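(* Let $m\ge 1$ and $N\ge 2m+1$, $N\geq 2$, be integers, $\Omega\subset\mathbb{R}^N$ a bounded smooth domain, and let $E_m$ be either $H^m_\vartheta(\Omega)$ or $H^m_0(\Omega)$. Let $f\in C(\overline\Omega\times\mathbb{R})$ satisfy both of the following conditions. (a) There exist $C_0>0$ and $s_0>0$ such that $|f(x,s)|\le C_0|s|^{\frac{N+2m}{N-2m}}$ for all $|s|\ge s_0$ and $x\in\Omega$. (b) There exist $C>0$ and $s_0>0$ such that for all $|s|>s_0$ and $x\in\Omega$, $$C|f(x,s)|^{\frac{2N}{N+2m}}\le sf(x,s)-2F(x,s)\quad\text{and}\quad sf(x,s)-2F(x,s)>0.$$ If $(u_n)$ is a sequence in $E_m$ such that $J(u_n)$ is bounded above and $J'(u_n)$ is bounded in the dual space $E_m'$, then $(u_n)$ is bounded in $E_m$.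
   Context: Spaces: $H^m_\vartheta(\Omega)=\{v\in H^m(\Omega):\Delta^j v=0 \text{ on }\partial\Omega \text{ for } j<m/2\}$ (Navier case) and $H^m_0(\Omega)=\{v\in H^m(\Omega):\nabla^j v=0\text{ on }\partial\Omega\text{ for }j=0,\dots,m-1\}$ (Dirichlet case). $E_m$ is a Hilbert space with scalar product $(u,v)_m=\int_\Omega(\Delta^l u)(\Delta^l v)$ if $m=2l$, and $(u,v)_m=\int_\Omega \nabla\Delta^l u\cdot\nabla\Delta^l v$ if $m=2l+1$; its norm is denoted $|\cdot|_m$, and its dual is $E_m'$. Put $F(x,s)=\int_0^s f(x,t)\,dt$. The energy functional is $J(u)=\frac12|u|_m^2-\int_\Omega F(x,u)\,dx$, which under condition (a) is well defined and of class $C^1$ on $E_m$, with $J'(u)\varphi=(u,\varphi)_m-\int_\Omega f(x,u)\varphi\,dx$. *)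

theory Defs
  imports "HOL-Analysis.Analysis"
begin

section \<open>Smooth functions and smooth domains\<close>

text \<open>A list of coordinates plays the role of a multi-index, its length being the order of the
  derivative; on smooth functions the order of the entries is irrelevant.\<close>

fun partials :: "'n list \<Rightarrow> (real^'n \<Rightarrow> real) \<Rightarrow> real^'n::finite \<Rightarrow> real" where
  "partials [] f = f"
| "partials (i # is) f = (\<lambda>x. frechet_derivative (partials is f) (at x) (axis i 1))"

definition smooth :: "(real^'n::finite \<Rightarrow> real) \<Rightarrow> bool" where
  "smooth f \<longleftrightarrow> (\<forall>is x. partials is f differentiable (at x))"

text \<open>Near each of its points the boundary is, after relabelling and reorienting the coordinate
  axes, the graph of a smooth function \<open>\<gamma>\<close> of the coordinates other than the \<open>i\<close>-th, and the
  open set lies on one side of this graph.\<close>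

definition smooth_boundary :: "(real^'n::finite) set \<Rightarrow> bool" where
  "smooth_boundary \<Omega> \<longleftrightarrow>
     (\<forall>z \<in> frontier \<Omega>. \<exists>r > 0. \<exists>i \<gamma>. smooth \<gamma> \<and> (\<forall>x t. \<gamma> (x + t *\<^sub>R axis i 1) = \<gamma> x) \<and>
        (\<Omega> \<inter> ball z r = {x \<in> ball z r. x $ i > \<gamma> x} \<or>
         \<Omega> \<inter> ball z r = {x \<in> ball z r. x $ i < \<gamma> x}))"

definition bounded_smooth_domain :: "(real^'n::finite) set \<Rightarrow> bool" where
  "bounded_smooth_domain \<Omega> \<longleftrightarrow>
     open \<Omega> \<and> connected \<Omega> \<and> \<Omega> \<noteq> {} \<and> bounded \<Omega> \<and> smooth_boundary \<Omega>"


section \<open>Weak derivatives and Sobolev spaces\<close>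

text \<open>Elements of \<open>L\<^sup>2(\<Omega>)\<close> and of the Sobolev spaces are represented by functions on the whole
  space. All notions below depend only on the values almost everywhere on \<open>\<Omega>\<close>.\<close>

definition L2 :: "(real^'n::finite) set \<Rightarrow> (real^'n \<Rightarrow> real) set" where
  "L2 \<Omega> = {u \<in> borel_measurable (lebesgue_on \<Omega>). integrable (lebesgue_on \<Omega>) (\<lambda>x. (u x)\<^sup>2)}"

definition test_functions :: "(real^'n::finite) set \<Rightarrow> (real^'n \<Rightarrow> real) set" where
  "test_functions \<Omega> =
     {\<phi>. smooth \<phi> \<and> compact (closure {x. \<phi> x \<noteq> 0}) \<and> closure {x. \<phi> x \<noteq> 0} \<subseteq> \<Omega>}"

definition has_weak_deriv ::
  "(real^'n::finite) set \<Rightarrow> 'n list \<Rightarrow> (real^'n \<Rightarrow> real) \<Rightarrow> (real^'n \<Rightarrow> real) \<Rightarrow> bool" where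
  "has_weak_deriv \<Omega> is u g \<longleftrightarrow> u \<in> L2 \<Omega> \<and> g \<in> L2 \<Omega> \<and>
     (\<forall>\<phi> \<in> test_functions \<Omega>.
        (\<integral>x. u x * partials is \<phi> x \<partial>lebesgue_on \<Omega>)
          = (-1) ^ length is * (\<integral>x. g x * \<phi> x \<partial>lebesgue_on \<Omega>))"

text \<open>Weak derivatives are unique up to null sets, so the choice is immaterial.\<close>

definition weak_deriv ::
  "(real^'n::finite) set \<Rightarrow> 'n list \<Rightarrow> (real^'n \<Rightarrow> real) \<Rightarrow> real^'n \<Rightarrow> real" where
  "weak_deriv \<Omega> is u = (SOME g. has_weak_deriv \<Omega> is u g)"

definition sobolev :: "nat \<Rightarrow> (real^'n::finite) set \<Rightarrow> (real^'n \<Rightarrow> real) set" where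
  "sobolev m \<Omega> = {u. \<forall>is. length is \<le> m \<longrightarrow> (\<exists>g. has_weak_deriv \<Omega> is u g)}"

definition laplacian ::
  "(real^'n::finite) set \<Rightarrow> (real^'n \<Rightarrow> real) \<Rightarrow> real^'n \<Rightarrow> real" where
  "laplacian \<Omega> u = (\<lambda>x. \<Sum>i\<in>UNIV. weak_deriv \<Omega> [i, i] u x)"

definition H1_norm :: "(real^'n::finite) set \<Rightarrow> (real^'n \<Rightarrow> real) \<Rightarrow> real" where
  "H1_norm \<Omega> u = sqrt ((\<integral>x. (u x)\<^sup>2 \<partial>lebesgue_on \<Omega>)
     + (\<integral>x. (\<Sum>i\<in>UNIV. (weak_deriv \<Omega> [i] u x)\<^sup>2) \<partial>lebesgue_on \<Omega>))"

text \<open>The meaning of \<open>v = 0 on \<partial>\<Omega>\<close> for \<open>v \<in> H\<^sup>1(\<Omega>)\<close>: \<open>v\<close> is the limit in \<open>H\<^sup>1(\<Omega>)\<close> of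
  functions that are smooth up to the boundary and vanish pointwise on it. On bounded smooth
  domains this is the kernel of the trace operator.\<close>

definition zero_on_boundary :: "(real^'n::finite) set \<Rightarrow> (real^'n \<Rightarrow> real) \<Rightarrow> bool" where
  "zero_on_boundary \<Omega> v \<longleftrightarrow> v \<in> sobolev 1 \<Omega> \<and>
     (\<exists>w :: nat \<Rightarrow> real^'n \<Rightarrow> real. (\<forall>k. smooth (w k) \<and> (\<forall>x \<in> frontier \<Omega>. w k x = 0)) \<and>
        (\<lambda>k. H1_norm \<Omega> (\<lambda>x. w k x - v x)) \<longlonglongrightarrow> 0)"

definition H_navier :: "nat \<Rightarrow> (real^'n::finite) set \<Rightarrow> (real^'n \<Rightarrow> real) set" where
  "H_navier m \<Omega> =
     {v \<in> sobolev m \<Omega>. \<forall>j. real j < real m / 2 \<longrightarrow> zero_on_boundary \<Omega> ((laplacian \<Omega> ^^ j) v)}"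

definition H_dirichlet :: "nat \<Rightarrow> (real^'n::finite) set \<Rightarrow> (real^'n \<Rightarrow> real) set" where
  "H_dirichlet m \<Omega> =
     {v \<in> sobolev m \<Omega>. \<forall>is. length is < m \<longrightarrow> zero_on_boundary \<Omega> (weak_deriv \<Omega> is v)}"

definition inner_m ::
  "nat \<Rightarrow> (real^'n::finite) set \<Rightarrow> (real^'n \<Rightarrow> real) \<Rightarrow> (real^'n \<Rightarrow> real) \<Rightarrow> real" where
  "inner_m m \<Omega> u v =
     (let U = (laplacian \<Omega> ^^ (m div 2)) u; V = (laplacian \<Omega> ^^ (m div 2)) v in
      if even m then (\<integral>x. U x * V x \<partial>lebesgue_on \<Omega>)
      else (\<integral>x. (\<Sum>i\<in>UNIV. weak_deriv \<Omega> [i] U x * weak_deriv \<Omega> [i] V x) \<partial>lebesgue_on \<Omega>))"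

definition norm_m :: "nat \<Rightarrow> (real^'n::finite) set \<Rightarrow> (real^'n \<Rightarrow> real) \<Rightarrow> real" where
  "norm_m m \<Omega> u = sqrt (inner_m m \<Omega> u u)"


section \<open>The energy functional and its derivative\<close>

definition primitive :: "('a \<Rightarrow> real \<Rightarrow> real) \<Rightarrow> 'a \<Rightarrow> real \<Rightarrow> real" where
  "primitive f x s = (LBINT t=ereal 0..ereal s. f x t)"

definition energy ::
  "nat \<Rightarrow> (real^'n::finite) set \<Rightarrow> (real^'n \<Rightarrow> real \<Rightarrow> real) \<Rightarrow> (real^'n \<Rightarrow> real) \<Rightarrow> real" where
  "energy m \<Omega> f u =
     1/2 * (norm_m m \<Omega> u)\<^sup>2 - (\<integral>x. primitive f x (u x) \<partial>lebesgue_on \<Omega>)"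

text \<open>Frechet differentiability at \<open>u\<close> of a functional \<open>J\<close> on a space \<open>E\<close> of functions, with
  respect to a norm \<open>p\<close> on \<open>E\<close>; \<open>L\<close> is the derivative, a bounded linear functional on \<open>E\<close>.\<close>

definition has_frechet_deriv_on ::
  "(('a \<Rightarrow> real) \<Rightarrow> real) \<Rightarrow> (('a \<Rightarrow> real) \<Rightarrow> real) \<Rightarrow> ('a \<Rightarrow> real) \<Rightarrow>
   ('a \<Rightarrow> real) set \<Rightarrow> (('a \<Rightarrow> real) \<Rightarrow> real) \<Rightarrow> bool" where
  "has_frechet_deriv_on J L u E p \<longleftrightarrow>
     (\<forall>\<phi>\<in>E. \<forall>\<psi>\<in>E. L (\<lambda>x. \<phi> x + \<psi> x) = L \<phi> + L \<psi>) \<and>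
     (\<forall>c. \<forall>\<phi>\<in>E. L (\<lambda>x. c * \<phi> x) = c * L \<phi>) \<and>
     (\<exists>K. \<forall>\<phi>\<in>E. \<bar>L \<phi>\<bar> \<le> K * p \<phi>) \<and>
     (\<forall>\<epsilon>>0. \<exists>\<delta>>0. \<forall>h\<in>E. p h < \<delta> \<longrightarrow> \<bar>J (\<lambda>x. u x + h x) - J u - L h\<bar> \<le> \<epsilon> * p h)"

text \<open>The derivative \<open>J'(u)\<close>, as a functional on \<open>E\<close>, where it is unique.\<close>

definition energy_deriv ::
  "(real^'n \<Rightarrow> real) set \<Rightarrow> nat \<Rightarrow> (real^'n::finite) set \<Rightarrow> (real^'n \<Rightarrow> real \<Rightarrow> real) \<Rightarrow>
   (real^'n \<Rightarrow> real) \<Rightarrow> (real^'n \<Rightarrow> real) \<Rightarrow> real" where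
  "energy_deriv E m \<Omega> f u =
     (SOME L. has_frechet_deriv_on (energy m \<Omega> f) L u E (norm_m m \<Omega>))"

end

theory Submission
  imports Defs
begin

text \<open>
  Write \<open>\<bar>u\<bar>\<close> for the norm of the energy space, \<open>p = 2N / (N - 2m)\<close> for the critical Sobolev exponent
  and \<open>q = 2N / (N + 2m)\<close> for its conjugate. Combining the two bounds,
  \<open>2 J(u) - J'(u) u = \<integral> (u f(x,u) - 2 F(x,u))\<close> grows at most linearly in \<open>\<bar>u\<bar>\<close>, and by condition (b)
  this integral controls \<open>\<integral> \<bar>f(x,u)\<bar>\<^sup>q\<close> up to a constant. Hence, by Hoelder's inequality and the
  Sobolev embedding into \<open>L\<^sup>p\<close>,
  \<open>\<bar>u\<bar>\<^sup>2 = J'(u) u + \<integral> u f(x,u) \<le> K \<bar>u\<bar> + S (a + b \<bar>u\<bar>)\<^sup>\<tau> \<bar>u\<bar>\<close> with \<open>\<tau> = 1/q < 1\<close>,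
  so \<open>\<bar>u\<bar>\<close> is bounded (lemmas \<open>bounded_energy_and_derivative_imp_bounded\<close> and
  \<open>sublinear_absorption\<close>). Two facts must be established for this: the embedding, and that \<open>J'(u)\<close>
  exists and has the expected value at \<open>u\<close>.

  The embedding (\<open>sobolev_embedding\<close>) is proved by iterating Laplacians. Every \<open>\<Delta>\<^sup>j u\<close> with \<open>2j < m\<close>
  vanishes on the boundary, for the Dirichlet space as well as for the Navier space. So it is enough to
  pass from \<open>\<Delta>\<^sup>l u\<close> with \<open>l = m div 2\<close> to \<open>u\<close>, undoing one Laplacian after the other: if \<open>-\<Delta>v = g\<close> and
  \<open>v = 0\<close> on the boundary, then the norm of \<open>v\<close> in \<open>L\<^sup>s\<close> is at most a constant times that of \<open>g\<close> in
  \<open>L\<^sup>r\<close>, where \<open>1/s = 1/r - 2/N\<close> (\<open>elliptic_estimate\<close>). This step is Moser's: test the equation with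
  \<open>H(v)\<close>, where \<open>H' = (\<Phi>')\<^sup>2\<close> and \<open>\<Phi>\<close> is a power truncated at height \<open>M\<close>, apply Sobolev's inequality
  to \<open>\<Phi>(v)\<close>, absorb, and let \<open>M\<close> tend to infinity (\<open>nonlinear_bound\<close>). The
  computation is made for the smooth functions \<open>w\<^sub>k\<close> approximating \<open>v\<close>, for which the chain rule is
  classical, with an error that tends to zero. It has to be shown that \<open>H(w\<^sub>k)\<close> may be
  used as a test function (\<open>minus_div_comp\<close>): approximate \<open>H\<close> by polynomials and cut off where
  \<open>w\<^sub>k\<close> is small, in particular near the boundary.

  Sobolev's inequality for \<open>\<Phi>(w)\<close>, with \<open>w\<close> smooth and zero on the boundary, comes from the
  Gagliardo-Nirenberg inequality (\<open>sobolev_composition\<close>, \<open>gagliardo_nirenberg\<close>). Each value of the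
  function is bounded by the integral of its gradient along every coordinate line through the point,
  because the line leaves the bounded open set, and the line integrals are combined by induction on the
  coordinates (\<open>gridlines\<close>).

  For the derivative of \<open>J\<close> the growth condition (a) makes \<open>u \<mapsto> f(x,u)\<close> continuous from \<open>L\<^sup>p\<close> to
  \<open>L\<^sup>q\<close> in the form needed here (\<open>difference_quotient_small\<close>). The derivative is unique in the
  direction \<open>u\<close> (\<open>frechet_deriv_on_ray_unique\<close>), so its value at \<open>u\<close> does not depend on how it was
  chosen.
\<close>

section \<open>Calculus of smooth functions\<close>

abbreviation pd :: "'n \<Rightarrow> (real^'n::finite \<Rightarrow> real) \<Rightarrow> real^'n \<Rightarrow> real" where
  "pd i f \<equiv> (\<lambda>x. frechet_derivative f (at x) (axis i 1))"

lemma partials_append: "partials (is @ js) f = partials is (partials js f)"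
  by (induction "is") simp_all

text \<open>Smoothness is the largest property that implies differentiability and passes to partial
  derivatives, so it can be verified one derivative at a time.\<close>

lemma smooth_coinduct:
  assumes "P f"
    and step: "\<And>g. P g \<Longrightarrow> (\<forall>x. g differentiable (at x)) \<and> (\<forall>i. P (pd i g))"
  shows "smooth f"
proof -
  have "P (partials is f)" for "is"
    by (induction "is") (use assms in auto)
  with step show ?thesis unfolding smooth_def by blast
qed

lemma smooth_partials: "smooth f \<Longrightarrow> smooth (partials is f)"
  unfolding smooth_def by (metis partials_append)

lemma smooth_pd: "smooth f \<Longrightarrow> smooth (pd i f)"
  using smooth_partials[of f "[i]"] by simp

lemma smooth_differentiable: "smooth f \<Longrightarrow> f differentiable (at x)"
  unfolding smooth_def by (metis partials.simps(1))

lemma smooth_continuous_on: "smooth f \<Longrightarrow> continuous_on S f"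
  by (meson continuous_at_imp_continuous_on differentiable_imp_continuous_within smooth_differentiable)

lemma pd_eqI: "(f has_derivative f') (at x) \<Longrightarrow> pd i f x = f' (axis i 1)"
  using frechet_derivative_at by metis

lemma smooth_has_derivative: "smooth f \<Longrightarrow> (f has_derivative frechet_derivative f (at x)) (at x)"
  using frechet_derivative_works smooth_differentiable by blast

definition smooth1 :: "(real \<Rightarrow> real) \<Rightarrow> bool" where
  "smooth1 G \<longleftrightarrow> (\<forall>k x. (deriv ^^ k) G field_differentiable (at x))"

lemma smooth1_deriv: "smooth1 G \<Longrightarrow> smooth1 (deriv G)"
  unfolding smooth1_def by (metis funpow_Suc_right o_apply)

lemma smooth1_has_derivative: "smooth1 G \<Longrightarrow> (G has_real_derivative deriv G x) (at x)"
  unfolding smooth1_def by (metis DERIV_deriv_iff_field_differentiable funpow_0)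

text \<open>The set of functions built from smooth ones by sums, products and composition with smooth
  functions of one variable is stable under partial differentiation; this yields all closure
  properties of smooth functions at once.\<close>

inductive_set smooth_alg :: "(real^'n::finite \<Rightarrow> real) set" where
  base: "smooth f \<Longrightarrow> f \<in> smooth_alg"
| add: "f \<in> smooth_alg \<Longrightarrow> g \<in> smooth_alg \<Longrightarrow> (\<lambda>x. f x + g x) \<in> smooth_alg"
| mult: "f \<in> smooth_alg \<Longrightarrow> g \<in> smooth_alg \<Longrightarrow> (\<lambda>x. f x * g x) \<in> smooth_alg"
| comp: "f \<in> smooth_alg \<Longrightarrow> smooth1 G \<Longrightarrow> (\<lambda>x. G (f x)) \<in> smooth_alg"

lemma has_derivative_comp_real:
  assumes "(f has_derivative f') (at x)" "(G has_real_derivative d) (at (f x))"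
  shows "((\<lambda>x. G (f x)) has_derivative (\<lambda>v. d * f' v)) (at x)"
  using has_derivative_compose[OF assms(1), of G "(*) d"] assms(2)
  by (simp add: has_field_derivative_def)

lemma smooth_alg_step:
  "g \<in> smooth_alg \<Longrightarrow> (\<forall>x. g differentiable (at x)) \<and> (\<forall>i. pd i g \<in> smooth_alg)"
proof (induction rule: smooth_alg.induct)
  case (base f)
  then show ?case by (simp add: smooth_differentiable smooth_pd smooth_alg.base)
next
  case (add f g)
  have d: "((\<lambda>x. f x + g x) has_derivative
     (\<lambda>v. frechet_derivative f (at x) v + frechet_derivative g (at x) v)) (at x)" for x
    using add.IH by (intro has_derivative_add) (simp_all add: frechet_derivative_works[symmetric])
  have "pd i (\<lambda>x. f x + g x) = (\<lambda>x. pd i f x + pd i g x)" for i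
    by (rule ext) (rule pd_eqI[OF d])
  then show ?case
    using d add.IH by (auto intro: smooth_alg.add simp: differentiable_def)
next
  case (mult f g)
  have d: "((\<lambda>x. f x * g x) has_derivative
     (\<lambda>v. f x * frechet_derivative g (at x) v + frechet_derivative f (at x) v * g x)) (at x)" for x
    using mult.IH by (intro has_derivative_mult) (simp_all add: frechet_derivative_works[symmetric])
  have "pd i (\<lambda>x. f x * g x) = (\<lambda>x. f x * pd i g x + pd i f x * g x)" for i
    by (rule ext) (rule pd_eqI[OF d])
  then show ?case
    using d mult smooth_alg.add[OF smooth_alg.mult smooth_alg.mult, of f _ _ g]
    by (simp add: differentiable_def) blast
next
  case (comp f G)
  have d: "((\<lambda>x. G (f x)) has_derivative
     (\<lambda>v. deriv G (f x) * frechet_derivative f (at x) v)) (at x)" for x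
    using comp by (intro has_derivative_comp_real smooth1_has_derivative)
      (simp_all add: frechet_derivative_works[symmetric])
  have "pd i (\<lambda>x. G (f x)) = (\<lambda>x. deriv G (f x) * pd i f x)" for i
    by (rule ext) (rule pd_eqI[OF d])
  then show ?case
    using d comp smooth_alg.mult[OF smooth_alg.comp[OF _ smooth1_deriv]]
    by (simp add: differentiable_def) blast
qed

lemma smooth_alg_smooth: "f \<in> smooth_alg \<Longrightarrow> smooth f"
  by (rule smooth_coinduct[where P = "\<lambda>f. f \<in> smooth_alg"]) (use smooth_alg_step in auto)

lemma smooth_add: "smooth f \<Longrightarrow> smooth g \<Longrightarrow> smooth (\<lambda>x. f x + g x)"
  and smooth_mult: "smooth f \<Longrightarrow> smooth g \<Longrightarrow> smooth (\<lambda>x. f x * g x)"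
  and smooth_comp: "smooth f \<Longrightarrow> smooth1 G \<Longrightarrow> smooth (\<lambda>x. G (f x))"
  by (simp_all add: smooth_alg.intros smooth_alg_smooth)

lemma smooth_const: "smooth (\<lambda>x. c)"
  by (rule smooth_coinduct[where P = "\<lambda>f. \<exists>c. f = (\<lambda>x. c)"]) auto

lemma smooth_component: "smooth (\<lambda>x. x $ i)"
proof (rule smooth_coinduct[where P = "\<lambda>f. f = (\<lambda>x. x $ i) \<or> smooth f"], goal_cases)
  case (2 g)
  have d: "((\<lambda>x. x $ i) has_derivative (\<lambda>v. v $ i)) (at x)" for x
    by (rule bounded_linear.has_derivative[OF bounded_linear_vec_nth has_derivative_ident])
  have "pd k (\<lambda>x. x $ i) = (\<lambda>x. axis k 1 $ i)" for k
    by (rule ext) (rule pd_eqI[OF d])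
  then show ?case using 2 d
    by (auto simp: differentiable_def smooth_const smooth_pd smooth_differentiable[unfolded differentiable_def])
qed simp

lemma smooth_prod: "(\<And>i. i \<in> I \<Longrightarrow> smooth (f i)) \<Longrightarrow> smooth (\<lambda>x. \<Prod>i\<in>I. f i x)"
  by (induction I rule: infinite_finite_induct) (auto simp: smooth_const intro: smooth_mult)

lemma smooth_diff: "smooth f \<Longrightarrow> smooth g \<Longrightarrow> smooth (\<lambda>x. f x - g x)"
  using smooth_add[of f "\<lambda>x. (-1) * g x"] smooth_mult[OF smooth_const[of "-1"], of g] by simp

lemma smooth_power: "smooth f \<Longrightarrow> smooth (\<lambda>x. f x ^ k)"
  by (induction k) (auto simp: smooth_const intro: smooth_mult)

lemma smooth_poly: "smooth f \<Longrightarrow> smooth (\<lambda>x. poly p (f x))"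
  by (induction p) (auto simp: smooth_const intro: smooth_mult smooth_add)

lemma pd_add: "smooth f \<Longrightarrow> smooth g \<Longrightarrow> pd i (\<lambda>x. f x + g x) x = pd i f x + pd i g x"
  and pd_cmult: "smooth f \<Longrightarrow> pd i (\<lambda>x. c * f x) x = c * pd i f x"
  and pd_mult: "smooth f \<Longrightarrow> smooth g \<Longrightarrow> pd i (\<lambda>x. f x * g x) x = f x * pd i g x + pd i f x * g x"
  and pd_comp: "smooth f \<Longrightarrow> (G has_real_derivative d) (at (f x)) \<Longrightarrow> pd i (\<lambda>x. G (f x)) x = d * pd i f x"
proof -
  show "smooth f \<Longrightarrow> smooth g \<Longrightarrow> pd i (\<lambda>x. f x + g x) x = pd i f x + pd i g x"
    by (rule pd_eqI) (intro has_derivative_add smooth_has_derivative)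
  show "smooth f \<Longrightarrow> pd i (\<lambda>x. c * f x) x = c * pd i f x"
    by (rule pd_eqI) (intro has_derivative_mult_right smooth_has_derivative)
  show "smooth f \<Longrightarrow> smooth g \<Longrightarrow> pd i (\<lambda>x. f x * g x) x = f x * pd i g x + pd i f x * g x"
    by (rule pd_eqI) (intro has_derivative_mult smooth_has_derivative)
  show "smooth f \<Longrightarrow> (G has_real_derivative d) (at (f x)) \<Longrightarrow> pd i (\<lambda>x. G (f x)) x = d * pd i f x"
    by (rule pd_eqI) (intro has_derivative_comp_real smooth_has_derivative)
qed

subsection \<open>A smooth function vanishing on a half-line\<close>

text \<open>The derivatives of \<open>exp (- 1/t)\<close>, extended by zero, all have this form.\<close>

definition poly_exp :: "real poly \<Rightarrow> real \<Rightarrow> real" where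
  "poly_exp p t = (if t > 0 then poly p (1 / t) * exp (- (1 / t)) else 0)"

lemma poly_exp_decay: "((\<lambda>y::real. poly p y * exp (- y)) \<longlongrightarrow> 0) at_top"
proof -
  have "((\<lambda>y::real. y ^ k * (poly p y * exp (- y))) \<longlongrightarrow> 0) at_top" for k
  proof (induction p arbitrary: k)
    case (pCons a p)
    have "((\<lambda>y::real. a * (y ^ k / exp y) + y ^ Suc k * (poly p y * exp (- y))) \<longlongrightarrow> a * 0 + 0) at_top"
      by (intro tendsto_intros tendsto_power_div_exp_0 pCons.IH)
    then show ?case by (simp add: algebra_simps exp_minus divide_inverse)
  qed simp
  from this[of 0] show ?thesis by simp
qed

text \<open>At the origin, the quotient is again a polynomial in \<open>1/t\<close> times \<open>exp (- 1/t)\<close>, so it vanishes in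
  the limit.\<close>

lemma poly_exp_has_derivative:
  "(poly_exp p has_real_derivative poly_exp ([:0, 0, 1:] * (p - pderiv p)) t) (at t)"
proof -
  consider "t > 0" | "t < 0" | "t = 0" by linarith
  then show ?thesis
  proof cases
    case 1
    have "((\<lambda>t. poly p (1 / t) * exp (- (1 / t))) has_real_derivative
        poly ([:0, 0, 1:] * (p - pderiv p)) (1 / t) * exp (- (1 / t))) (at t)"
      using 1 by (auto intro!: derivative_eq_intros DERIV_chain2[OF poly_DERIV]
          simp: field_simps power2_eq_square)
    then have "(poly_exp p has_real_derivative
        poly ([:0, 0, 1:] * (p - pderiv p)) (1 / t) * exp (- (1 / t))) (at t)"
      by (rule has_field_derivative_transform_within_open[of _ _ _ "{0<..}"])
        (use 1 in \<open>auto simp: poly_exp_def\<close>)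
    then show ?thesis using 1 by (simp add: poly_exp_def)
  next
    case 2
    have "(poly_exp p has_real_derivative 0) (at t)"
      by (rule has_field_derivative_transform_within_open[of "\<lambda>_. 0" _ _ "{..<0}"])
        (use 2 in \<open>auto simp: poly_exp_def\<close>)
    then show ?thesis using 2 by (simp add: poly_exp_def)
  next
    case 3
    have "((\<lambda>h::real. poly ([:0, 1:] * p) (inverse h) * exp (- inverse h)) \<longlongrightarrow> 0) (at_right 0)"
      by (rule filterlim_compose[OF poly_exp_decay filterlim_inverse_at_top_right])
    then have r: "((\<lambda>h. poly_exp p h / h) \<longlongrightarrow> 0) (at_right 0)"
      by (rule Lim_transform_eventually)
        (auto simp: eventually_at_right_field poly_exp_def field_simps intro!: exI[of _ 1])
    have "((\<lambda>h. poly_exp p h / h) \<longlongrightarrow> 0) (at_left 0)"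
      by (rule Lim_transform_eventually[OF tendsto_const])
        (auto simp: eventually_at_left_field poly_exp_def intro!: exI[of _ "-1"])
    with r have "((\<lambda>h. poly_exp p h / h) \<longlongrightarrow> 0) (at 0)"
      by (simp add: filterlim_at_split)
    then show ?thesis using 3 by (simp add: DERIV_def poly_exp_def)
  qed
qed

definition flat :: "real \<Rightarrow> real" where "flat = poly_exp 1"

lemma flat_eq: "flat t = (if t > 0 then exp (- (1 / t)) else 0)"
  by (simp add: flat_def poly_exp_def)

lemma smooth1_flat: "smooth1 flat"
proof -
  have "\<exists>q. (deriv ^^ k) flat = poly_exp q" for k
  proof (induction k)
    case (Suc k)
    then obtain q where "(deriv ^^ k) flat = poly_exp q" by blast
    then have "(deriv ^^ Suc k) flat = poly_exp ([:0, 0, 1:] * (q - pderiv q))"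
      using DERIV_imp_deriv[OF poly_exp_has_derivative] by auto
    then show ?case by blast
  qed (auto simp: flat_def)
  then show ?thesis
    unfolding smooth1_def field_differentiable_def using poly_exp_has_derivative by metis
qed

lemma flat_nonneg: "flat t \<ge> 0" and flat_le_1: "flat t \<le> 1"
  by (auto simp: flat_eq)

lemma flat_tendsto_1: "(flat \<longlongrightarrow> 1) at_top"
proof -
  have "((\<lambda>t::real. exp (- inverse t)) \<longlongrightarrow> exp (- 0)) at_top"
    by (intro tendsto_intros tendsto_inverse_0_at_top filterlim_ident)
  then have "((\<lambda>t::real. exp (- inverse t)) \<longlongrightarrow> 1) at_top" by simp
  then show ?thesis
    by (rule Lim_transform_eventually)
       (use eventually_gt_at_top[of 0] in \<open>auto simp: flat_eq divide_inverse elim: eventually_mono\<close>)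
qed

lemma flat_deriv: "(flat has_real_derivative (if t > 0 then exp (- (1 / t)) / t\<^sup>2 else 0)) (at t)"
  using poly_exp_has_derivative[of 1 t]
  by (cases "t > 0") (simp_all add: flat_def poly_exp_def power2_eq_square mult_ac pderiv_1)

section \<open>Weak derivatives on bounded open sets\<close>

text \<open>The sets over which \<open>h\<close> has integral zero form a Dynkin system, and the boxes are a generator
  stable under intersection.\<close>

lemma integral_zero_on_boxes_imp_AE_zero:
  fixes h :: "'a::euclidean_space \<Rightarrow> real"
  assumes h: "integrable lborel h"
    and total: "(\<integral>x. h x \<partial>lborel) = 0"
    and boxes: "\<And>a b. (\<integral>x. indicator (box a b) x * h x \<partial>lborel) = 0"
  shows "AE x in lborel. h x = 0"
proof (rule sigma_finite_measure.density_zero[OF lborel.sigma_finite_measure_axioms h])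
  fix A :: "'a set" assume A: "A \<in> sets lborel"
  define G where "G = range (\<lambda>(a, b). box a b :: 'a set)"
  have ind: "integrable lborel (\<lambda>x. indicator B x * h x)" if "B \<in> sets borel" for B
    using integrable_mult_indicator[OF _ h, of B] that by simp
  have "Int_stable G"
    unfolding Int_stable_def G_def by (auto simp: box_Int_box)
  moreover have "G \<subseteq> Pow UNIV" by simp
  moreover have "A \<in> sigma_sets UNIV G"
    using A unfolding sets_lborel borel_eq_box G_def by simp
  ultimately have "A \<in> sets lborel \<and> (\<integral>x\<in>A. h x \<partial>lborel) = 0"
  proof (induction rule: sigma_sets_induct_disjoint)
    case (basic A)
    then show ?case using boxes by (auto simp: G_def set_lebesgue_integral_def)
  next
    case empty
    then show ?case by (simp add: set_lebesgue_integral_def)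
  next
    case (compl A)
    have "(\<integral>x\<in>UNIV. h x \<partial>lborel) = (\<integral>x\<in>A. h x \<partial>lborel) + (\<integral>x\<in>UNIV - A. h x \<partial>lborel)"
      using compl by (subst set_integral_Un[symmetric])
        (auto simp: set_integrable_def ind)
    then show ?case using compl total by (auto simp: set_lebesgue_integral_def)
  next
    case (union A)
    then have "(\<Union>i. A i) \<in> sets borel" by auto
    with union have "(\<integral>x\<in>(\<Union>i. A i). h x \<partial>lborel) = (\<Sum>i. (\<integral>x\<in>A i. h x \<partial>lborel))"
      by (intro lebesgue_integral_countable_add)
        (auto simp: set_integrable_def disjoint_family_on_def ind)
    then show ?case using union by auto
  qed
  then show "set_lebesgue_integral lborel A h = 0" by simp
qed

lemma abs_mult_le_squares: "\<bar>a * b\<bar> \<le> a\<^sup>2 + (b::real)\<^sup>2"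
proof -
  have "2 * (\<bar>a\<bar> * \<bar>b\<bar>) \<le> \<bar>a\<bar>\<^sup>2 + \<bar>b\<bar>\<^sup>2"
    using sum_squares_bound[of "\<bar>a\<bar>" "\<bar>b\<bar>"] by (simp add: mult.assoc)
  moreover have "0 \<le> \<bar>a\<bar> * \<bar>b\<bar>" by simp
  ultimately show ?thesis unfolding abs_mult by (simp only: power2_abs)
qed

locale bounded_open =
  fixes \<Omega> :: "(real^'n::finite) set"
  assumes open_dom: "open \<Omega>" and bounded_dom: "bounded \<Omega>"
begin

abbreviation "M \<equiv> lebesgue_on \<Omega>"

sublocale finite_measure M
  using bounded_dom open_dom by (intro finite_measure_lebesgue_on lmeasurable_open)

lemma dom_sets [simp, measurable]: "\<Omega> \<in> sets lebesgue" "\<Omega> \<in> sets lborel" "\<Omega> \<in> sets borel"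
  using open_dom by (auto simp: borel_open)

lemma AE_M_iff: "(AE x in M. P x) \<longleftrightarrow> (AE x in lborel. x \<in> \<Omega> \<longrightarrow> P x)"
  by (simp add: AE_restrict_space_iff AE_completion_iff)

lemma AE_M_I: "(\<And>x. x \<in> \<Omega> \<Longrightarrow> P x) \<Longrightarrow> AE x in M. P x"
  by (simp add: AE_M_iff)

lemma continuous_measurable: "continuous_on \<Omega> f \<Longrightarrow> f \<in> borel_measurable M"
  by (rule continuous_imp_measurable_on_sets_lebesgue) simp_all

lemma smooth_measurable: "smooth f \<Longrightarrow> f \<in> borel_measurable M"
  by (simp add: continuous_measurable smooth_continuous_on)

lemma continuous_bounded:
  fixes f :: "_ \<Rightarrow> real"
  assumes "continuous_on (closure \<Omega>) f"
  obtains B where "B > 0" "\<And>x. x \<in> closure \<Omega> \<Longrightarrow> \<bar>f x\<bar> \<le> B"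
proof -
  have "bounded (f ` closure \<Omega>)"
    using assms bounded_dom by (intro compact_imp_bounded compact_continuous_image) simp_all
  then show ?thesis using that by (auto simp: bounded_pos)
qed

lemma integrable_bounded:
  fixes f :: "_ \<Rightarrow> real"
  assumes "f \<in> borel_measurable M" "\<And>x. x \<in> \<Omega> \<Longrightarrow> \<bar>f x\<bar> \<le> B"
  shows "integrable M f"
  using assms by (intro integrable_const_bound[of _ B]) (auto intro: AE_M_I)

lemma continuous_integrable:
  fixes f :: "_ \<Rightarrow> real"
  assumes "continuous_on (closure \<Omega>) f"
  shows "integrable M f"
proof -
  obtain B where "\<And>x. x \<in> closure \<Omega> \<Longrightarrow> \<bar>f x\<bar> \<le> B" using continuous_bounded[OF assms] by metis
  moreover have "continuous_on \<Omega> f" using assms closure_subset continuous_on_subset by blast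
  ultimately show ?thesis using closure_subset by (intro integrable_bounded[of _ B]) (auto intro: continuous_measurable)
qed

lemma integral_M_eq_lborel:
  fixes f :: "_ \<Rightarrow> real"
  assumes "f \<in> borel_measurable borel"
  shows "(\<integral>x. f x \<partial>M) = (\<integral>x. indicator \<Omega> x * f x \<partial>lborel)"
proof -
  have "(\<integral>x. f x \<partial>M) = (\<integral>x. indicator \<Omega> x *\<^sub>R f x \<partial>lebesgue)"
    by (rule integral_restrict_space) simp
  also have "\<dots> = (\<integral>x. indicator \<Omega> x *\<^sub>R f x \<partial>lborel)"
    using assms by (intro integral_completion) simp
  finally show ?thesis by simp
qed

lemma nn_integral_M_lborel:
  assumes "f \<in> borel_measurable borel"
  shows "(\<integral>\<^sup>+x. f x \<partial>M) = (\<integral>\<^sup>+x. indicator \<Omega> x * f x \<partial>lborel)"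
  by (simp add: nn_integral_restrict_space nn_integral_completion mult.commute)

subsection \<open>Square integrable functions\<close>

lemma L2_measurable [measurable_dest]: "f \<in> L2 \<Omega> \<Longrightarrow> f \<in> borel_measurable M"
  by (simp add: L2_def)

lemma L2_square_integrable: "f \<in> L2 \<Omega> \<Longrightarrow> integrable M (\<lambda>x. (f x)\<^sup>2)"
  by (simp add: L2_def)

lemma L2_mult_integrable:
  assumes "f \<in> L2 \<Omega>" "g \<in> L2 \<Omega>"
  shows "integrable M (\<lambda>x. f x * g x)"
proof (rule Bochner_Integration.integrable_bound)
  show "integrable M (\<lambda>x. (f x)\<^sup>2 + (g x)\<^sup>2)" using assms by (simp add: L2_def)
  show "(\<lambda>x. f x * g x) \<in> borel_measurable M"
    using assms by (intro borel_measurable_times) (simp_all add: L2_measurable)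
  show "AE x in M. norm (f x * g x) \<le> norm ((f x)\<^sup>2 + (g x)\<^sup>2)"
    using abs_mult_le_squares by (auto simp: abs_of_nonneg)
qed

lemma L2_add: "f \<in> L2 \<Omega> \<Longrightarrow> g \<in> L2 \<Omega> \<Longrightarrow> (\<lambda>x. f x + g x) \<in> L2 \<Omega>"
  using L2_mult_integrable[of f g]
  by (auto simp: L2_def power2_sum mult.assoc)

lemma L2_cmult: "f \<in> L2 \<Omega> \<Longrightarrow> (\<lambda>x. c * f x) \<in> L2 \<Omega>"
  by (auto simp: L2_def power_mult_distrib)

lemma L2_diff: "f \<in> L2 \<Omega> \<Longrightarrow> g \<in> L2 \<Omega> \<Longrightarrow> (\<lambda>x. f x - g x) \<in> L2 \<Omega>"
  using L2_add[of f "\<lambda>x. (-1) * g x"] L2_cmult[of g "-1"] by simp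

lemma L2_zero: "(\<lambda>x. 0) \<in> L2 \<Omega>" by (simp add: L2_def)

lemma L2_sum: "(\<And>i. i \<in> I \<Longrightarrow> f i \<in> L2 \<Omega>) \<Longrightarrow> (\<lambda>x. \<Sum>i\<in>I. f i x) \<in> L2 \<Omega>"
proof (induction I rule: infinite_finite_induct)
  case (insert a I)
  then show ?case using L2_add[of "f a" "\<lambda>x. \<Sum>i\<in>I. f i x"] by simp
qed (simp_all add: L2_zero)

lemma continuous_L2:
  assumes "continuous_on (closure \<Omega>) f" shows "f \<in> L2 \<Omega>"
  using assms closure_subset[of \<Omega>] continuous_on_subset[OF assms]
  unfolding L2_def by (auto intro!: continuous_measurable continuous_integrable continuous_intros)

lemma smooth_L2: "smooth f \<Longrightarrow> f \<in> L2 \<Omega>"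
  by (intro continuous_L2 smooth_continuous_on)

lemma L2_integrable: "f \<in> L2 \<Omega> \<Longrightarrow> integrable M f"
  using L2_mult_integrable[of f "\<lambda>x. 1"] continuous_L2[of "\<lambda>x. 1"] by simp

lemma L2_AE_cong:
  assumes "f \<in> L2 \<Omega>" "g \<in> borel_measurable M" "AE x in M. f x = g x"
  shows "g \<in> L2 \<Omega>"
proof -
  have "integrable M (\<lambda>x. (g x)\<^sup>2)"
    by (rule integrable_cong_AE_imp[OF L2_square_integrable[OF assms(1)]])
       (use assms in auto)
  then show ?thesis using assms by (simp add: L2_def)
qed

subsection \<open>Test functions\<close>

lemma test_smooth: "\<phi> \<in> test_functions \<Omega> \<Longrightarrow> smooth \<phi>"
  by (simp add: test_functions_def)

lemma test_zero_outside: "\<phi> \<in> test_functions \<Omega> \<Longrightarrow> x \<notin> \<Omega> \<Longrightarrow> \<phi> x = 0"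
  using closure_subset[of "{x. \<phi> x \<noteq> 0}"] by (auto simp: test_functions_def)

lemma test_functionsI:
  assumes "smooth \<phi>" "compact K" "K \<subseteq> \<Omega>" "\<And>x. x \<notin> K \<Longrightarrow> \<phi> x = 0"
  shows "\<phi> \<in> test_functions \<Omega>"
proof -
  have "closure {x. \<phi> x \<noteq> 0} \<subseteq> K"
    by (rule closure_minimal) (use assms compact_imp_closed in auto)
  moreover have "compact (closure {x. \<phi> x \<noteq> 0})"
    using calculation compact_Int_closed[OF assms(2) closed_closure[of "{x. \<phi> x \<noteq> 0}"]]
    by (simp add: Int_absorb1 Int_commute)
  ultimately show ?thesis using assms by (auto simp: test_functions_def)
qed

lemma pd_zero_off_support:
  assumes "smooth \<phi>" "x \<notin> closure {x. \<phi> x \<noteq> 0}"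
  shows "pd i \<phi> x = 0"
proof -
  have "(\<phi> has_derivative (\<lambda>v. 0)) (at x)"
    by (rule has_derivative_transform_within_open[of "\<lambda>_. 0" _ _ _ "- closure {x. \<phi> x \<noteq> 0}"])
       (use assms closure_subset[of "{x. \<phi> x \<noteq> 0}"] in auto)
  from pd_eqI[OF this] show ?thesis .
qed

lemma test_pd: "\<phi> \<in> test_functions \<Omega> \<Longrightarrow> pd i \<phi> \<in> test_functions \<Omega>"
  by (rule test_functionsI[of _ "closure {x. \<phi> x \<noteq> 0}"])
     (auto simp: test_functions_def smooth_pd pd_zero_off_support)

lemma test_partials: "\<phi> \<in> test_functions \<Omega> \<Longrightarrow> partials is \<phi> \<in> test_functions \<Omega>"
  by (induction "is") (auto simp: test_pd)

lemma test_mult_smooth: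
  "\<phi> \<in> test_functions \<Omega> \<Longrightarrow> smooth w \<Longrightarrow> (\<lambda>x. w x * \<phi> x) \<in> test_functions \<Omega>"
  by (rule test_functionsI[of _ "closure {x. \<phi> x \<noteq> 0}"])
     (use closure_subset[of "{x. \<phi> x \<noteq> 0}"] in \<open>auto simp: test_functions_def intro: smooth_mult\<close>)

lemma test_L2: "\<phi> \<in> test_functions \<Omega> \<Longrightarrow> \<phi> \<in> L2 \<Omega>"
  by (simp add: smooth_L2 test_smooth)

lemma test_bounded:
  assumes "\<phi> \<in> test_functions \<Omega>"
  obtains B where "B > 0" "\<And>x. \<bar>\<phi> x\<bar> \<le> B"
proof -
  obtain B where "B > 0" "\<And>x. x \<in> closure \<Omega> \<Longrightarrow> \<bar>\<phi> x\<bar> \<le> B"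
    using continuous_bounded[OF smooth_continuous_on[OF test_smooth[OF assms]]] by metis
  then have "\<bar>\<phi> x\<bar> \<le> B" for x
    using test_zero_outside[OF assms] closure_subset by (cases "x \<in> \<Omega>") auto
  then show ?thesis using that \<open>B > 0\<close> by blast
qed

lemma smooth_line_derivative:
  fixes f :: "real^'n \<Rightarrow> real"
  assumes "smooth f"
  shows "((\<lambda>t. f (x + t *\<^sub>R axis i 1)) has_real_derivative pd i f (x + t *\<^sub>R axis i 1)) (at t)"
proof -
  have "((\<lambda>t. x + t *\<^sub>R axis i 1 :: real^'n) has_derivative (\<lambda>h. h *\<^sub>R axis i 1)) (at t)"
    by (auto intro!: derivative_eq_intros)
  from has_derivative_compose[OF this smooth_has_derivative[OF assms]]
  have "((\<lambda>t. f (x + t *\<^sub>R axis i 1)) has_derivative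
      (\<lambda>h. frechet_derivative f (at (x + t *\<^sub>R axis i 1)) (h *\<^sub>R axis i 1))) (at t)" .
  moreover have "linear (frechet_derivative f (at (x + t *\<^sub>R axis i 1)))"
    by (rule linear_frechet_derivative) (rule smooth_differentiable[OF assms])
  ultimately show ?thesis
    by (simp add: has_field_derivative_def linear_cmul mult_commute_abs)
qed

text \<open>The integral of each difference quotient of \<open>\<phi>\<close> is zero because Lebesgue measure is invariant under
  translations. Dominated convergence passes to the derivative.\<close>

lemma test_integral_pd:
  assumes \<phi>: "\<phi> \<in> test_functions \<Omega>"
  shows "(\<integral>x. pd i \<phi> x \<partial>M) = 0"
proof -
  let ?e = "axis i 1 :: real^'n"
  have sm: "smooth \<phi>" by (rule test_smooth[OF \<phi>])
  have [measurable]: "\<phi> \<in> borel_measurable borel" "pd i \<phi> \<in> borel_measurable borel"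
    using sm by (auto intro!: borel_measurable_continuous_onI smooth_continuous_on smooth_pd)
  obtain B where B: "\<And>x. \<bar>pd i \<phi> x\<bar> \<le> B" using test_bounded[OF test_pd[OF \<phi>]] by metis
  have B0: "B \<ge> 0" using B[of undefined] by linarith
  obtain R where R: "\<And>x. x \<in> \<Omega> \<Longrightarrow> norm x \<le> R" using bounded_dom by (auto simp: bounded_iff)
  define q where "q k x = (\<phi> (x + (1 / Suc k) *\<^sub>R ?e) - \<phi> x) / (1 / real (Suc k))" for k x
  have supp: "\<phi> x = 0" if "norm x > R" for x
    using test_zero_outside[OF \<phi>] R that by force
  have int\<phi>: "integrable lborel \<phi>"
  proof -
    obtain C where C: "\<And>x. \<bar>\<phi> x\<bar> \<le> C" using test_bounded[OF \<phi>] by metis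
    show ?thesis
  proof (rule integrableI_bounded_set[where A = "cball 0 R"])
    show "AE x in lborel. x \<in> cball 0 R \<longrightarrow> norm (\<phi> x) \<le> C" using C by simp
    show "emeasure lborel (cball 0 R) < \<infinity>" by (rule emeasure_bounded_finite) simp
  qed (use supp in auto)
  qed
  have int_shift: "integrable lborel (\<lambda>x. \<phi> (x + v))" and
    shift: "(\<integral>x. \<phi> (x + v) \<partial>lborel) = (\<integral>x. \<phi> x \<partial>lborel)" for v
  proof -
    have d: "distr lborel borel (\<lambda>x. x + v) = lborel"
    proof -
      have "(\<lambda>x. x + v) = (+) v" by (simp add: fun_eq_iff add.commute)
      then show ?thesis using lborel_distr_plus[of v] by simp
    qed
    show "integrable lborel (\<lambda>x. \<phi> (x + v))"
      using int\<phi> by (subst (asm) d[symmetric]) (simp add: integrable_distr_eq)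
    show "(\<integral>x. \<phi> (x + v) \<partial>lborel) = (\<integral>x. \<phi> x \<partial>lborel)"
      by (subst (2) d[symmetric]) (simp add: integral_distr)
  qed
  have q0: "(\<integral>x. q k x \<partial>lborel) = 0" for k
    unfolding q_def using int_shift int\<phi> shift by simp
  have q_mvt: "\<exists>t\<in>{0<..<1 / real (Suc k)}. q k x = pd i \<phi> (x + t *\<^sub>R ?e)" for k x
  proof -
    let ?d = "1 / real (Suc k)"
    have "\<exists>z>0. z < ?d \<and> \<phi> (x + ?d *\<^sub>R ?e) - \<phi> (x + 0 *\<^sub>R ?e) = (?d - 0) * pd i \<phi> (x + z *\<^sub>R ?e)"
      by (rule MVT2) (auto intro: smooth_line_derivative[OF sm])
    then obtain z where "z > 0" "z < ?d" "\<phi> (x + ?d *\<^sub>R ?e) - \<phi> x = ?d * pd i \<phi> (x + z *\<^sub>R ?e)"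
      by auto
    then show ?thesis by (intro bexI[of _ z]) (auto simp: q_def)
  qed
  have "(\<lambda>k. \<integral>x. q k x \<partial>lborel) \<longlonglongrightarrow> (\<integral>x. pd i \<phi> x \<partial>lborel)"
  proof (rule integral_dominated_convergence[where w = "\<lambda>x. B * indicator (cball 0 (R + 1)) x"])
    show "integrable lborel (\<lambda>x. B * indicator (cball 0 (R + 1)) (x::real^'n))"
      by (intro integrable_mult_right integrable_real_indicator emeasure_bounded_finite) auto
    show "AE x in lborel. (\<lambda>k. q k x) \<longlonglongrightarrow> pd i \<phi> x"
    proof (rule AE_I2)
      fix x
      have "((\<lambda>t. (\<phi> (x + t *\<^sub>R ?e) - \<phi> x) / t) \<longlongrightarrow> pd i \<phi> x) (at 0)"
        using smooth_line_derivative[OF sm, of x i 0] by (simp add: DERIV_def)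
      moreover have "filterlim (\<lambda>k. 1 / real (Suc k)) (at 0) sequentially"
        using LIMSEQ_inverse_real_of_nat by (simp add: filterlim_at inverse_eq_divide)
      ultimately show "(\<lambda>k. q k x) \<longlonglongrightarrow> pd i \<phi> x"
        unfolding q_def by (rule filterlim_compose)
    qed
    show "AE x in lborel. norm (q k x) \<le> B * indicator (cball 0 (R + 1)) x" for k
    proof (rule AE_I2)
      fix x :: "real^'n"
      show "norm (q k x) \<le> B * indicator (cball 0 (R + 1)) x"
      proof (cases "norm x \<le> R + 1")
        case True
        then show ?thesis using q_mvt[of k x] B by auto
      next
        case False
        have "norm x \<le> norm (x + (1 / Suc k) *\<^sub>R ?e) + norm ((1 / Suc k) *\<^sub>R ?e)"
          using norm_triangle_ineq4[of "x + (1 / Suc k) *\<^sub>R ?e" "(1 / Suc k) *\<^sub>R ?e"] by simp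
        also have "norm ((1 / Suc k) *\<^sub>R ?e) \<le> 1" by simp
        finally show ?thesis using False supp by (simp add: q_def)
      qed
    qed
  qed (simp_all add: q_def)
  then have "(\<integral>x. pd i \<phi> x \<partial>lborel) = 0"
    by (simp add: q0 LIMSEQ_const_iff)
  moreover have "(\<integral>x. pd i \<phi> x \<partial>M) = (\<integral>x. pd i \<phi> x \<partial>lborel)"
    unfolding integral_M_eq_lborel[OF \<open>pd i \<phi> \<in> borel_measurable borel\<close>]
    using test_zero_outside[OF test_pd[OF \<phi>]]
    by (intro Bochner_Integration.integral_cong) (auto simp: indicator_def)
  ultimately show ?thesis by simp
qed

subsection \<open>Uniqueness of weak derivatives\<close>

text \<open>Products of flat functions of the coordinates increase to the indicator of a box.\<close>

definition bump :: "real^'n \<Rightarrow> real^'n \<Rightarrow> nat \<Rightarrow> real^'n \<Rightarrow> real" where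
  "bump a b k x = (\<Prod>i\<in>UNIV. flat (real k * (x $ i - a $ i)) * flat (real k * (b $ i - x $ i)))"

lemma smooth_bump: "smooth (bump a b k)"
  unfolding bump_def
  by (intro smooth_prod smooth_mult smooth_comp[OF _ smooth1_flat] smooth_const smooth_diff smooth_component)

lemma bump_outside: "x \<notin> box a b \<Longrightarrow> bump a b k x = 0"
proof -
  assume "x \<notin> box a b"
  then obtain i where "x $ i \<le> a $ i \<or> b $ i \<le> x $ i"
    unfolding mem_box_cart by (meson not_le)
  then have "flat (real k * (x $ i - a $ i)) * flat (real k * (b $ i - x $ i)) = 0"
    by (auto simp: flat_eq zero_less_mult_iff)
  then show ?thesis unfolding bump_def by (intro prod_zero) auto
qed

lemma bump_bound: "\<bar>bump a b k x\<bar> \<le> 1"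
  unfolding bump_def abs_prod abs_mult
  by (intro prod_le_1) (auto simp: flat_nonneg flat_le_1 intro!: mult_le_one)

lemma bump_tendsto: "(\<lambda>k. bump a b k x) \<longlonglongrightarrow> indicator (box a b) x"
proof (cases "x \<in> box a b")
  case True
  have "(\<lambda>k. flat (real k * c)) \<longlonglongrightarrow> 1" if "c > 0" for c
    by (rule filterlim_compose[OF flat_tendsto_1])
       (rule filterlim_at_top_mult_tendsto_pos[OF tendsto_const that filterlim_real_sequentially])
  then have "(\<lambda>k. bump a b k x) \<longlonglongrightarrow> (\<Prod>i\<in>(UNIV::'n set). 1 * 1)"
    unfolding bump_def using True by (intro tendsto_prod tendsto_mult) (auto simp: mem_box_cart)
  then show ?thesis using True by simp
qed (simp add: bump_outside)

lemma test_bump: "cbox a b \<subseteq> \<Omega> \<Longrightarrow> bump a b k \<in> test_functions \<Omega>"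
  by (rule test_functionsI[OF smooth_bump compact_cbox])
     (use bump_outside box_subset_cbox in blast)+

text \<open>The fundamental lemma of the calculus of variations. Testing with bumps shows that the integral over
  every closed box inside the set is zero; by intersection with a fixed box the previous criterion
  applies there, and countably many boxes cover the set.\<close>

lemma ortho_test_imp_AE_zero:
  assumes g: "g \<in> L2 \<Omega>"
    and ortho: "\<And>\<phi>. \<phi> \<in> test_functions \<Omega> \<Longrightarrow> (\<integral>x. g x * \<phi> x \<partial>M) = 0"
  shows "AE x in M. g x = 0"
proof -
  define g1 where "g1 x = indicator \<Omega> x *\<^sub>R g x" for x
  have g1m: "g1 \<in> borel_measurable lebesgue"
    using L2_measurable[OF g] unfolding g1_def by (simp add: borel_measurable_restrict_space_iff)
  have g1i: "integrable lebesgue g1"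
    using L2_integrable[OF g] unfolding g1_def by (simp add: integrable_restrict_space)
  obtain h where h[measurable]: "h \<in> borel_measurable lborel" and gh: "AE x in lborel. g1 x = h x"
    using completion_ex_borel_measurable_real[OF g1m] by blast
  have gh': "AE x in lebesgue. g1 x = h x" using gh by (rule AE_completion)
  have hm: "h \<in> borel_measurable lebesgue" using h by (rule measurable_completion)
  have "integrable lebesgue h"
    by (rule integrable_cong_AE_imp[OF g1i hm]) (use gh' in auto)
  then have hi: "integrable lborel h" using integrable_completion[OF h] by simp
  have test0: "(\<integral>x. h x * \<phi> x \<partial>lborel) = 0" if \<phi>: "\<phi> \<in> test_functions \<Omega>" for \<phi>
  proof -
    have [measurable]: "\<phi> \<in> borel_measurable borel"
      using test_smooth[OF \<phi>] by (intro borel_measurable_continuous_onI smooth_continuous_on)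
    have m: "\<phi> \<in> borel_measurable lebesgue" by (intro measurable_completion) simp
    have "0 = (\<integral>x. g1 x * \<phi> x \<partial>lebesgue)"
      using ortho[OF \<phi>] by (simp add: integral_restrict_space g1_def mult.assoc)
    also have "\<dots> = (\<integral>x. h x * \<phi> x \<partial>lebesgue)"
      using gh' m hm g1m by (intro integral_cong_AE) auto
    also have "\<dots> = (\<integral>x. h x * \<phi> x \<partial>lborel)" by (rule integral_completion) simp
    finally show ?thesis by simp
  qed
  have cbox0: "(\<integral>x. indicator (cbox a b) x * h x \<partial>lborel) = 0" if sub: "cbox a b \<subseteq> \<Omega>" for a b
  proof -
    have [measurable]: "bump a b k \<in> borel_measurable borel" for k
      by (intro borel_measurable_continuous_onI smooth_continuous_on smooth_bump)
    have "(\<lambda>k. \<integral>x. h x * bump a b k x \<partial>lborel) \<longlonglongrightarrow> (\<integral>x. h x * indicator (box a b) x \<partial>lborel)"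
    proof (rule integral_dominated_convergence[where w = "\<lambda>x. \<bar>h x\<bar>"])
      show "AE x in lborel. norm (h x * bump a b k x) \<le> \<bar>h x\<bar>" for k
        using mult_left_le[OF bump_bound] by (auto simp: abs_mult)
      show "AE x in lborel. (\<lambda>k. h x * bump a b k x) \<longlonglongrightarrow> h x * indicator (box a b) x"
        by (intro AE_I2 tendsto_intros bump_tendsto)
    qed (use hi in auto)
    then have "(\<integral>x. h x * indicator (box a b) x \<partial>lborel) = 0"
      using test0[OF test_bump[OF sub]] by (simp add: LIMSEQ_const_iff)
    moreover have "AE x in lborel. x \<notin> cbox a b - box a b"
      by (rule AE_not_in) (rule null_sets_cbox_Diff_box)
    then have "(\<integral>x. indicator (cbox a b) x * h x \<partial>lborel) = (\<integral>x. h x * indicator (box a b) x \<partial>lborel)"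
      by (intro integral_cong_AE) (use box_subset_cbox in \<open>auto simp: indicator_def\<close>)
    ultimately show ?thesis by simp
  qed
  have AE_cbox: "AE x in lborel. x \<in> cbox a b \<longrightarrow> h x = 0" if sub: "cbox a b \<subseteq> \<Omega>" for a b
  proof -
    have "AE x in lborel. indicator (cbox a b) x * h x = 0"
    proof (rule integral_zero_on_boxes_imp_AE_zero)
      show "integrable lborel (\<lambda>x. indicator (cbox a b) x * h x)"
        using integrable_mult_indicator[OF _ hi, of "cbox a b"] by simp
      show "(\<integral>x. indicator (cbox a b) x * h x \<partial>lborel) = 0" by (rule cbox0[OF sub])
      fix c d :: "real^'n"
      have "AE x in lborel. x \<notin> cbox c d - box c d"
        by (rule AE_not_in) (rule null_sets_cbox_Diff_box)
      then have "(\<integral>x. indicator (box c d) x * (indicator (cbox a b) x * h x) \<partial>lborel)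
          = (\<integral>x. indicator (cbox a b \<inter> cbox c d) x * h x \<partial>lborel)"
        by (intro integral_cong_AE) (use box_subset_cbox in \<open>auto simp: indicator_def\<close>)
      also have "\<dots> = 0"
        unfolding Int_interval using sub by (intro cbox0) (auto simp flip: Int_interval)
      finally show "(\<integral>x. indicator (box c d) x * (indicator (cbox a b) x * h x) \<partial>lborel) = 0" .
    qed
    then show ?thesis by (auto simp: indicator_def)
  qed
  obtain D where D: "countable D" "\<And>X. X \<in> D \<Longrightarrow> X \<subseteq> \<Omega> \<and> (\<exists>a b. X = cbox a b)" "\<Union>D = \<Omega>"
    using open_countable_Union_open_cbox[OF open_dom] by (metis PowD subsetD)
  have "AE x in lborel. \<forall>X\<in>D. x \<in> X \<longrightarrow> h x = 0"
    using D(1,2) AE_cbox by (subst AE_ball_countable) blast+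
  with gh have "AE x in lborel. x \<in> \<Omega> \<longrightarrow> g x = 0"
    by eventually_elim (auto simp: g1_def indicator_def simp flip: D(3))
  then show ?thesis by (simp add: AE_M_iff)
qed

lemma has_weak_derivD:
  assumes "has_weak_deriv \<Omega> is u g"
  shows "u \<in> L2 \<Omega>" "g \<in> L2 \<Omega>"
    "\<phi> \<in> test_functions \<Omega> \<Longrightarrow>
      (\<integral>x. u x * partials is \<phi> x \<partial>M) = (-1) ^ length is * (\<integral>x. g x * \<phi> x \<partial>M)"
  using assms by (auto simp: has_weak_deriv_def)

lemma has_weak_deriv_add:
  assumes "has_weak_deriv \<Omega> is u g" "has_weak_deriv \<Omega> is v h"
  shows "has_weak_deriv \<Omega> is (\<lambda>x. u x + v x) (\<lambda>x. g x + h x)"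
  unfolding has_weak_deriv_def
proof (intro conjI ballI)
  note u = has_weak_derivD[OF assms(1)] and v = has_weak_derivD[OF assms(2)]
  fix \<phi> assume \<phi>: "\<phi> \<in> test_functions \<Omega>"
  show "(\<integral>x. (u x + v x) * partials is \<phi> x \<partial>M) = (-1) ^ length is * (\<integral>x. (g x + h x) * \<phi> x \<partial>M)"
    using u(3)[OF \<phi>] v(3)[OF \<phi>] L2_mult_integrable[OF _ test_L2[OF test_partials[OF \<phi>]]]
      L2_mult_integrable[OF _ test_L2[OF \<phi>]] u(1,2) v(1,2)
    by (simp add: distrib_right distrib_left)
qed (use has_weak_derivD[OF assms(1)] has_weak_derivD[OF assms(2)] L2_add in auto)

lemma has_weak_deriv_cmult:
  "has_weak_deriv \<Omega> is u g \<Longrightarrow> has_weak_deriv \<Omega> is (\<lambda>x. c * u x) (\<lambda>x. c * g x)"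
  unfolding has_weak_deriv_def by (simp add: L2_cmult mult.assoc)

lemma has_weak_deriv_zero: "has_weak_deriv \<Omega> is (\<lambda>x. 0) (\<lambda>x. 0)"
  by (simp add: has_weak_deriv_def L2_zero)

lemma has_weak_deriv_sum:
  "(\<And>a. a \<in> A \<Longrightarrow> has_weak_deriv \<Omega> is (u a) (g a)) \<Longrightarrow>
     has_weak_deriv \<Omega> is (\<lambda>x. \<Sum>a\<in>A. u a x) (\<lambda>x. \<Sum>a\<in>A. g a x)"
proof (induction A rule: infinite_finite_induct)
  case (insert a A)
  then show ?case using has_weak_deriv_add[of "is" "u a" "g a"] by simp
qed (simp_all add: has_weak_deriv_zero)

lemma has_weak_deriv_AE_cong:
  assumes d: "has_weak_deriv \<Omega> is u g"
    and u': "u' \<in> borel_measurable M" "AE x in M. u x = u' x"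
    and g': "g' \<in> borel_measurable M" "AE x in M. g x = g' x"
  shows "has_weak_deriv \<Omega> is u' g'"
  unfolding has_weak_deriv_def
proof (intro conjI ballI)
  note D = has_weak_derivD[OF d]
  fix \<phi> assume \<phi>: "\<phi> \<in> test_functions \<Omega>"
  have "(\<integral>x. u' x * partials is \<phi> x \<partial>M) = (\<integral>x. u x * partials is \<phi> x \<partial>M)"
    using u' L2_measurable[OF D(1)] L2_measurable[OF test_L2[OF test_partials[OF \<phi>]]]
    by (intro integral_cong_AE borel_measurable_times) auto
  also have "\<dots> = (-1) ^ length is * (\<integral>x. g x * \<phi> x \<partial>M)" by (rule D(3)[OF \<phi>])
  also have "(\<integral>x. g x * \<phi> x \<partial>M) = (\<integral>x. g' x * \<phi> x \<partial>M)"
    using g' L2_measurable[OF D(2)] L2_measurable[OF test_L2[OF \<phi>]]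
    by (intro integral_cong_AE borel_measurable_times) auto
  finally show "(\<integral>x. u' x * partials is \<phi> x \<partial>M) = (-1) ^ length is * (\<integral>x. g' x * \<phi> x \<partial>M)" .
qed (use has_weak_derivD[OF d] L2_AE_cong u' g' in blast)+

lemma has_weak_deriv_unique:
  assumes g: "has_weak_deriv \<Omega> is u g" and h: "has_weak_deriv \<Omega> is v h"
    and uv: "AE x in M. u x = v x"
  shows "AE x in M. g x = h x"
proof -
  note G = has_weak_derivD[OF g] and H = has_weak_derivD[OF h]
  have "AE x in M. g x - h x = 0"
  proof (rule ortho_test_imp_AE_zero)
    show "(\<lambda>x. g x - h x) \<in> L2 \<Omega>" using G H L2_diff by blast
    fix \<phi> assume \<phi>: "\<phi> \<in> test_functions \<Omega>"
    have "(\<integral>x. u x * partials is \<phi> x \<partial>M) = (\<integral>x. v x * partials is \<phi> x \<partial>M)"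
      using uv G(1) H(1) test_L2[OF test_partials[OF \<phi>]]
      by (intro integral_cong_AE borel_measurable_times L2_measurable) auto
    then have "(\<integral>x. g x * \<phi> x \<partial>M) = (\<integral>x. h x * \<phi> x \<partial>M)"
      using G(3)[OF \<phi>] H(3)[OF \<phi>] by simp
    then show "(\<integral>x. (g x - h x) * \<phi> x \<partial>M) = 0"
      using L2_mult_integrable[OF G(2) test_L2[OF \<phi>]] L2_mult_integrable[OF H(2) test_L2[OF \<phi>]]
      by (simp add: left_diff_distrib)
  qed
  then show ?thesis by simp
qed

lemma weak_deriv_works:
  "has_weak_deriv \<Omega> is u g \<Longrightarrow> has_weak_deriv \<Omega> is u (weak_deriv \<Omega> is u)"
  unfolding weak_deriv_def using someI[of "has_weak_deriv \<Omega> is u" g] by simp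

lemma weak_deriv_AE_eq:
  assumes "has_weak_deriv \<Omega> is v g" "has_weak_deriv \<Omega> is u g'" "AE x in M. u x = v x"
  shows "AE x in M. weak_deriv \<Omega> is u x = g x"
  using has_weak_deriv_unique[OF weak_deriv_works[OF assms(2)] assms(1,3)] .

lemma has_weak_deriv_Nil: "u \<in> L2 \<Omega> \<Longrightarrow> has_weak_deriv \<Omega> [] u u"
  by (simp add: has_weak_deriv_def)

lemma has_weak_deriv_smooth:
  assumes w: "smooth w" shows "has_weak_deriv \<Omega> [i] w (pd i w)"
  unfolding has_weak_deriv_def
proof (intro conjI ballI)
  fix \<phi> assume \<phi>: "\<phi> \<in> test_functions \<Omega>"
  have eq: "pd i (\<lambda>x. w x * \<phi> x) x = w x * pd i \<phi> x + pd i w x * \<phi> x" for x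
    by (rule pd_mult[OF w test_smooth[OF \<phi>]])
  have "integrable M (\<lambda>x. w x * pd i \<phi> x)" "integrable M (\<lambda>x. pd i w x * \<phi> x)"
    using w test_smooth[OF \<phi>] by (auto intro!: L2_mult_integrable smooth_L2 smooth_pd)
  with test_integral_pd[OF test_mult_smooth[OF \<phi> w], of i]
  show "(\<integral>x. w x * partials [i] \<phi> x \<partial>M) = (-1) ^ length [i] * (\<integral>x. pd i w x * \<phi> x \<partial>M)"
    by (simp add: eq)
qed (use w in \<open>auto intro: smooth_L2 smooth_pd\<close>)

text \<open>Weak derivatives compose because derivatives of test functions do: \<open>v\<close> is tested with the derivative of order
  \<open>js\<close> of a test function, to which the one of order \<open>is\<close> is applied afterwards.\<close>

lemma has_weak_deriv_append:
  assumes g: "has_weak_deriv \<Omega> is v g" and G: "has_weak_deriv \<Omega> (is @ js) v G"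
  shows "has_weak_deriv \<Omega> js g G"
  unfolding has_weak_deriv_def
proof (intro conjI ballI)
  fix \<phi> assume \<phi>: "\<phi> \<in> test_functions \<Omega>"
  have "(-1) ^ length is * (\<integral>x. g x * partials js \<phi> x \<partial>M)
      = (-1) ^ length is * ((-1) ^ length js * (\<integral>x. G x * \<phi> x \<partial>M))"
    using has_weak_derivD(3)[OF g test_partials[OF \<phi>], of js] has_weak_derivD(3)[OF G \<phi>]
    by (simp add: partials_append power_add)
  then show "(\<integral>x. g x * partials js \<phi> x \<partial>M) = (-1) ^ length js * (\<integral>x. G x * \<phi> x \<partial>M)"
    by simp
qed (use has_weak_derivD[OF g] has_weak_derivD[OF G] in auto)

end

section \<open>Sobolev spaces and iterated Laplacians\<close>

context bounded_open
begin

lemma sobolev_weak: "v \<in> sobolev m \<Omega> \<Longrightarrow> length is \<le> m \<Longrightarrow> has_weak_deriv \<Omega> is v (weak_deriv \<Omega> is v)"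
  using weak_deriv_works unfolding sobolev_def by blast

lemma sobolev_L2: "v \<in> sobolev m \<Omega> \<Longrightarrow> v \<in> L2 \<Omega>"
  using sobolev_weak[of v m "[]"] by (simp add: has_weak_deriv_def)

lemma sobolev_mono: "v \<in> sobolev m \<Omega> \<Longrightarrow> k \<le> m \<Longrightarrow> v \<in> sobolev k \<Omega>"
  unfolding sobolev_def by auto

lemma sobolev_weak_deriv:
  assumes "v \<in> sobolev m \<Omega>" "length is + k \<le> m"
  shows "weak_deriv \<Omega> is v \<in> sobolev k \<Omega>"
  unfolding sobolev_def
proof (clarify)
  fix js :: "'n list" assume "length js \<le> k"
  with assms have "has_weak_deriv \<Omega> js (weak_deriv \<Omega> is v) (weak_deriv \<Omega> (is @ js) v)"
    by (intro has_weak_deriv_append[OF sobolev_weak[OF assms(1)] sobolev_weak[OF assms(1)]]) simp_all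
  then show "\<exists>g. has_weak_deriv \<Omega> js (weak_deriv \<Omega> is v) g" by blast
qed

lemma sobolev_add: "v \<in> sobolev m \<Omega> \<Longrightarrow> w \<in> sobolev m \<Omega> \<Longrightarrow> (\<lambda>x. v x + w x) \<in> sobolev m \<Omega>"
  unfolding sobolev_def using has_weak_deriv_add by blast

lemma sobolev_cmult: "v \<in> sobolev m \<Omega> \<Longrightarrow> (\<lambda>x. c * v x) \<in> sobolev m \<Omega>"
  unfolding sobolev_def using has_weak_deriv_cmult by blast

lemma sobolev_sum:
  "(\<And>a. a \<in> A \<Longrightarrow> v a \<in> sobolev m \<Omega>) \<Longrightarrow> (\<lambda>x. \<Sum>a\<in>A. v a x) \<in> sobolev m \<Omega>"
proof -
  assume v: "\<And>a. a \<in> A \<Longrightarrow> v a \<in> sobolev m \<Omega>"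
  have "has_weak_deriv \<Omega> is (\<lambda>x. \<Sum>a\<in>A. v a x) (\<lambda>x. \<Sum>a\<in>A. weak_deriv \<Omega> is (v a) x)"
    if "length is \<le> m" for "is"
    by (rule has_weak_deriv_sum) (rule sobolev_weak[OF v that])
  then show ?thesis unfolding sobolev_def by blast
qed

lemma weak_deriv_AE: "has_weak_deriv \<Omega> is u g \<Longrightarrow> AE x in M. weak_deriv \<Omega> is u x = g x"
  by (rule weak_deriv_AE_eq[OF _ _ AE_I2]) simp_all

lemma weak_deriv_cmult:
  assumes "v \<in> sobolev m \<Omega>" "length is \<le> m"
  shows "AE x in M. weak_deriv \<Omega> is (\<lambda>x. c * v x) x = c * weak_deriv \<Omega> is v x"
  by (rule weak_deriv_AE[OF has_weak_deriv_cmult[OF sobolev_weak[OF assms]]])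

subsection \<open>Functions vanishing on the boundary\<close>

text \<open>The weak gradient of the difference inside \<^const>\<open>H1_norm\<close> is an arbitrary choice. Here the gradient \<open>G\<close> of the
  limit is a parameter, and that of the smooth functions is the classical one.\<close>

definition H10_approx :: "(nat \<Rightarrow> real^'n \<Rightarrow> real) \<Rightarrow> (real^'n \<Rightarrow> real) \<Rightarrow> ('n \<Rightarrow> real^'n \<Rightarrow> real) \<Rightarrow> bool" where
  "H10_approx w v G \<longleftrightarrow> (\<forall>k. smooth (w k)) \<and> (\<forall>k. \<forall>x \<in> frontier \<Omega>. w k x = 0) \<and>
     (\<lambda>k. \<integral>x. (w k x - v x)\<^sup>2 \<partial>M) \<longlonglongrightarrow> 0 \<and>
     (\<forall>i. (\<lambda>k. \<integral>x. (pd i (w k) x - G i x)\<^sup>2 \<partial>M) \<longlonglongrightarrow> 0)"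

lemma H1_norm_diff:
  assumes w: "smooth w" and G: "\<And>i. has_weak_deriv \<Omega> [i] v (G i)"
  shows "H1_norm \<Omega> (\<lambda>x. w x - v x) =
    sqrt ((\<integral>x. (w x - v x)\<^sup>2 \<partial>M) + (\<Sum>i\<in>UNIV. \<integral>x. (pd i w x - G i x)\<^sup>2 \<partial>M))"
proof -
  have d: "has_weak_deriv \<Omega> [i] (\<lambda>x. w x - v x) (\<lambda>x. pd i w x - G i x)" for i
    using has_weak_deriv_add[OF has_weak_deriv_smooth[OF w] has_weak_deriv_cmult[OF G[of i], of "-1"]]
    by simp
  have ae: "AE x in M. weak_deriv \<Omega> [i] (\<lambda>x. w x - v x) x = pd i w x - G i x" for i
    by (rule weak_deriv_AE[OF d])
  have m: "weak_deriv \<Omega> [i] (\<lambda>x. w x - v x) \<in> borel_measurable M"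
    "(\<lambda>x. pd i w x - G i x) \<in> borel_measurable M" for i
    using has_weak_derivD(2)[OF weak_deriv_works[OF d]] has_weak_derivD(2)[OF d] by auto
  have "(\<integral>x. (\<Sum>i\<in>UNIV. (weak_deriv \<Omega> [i] (\<lambda>x. w x - v x) x)\<^sup>2) \<partial>M)
      = (\<integral>x. (\<Sum>i\<in>UNIV. (pd i w x - G i x)\<^sup>2) \<partial>M)"
  proof (rule integral_cong_AE)
    have "AE x in M. \<forall>i\<in>UNIV. weak_deriv \<Omega> [i] (\<lambda>x. w x - v x) x = pd i w x - G i x"
      using ae by (intro AE_finite_allI) auto
    then show "AE x in M. (\<Sum>i\<in>UNIV. (weak_deriv \<Omega> [i] (\<lambda>x. w x - v x) x)\<^sup>2)
        = (\<Sum>i\<in>UNIV. (pd i w x - G i x)\<^sup>2)" by auto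
  qed (intro borel_measurable_sum borel_measurable_power m)+
  also have "\<dots> = (\<Sum>i\<in>UNIV. \<integral>x. (pd i w x - G i x)\<^sup>2 \<partial>M)"
    by (rule Bochner_Integration.integral_sum) (rule L2_square_integrable[OF has_weak_derivD(2)[OF d]])
  finally show ?thesis by (simp add: H1_norm_def)
qed

lemma sobolev_1I: "(\<And>i. has_weak_deriv \<Omega> [i] v (G i)) \<Longrightarrow> v \<in> sobolev 1 \<Omega>"
proof -
  assume G: "\<And>i. has_weak_deriv \<Omega> [i] v (G i)"
  then have "has_weak_deriv \<Omega> [] v v"
    using has_weak_deriv_Nil has_weak_derivD(1) by blast
  with G have "\<exists>g. has_weak_deriv \<Omega> is v g" if "length is \<le> 1" for "is"
    using that by (cases "is") auto
  then show ?thesis by (simp add: sobolev_def)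
qed

lemma zero_on_boundary_iff:
  assumes G: "\<And>i. has_weak_deriv \<Omega> [i] v (G i)"
  shows "zero_on_boundary \<Omega> v \<longleftrightarrow> (\<exists>w. H10_approx w v G)"
proof -
  have lim: "(\<lambda>k. H1_norm \<Omega> (\<lambda>x. w k x - v x)) \<longlonglongrightarrow> 0 \<longleftrightarrow>
      (\<lambda>k. \<integral>x. (w k x - v x)\<^sup>2 \<partial>M) \<longlonglongrightarrow> 0 \<and>
      (\<forall>i. (\<lambda>k. \<integral>x. (pd i (w k) x - G i x)\<^sup>2 \<partial>M) \<longlonglongrightarrow> 0)" (is "?L \<longleftrightarrow> ?R")
    if w: "\<forall>k. smooth (w k)" for w
  proof -
    define A where "A k = (\<integral>x. (w k x - v x)\<^sup>2 \<partial>M)" for k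
    define B where "B k i = (\<integral>x. (pd i (w k) x - G i x)\<^sup>2 \<partial>M)" for k i
    have nn: "A k \<ge> 0" "B k i \<ge> 0" for k i by (simp_all add: A_def B_def)
    have H: "H1_norm \<Omega> (\<lambda>x. w k x - v x) = sqrt (A k + (\<Sum>i\<in>UNIV. B k i))" for k
      using H1_norm_diff[OF _ G, of "w k"] w by (simp add: A_def B_def)
    have "(\<lambda>k. sqrt (A k + (\<Sum>i\<in>UNIV. B k i))) \<longlonglongrightarrow> 0 \<longleftrightarrow> A \<longlonglongrightarrow> 0 \<and> (\<forall>i. (\<lambda>k. B k i) \<longlonglongrightarrow> 0)"
    proof (intro iffI conjI allI)
      assume "(\<lambda>k. sqrt (A k + (\<Sum>i\<in>UNIV. B k i))) \<longlonglongrightarrow> 0"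
      then have "(\<lambda>k. (sqrt (A k + (\<Sum>i\<in>UNIV. B k i)))\<^sup>2) \<longlonglongrightarrow> 0\<^sup>2" by (intro tendsto_power)
      then have s: "(\<lambda>k. A k + (\<Sum>i\<in>UNIV. B k i)) \<longlonglongrightarrow> 0"
        using nn by (simp add: sum_nonneg)
      show "A \<longlonglongrightarrow> 0"
        by (rule tendsto_sandwich[OF _ _ tendsto_const s]) (use nn in \<open>auto simp: sum_nonneg\<close>)
      fix i
      have "B k i \<le> A k + (\<Sum>i\<in>UNIV. B k i)" for k
        using nn member_le_sum[of i UNIV "B k"] by (simp add: add_increasing)
      then show "(\<lambda>k. B k i) \<longlonglongrightarrow> 0"
        by (intro tendsto_sandwich[OF _ _ tendsto_const s]) (use nn in auto)
    next
      assume "A \<longlonglongrightarrow> 0 \<and> (\<forall>i. (\<lambda>k. B k i) \<longlonglongrightarrow> 0)"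
      then have "(\<lambda>k. sqrt (A k + (\<Sum>i\<in>UNIV. B k i))) \<longlonglongrightarrow> sqrt (0 + (\<Sum>i\<in>(UNIV::'n set). 0))"
        by (intro tendsto_intros) auto
      then show "(\<lambda>k. sqrt (A k + (\<Sum>i\<in>UNIV. B k i))) \<longlonglongrightarrow> 0" by simp
    qed
    then show ?thesis unfolding H unfolding A_def B_def .
  qed
  show ?thesis
    unfolding zero_on_boundary_def H10_approx_def using sobolev_1I[OF G] lim by blast
qed

lemma L2_tendsto_add:
  assumes "\<And>k. f k \<in> L2 \<Omega>" "\<And>k. g k \<in> L2 \<Omega>"
    and "(\<lambda>k. \<integral>x. (f k x)\<^sup>2 \<partial>M) \<longlonglongrightarrow> 0" "(\<lambda>k. \<integral>x. (g k x)\<^sup>2 \<partial>M) \<longlonglongrightarrow> 0"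
  shows "(\<lambda>k. \<integral>x. (f k x + g k x)\<^sup>2 \<partial>M) \<longlonglongrightarrow> 0"
proof (rule tendsto_sandwich[OF _ _ tendsto_const])
  have "(\<lambda>k. 2 * (\<integral>x. (f k x)\<^sup>2 \<partial>M) + 2 * (\<integral>x. (g k x)\<^sup>2 \<partial>M)) \<longlonglongrightarrow> 2 * 0 + 2 * 0"
    by (intro tendsto_intros assms)
  then show "(\<lambda>k. 2 * (\<integral>x. (f k x)\<^sup>2 \<partial>M) + 2 * (\<integral>x. (g k x)\<^sup>2 \<partial>M)) \<longlonglongrightarrow> 0" by simp
  have "(\<integral>x. (f k x + g k x)\<^sup>2 \<partial>M) \<le> 2 * (\<integral>x. (f k x)\<^sup>2 \<partial>M) + 2 * (\<integral>x. (g k x)\<^sup>2 \<partial>M)" for k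
  proof -
    have "(\<integral>x. (f k x + g k x)\<^sup>2 \<partial>M) \<le> (\<integral>x. 2 * (f k x)\<^sup>2 + 2 * (g k x)\<^sup>2 \<partial>M)"
    proof (rule integral_mono)
      show "(f k x + g k x)\<^sup>2 \<le> 2 * (f k x)\<^sup>2 + 2 * (g k x)\<^sup>2" for x
        using sum_squares_bound[of "f k x" "g k x"] by (simp add: power2_sum)
    qed (use assms L2_add L2_square_integrable in auto)
    then show ?thesis using assms by (simp add: L2_square_integrable)
  qed
  then show "\<forall>\<^sub>F k in sequentially. (\<integral>x. (f k x + g k x)\<^sup>2 \<partial>M) \<le> 2 * (\<integral>x. (f k x)\<^sup>2 \<partial>M) + 2 * (\<integral>x. (g k x)\<^sup>2 \<partial>M)"
    by simp
qed simp

lemma zero_on_boundary_weak: "zero_on_boundary \<Omega> v \<Longrightarrow> has_weak_deriv \<Omega> [i] v (weak_deriv \<Omega> [i] v)"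
  using sobolev_weak[of v 1 "[i]"] by (simp add: zero_on_boundary_def)

lemma zero_on_boundary_add:
  assumes v: "zero_on_boundary \<Omega> v" and v': "zero_on_boundary \<Omega> v'"
  shows "zero_on_boundary \<Omega> (\<lambda>x. v x + v' x)"
proof -
  let ?G = "\<lambda>i. weak_deriv \<Omega> [i] v" and ?G' = "\<lambda>i. weak_deriv \<Omega> [i] v'"
  note d = zero_on_boundary_weak[OF v] and d' = zero_on_boundary_weak[OF v']
  obtain w where w: "H10_approx w v ?G" using v zero_on_boundary_iff[of v ?G, OF d] by blast
  obtain w' where w': "H10_approx w' v' ?G'" using v' zero_on_boundary_iff[of v' ?G', OF d'] by blast
  have sm: "\<And>k. smooth (w k)" "\<And>k. smooth (w' k)" using w w' by (auto simp: H10_approx_def)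
  have "H10_approx (\<lambda>k x. w k x + w' k x) (\<lambda>x. v x + v' x) (\<lambda>i x. ?G i x + ?G' i x)"
    unfolding H10_approx_def
  proof (intro conjI allI ballI)
    show "smooth (\<lambda>x. w k x + w' k x)" for k using sm by (rule smooth_add)
    show "w k x + w' k x = 0" if "x \<in> frontier \<Omega>" for k x
      using w w' that by (simp add: H10_approx_def)
    have "(\<lambda>k. \<integral>x. ((w k x - v x) + (w' k x - v' x))\<^sup>2 \<partial>M) \<longlonglongrightarrow> 0"
      using w w' by (intro L2_tendsto_add L2_diff smooth_L2[OF sm(1)] smooth_L2[OF sm(2)]
        has_weak_derivD(1)[OF d] has_weak_derivD(1)[OF d']) (auto simp: H10_approx_def)
    then show "(\<lambda>k. \<integral>x. (w k x + w' k x - (v x + v' x))\<^sup>2 \<partial>M) \<longlonglongrightarrow> 0" by (simp add: algebra_simps)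
    fix i
    have "(\<lambda>k. \<integral>x. ((pd i (w k) x - ?G i x) + (pd i (w' k) x - ?G' i x))\<^sup>2 \<partial>M) \<longlonglongrightarrow> 0"
      using w w' by (intro L2_tendsto_add L2_diff smooth_L2[OF smooth_pd[OF sm(1)]]
        smooth_L2[OF smooth_pd[OF sm(2)]] has_weak_derivD(2)[OF d] has_weak_derivD(2)[OF d'])
        (auto simp: H10_approx_def)
    then show "(\<lambda>k. \<integral>x. (pd i (\<lambda>x. w k x + w' k x) x - (?G i x + ?G' i x))\<^sup>2 \<partial>M) \<longlonglongrightarrow> 0"
      by (simp add: pd_add sm algebra_simps)
  qed
  moreover have "\<And>i. has_weak_deriv \<Omega> [i] (\<lambda>x. v x + v' x) (\<lambda>x. ?G i x + ?G' i x)"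
    by (rule has_weak_deriv_add[OF d d'])
  ultimately show ?thesis using zero_on_boundary_iff[where v = "\<lambda>x. v x + v' x" and G = "\<lambda>i x. ?G i x + ?G' i x"] by blast
qed

lemma zero_on_boundary_cmult:
  assumes v: "zero_on_boundary \<Omega> v"
  shows "zero_on_boundary \<Omega> (\<lambda>x. c * v x)"
proof -
  let ?G = "\<lambda>i. weak_deriv \<Omega> [i] v"
  note d = zero_on_boundary_weak[OF v]
  obtain w where w: "H10_approx w v ?G" using v zero_on_boundary_iff[of v ?G, OF d] by blast
  have sm: "\<And>k. smooth (w k)" using w by (auto simp: H10_approx_def)
  have sq: "(c * a - c * b)\<^sup>2 = c\<^sup>2 * (a - b)\<^sup>2" for a b :: real
    by (simp add: power_mult_distrib flip: right_diff_distrib)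
  have "H10_approx (\<lambda>k x. c * w k x) (\<lambda>x. c * v x) (\<lambda>i x. c * ?G i x)"
    using w unfolding H10_approx_def
    by (auto simp: sm smooth_const smooth_mult pd_cmult sq intro!: tendsto_mult_right_zero)
  moreover have "\<And>i. has_weak_deriv \<Omega> [i] (\<lambda>x. c * v x) (\<lambda>x. c * ?G i x)"
    by (rule has_weak_deriv_cmult[OF d])
  ultimately show ?thesis using zero_on_boundary_iff[where v = "\<lambda>x. c * v x" and G = "\<lambda>i x. c * ?G i x"] by blast
qed

lemma zero_on_boundary_zero: "zero_on_boundary \<Omega> (\<lambda>x. 0)"
proof -
  have "H10_approx (\<lambda>k x. 0) (\<lambda>x. 0) (\<lambda>i x. 0)"
    using pd_cmult[OF smooth_const, of _ 0] by (simp add: H10_approx_def smooth_const)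
  then show ?thesis using zero_on_boundary_iff[OF has_weak_deriv_zero] by blast
qed

lemma zero_on_boundary_sum:
  "(\<And>a. a \<in> A \<Longrightarrow> zero_on_boundary \<Omega> (v a)) \<Longrightarrow> zero_on_boundary \<Omega> (\<lambda>x. \<Sum>a\<in>A. v a x)"
proof (induction A rule: infinite_finite_induct)
  case (insert a A)
  then show ?case using zero_on_boundary_add[of "v a"] by simp
qed (simp_all add: zero_on_boundary_zero)

text \<open>Laplacians are sums of arbitrarily chosen weak derivatives, so linearity identities for them hold only
  almost everywhere. This is what makes them usable in boundary conditions.\<close>

lemma zero_on_boundary_AE_cong:
  assumes v: "zero_on_boundary \<Omega> v" and v': "v' \<in> borel_measurable M" "AE x in M. v x = v' x"
  shows "zero_on_boundary \<Omega> v'"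
proof -
  let ?G = "\<lambda>i. weak_deriv \<Omega> [i] v"
  note d = zero_on_boundary_weak[OF v]
  obtain w where w: "H10_approx w v ?G" using v zero_on_boundary_iff[of v ?G, OF d] by blast
  have d': "has_weak_deriv \<Omega> [i] v' (?G i)" for i
    by (rule has_weak_deriv_AE_cong[OF d v']) (use has_weak_derivD(2)[OF d] in auto)
  have "(\<integral>x. (w k x - v x)\<^sup>2 \<partial>M) = (\<integral>x. (w k x - v' x)\<^sup>2 \<partial>M)" for k
  proof (rule integral_cong_AE)
    have [measurable]: "w k \<in> borel_measurable M"
      using w by (auto simp: H10_approx_def intro: smooth_measurable)
    have [measurable]: "v \<in> borel_measurable M" using has_weak_derivD(1)[OF d] by auto
    note v'(1)[measurable]
    show "(\<lambda>x. (w k x - v x)\<^sup>2) \<in> borel_measurable M" "(\<lambda>x. (w k x - v' x)\<^sup>2) \<in> borel_measurable M"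
      by measurable
  qed (use v' in auto)
  with w have "H10_approx w v' ?G" by (simp add: H10_approx_def)
  then show ?thesis using zero_on_boundary_iff[of v' ?G, OF d'] by blast
qed

subsection \<open>Iterated Laplacians\<close>

lemma laplacian_sobolev:
  "v \<in> sobolev m \<Omega> \<Longrightarrow> 2 + k \<le> m \<Longrightarrow> laplacian \<Omega> v \<in> sobolev k \<Omega>"
  unfolding laplacian_def by (rule sobolev_sum) (auto intro: sobolev_weak_deriv)

lemma laplacian_AE_linear:
  assumes "v \<in> sobolev 2 \<Omega>" "w \<in> sobolev 2 \<Omega>" "z \<in> sobolev 2 \<Omega>"
    and "AE x in M. z x = v x + c * w x"
  shows "AE x in M. laplacian \<Omega> z x = laplacian \<Omega> v x + c * laplacian \<Omega> w x"
proof -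
  have "AE x in M. weak_deriv \<Omega> [i,i] z x = weak_deriv \<Omega> [i,i] v x + c * weak_deriv \<Omega> [i,i] w x" for i
  proof -
    have "has_weak_deriv \<Omega> [i,i] (\<lambda>x. v x + c * w x) (\<lambda>x. weak_deriv \<Omega> [i,i] v x + c * weak_deriv \<Omega> [i,i] w x)"
      using assms by (intro has_weak_deriv_add has_weak_deriv_cmult sobolev_weak) auto
    then show ?thesis
      by (rule weak_deriv_AE_eq[OF _ sobolev_weak[OF assms(3)] assms(4)]) simp
  qed
  then have "AE x in M. \<forall>i\<in>UNIV. weak_deriv \<Omega> [i,i] z x = weak_deriv \<Omega> [i,i] v x + c * weak_deriv \<Omega> [i,i] w x"
    by (intro AE_finite_allI) auto
  then show ?thesis
    by eventually_elim (simp add: laplacian_def sum.distrib sum_distrib_left)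
qed

lemma laplacian_pow_sobolev:
  "v \<in> sobolev m \<Omega> \<Longrightarrow> 2 * j + k \<le> m \<Longrightarrow> (laplacian \<Omega> ^^ j) v \<in> sobolev k \<Omega>"
proof (induction j arbitrary: k)
  case (Suc j)
  then show ?case using laplacian_sobolev[of "(laplacian \<Omega> ^^ j) v" "2 + k" k] by simp
qed (simp add: sobolev_mono)

lemma laplacian_pow_AE_linear:
  assumes "v \<in> sobolev m \<Omega>" "w \<in> sobolev m \<Omega>" "2 * j \<le> m"
  shows "AE x in M. (laplacian \<Omega> ^^ j) (\<lambda>x. v x + c * w x) x
      = (laplacian \<Omega> ^^ j) v x + c * (laplacian \<Omega> ^^ j) w x"
  using assms(3)
proof (induction j)
  case (Suc j)
  show ?case
    unfolding funpow.simps comp_def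
    using Suc.prems
    by (intro laplacian_AE_linear laplacian_pow_sobolev[OF assms(1)] laplacian_pow_sobolev[OF assms(2)]
        laplacian_pow_sobolev[OF sobolev_add[OF assms(1) sobolev_cmult[OF assms(2)]]] Suc.IH) simp_all
qed simp

lemma weak_deriv_laplacian:
  assumes v: "v \<in> sobolev m \<Omega>" "2 + length js \<le> m"
  shows "AE x in M. weak_deriv \<Omega> js (laplacian \<Omega> v) x = (\<Sum>i\<in>UNIV. weak_deriv \<Omega> ([i,i] @ js) v x)"
proof -
  have "has_weak_deriv \<Omega> js (laplacian \<Omega> v) (\<lambda>x. \<Sum>i\<in>UNIV. weak_deriv \<Omega> ([i,i] @ js) v x)"
    unfolding laplacian_def using v(2)
    by (intro has_weak_deriv_sum has_weak_deriv_append[OF sobolev_weak[OF v(1)] sobolev_weak[OF v(1)]]) simp_all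
  then show ?thesis by (rule weak_deriv_AE)
qed

text \<open>Up to null sets, \<open>\<Delta>\<^sup>j v\<close> and its derivatives are sums of derivatives of \<open>v\<close>, each of which vanishes on
  the boundary.\<close>

lemma zero_on_boundary_laplacian_pow:
  assumes v: "v \<in> sobolev m \<Omega>" and bd: "\<And>is. length is < m \<Longrightarrow> zero_on_boundary \<Omega> (weak_deriv \<Omega> is v)"
  shows "length js + 2 * j < m \<Longrightarrow> zero_on_boundary \<Omega> (weak_deriv \<Omega> js ((laplacian \<Omega> ^^ j) v))"
proof (induction j arbitrary: js)
  case (Suc j)
  let ?u = "(laplacian \<Omega> ^^ j) v"
  have u: "?u \<in> sobolev (2 + length js) \<Omega>"
    using Suc.prems by (intro laplacian_pow_sobolev[OF v]) simp
  have z: "zero_on_boundary \<Omega> (\<lambda>x. \<Sum>i\<in>UNIV. weak_deriv \<Omega> ([i,i] @ js) ?u x)"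
    using Suc.prems by (intro zero_on_boundary_sum Suc.IH) simp
  have "weak_deriv \<Omega> js (laplacian \<Omega> ?u) \<in> borel_measurable M"
    using has_weak_derivD(2)[OF sobolev_weak[OF laplacian_sobolev[OF u order_refl] order_refl]] by auto
  moreover have "AE x in M. (\<Sum>i\<in>UNIV. weak_deriv \<Omega> ([i,i] @ js) ?u x) = weak_deriv \<Omega> js (laplacian \<Omega> ?u) x"
    using weak_deriv_laplacian[OF u order_refl] by auto
  ultimately show ?case using zero_on_boundary_AE_cong[OF z] by simp
qed (use bd in simp)

text \<open>This reduces the embedding of both energy spaces to that of the Navier space.\<close>

lemma H_dirichlet_subset_navier: "H_dirichlet m \<Omega> \<subseteq> H_navier m \<Omega>"
proof
  fix v assume "v \<in> H_dirichlet m \<Omega>"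
  then have v: "v \<in> sobolev m \<Omega>" and bd: "\<And>is. length is < m \<Longrightarrow> zero_on_boundary \<Omega> (weak_deriv \<Omega> is v)"
    by (auto simp: H_dirichlet_def)
  have "zero_on_boundary \<Omega> ((laplacian \<Omega> ^^ j) v)" if "real j < real m / 2" for j
  proof -
    have j: "2 * j < m" using that by linarith
    have s: "(laplacian \<Omega> ^^ j) v \<in> L2 \<Omega>" using laplacian_pow_sobolev[OF v, of j 0] j by (simp add: sobolev_L2)
    have "AE x in M. weak_deriv \<Omega> [] ((laplacian \<Omega> ^^ j) v) x = (laplacian \<Omega> ^^ j) v x"
      by (rule weak_deriv_AE[OF has_weak_deriv_Nil[OF s]])
    moreover have "zero_on_boundary \<Omega> (weak_deriv \<Omega> [] ((laplacian \<Omega> ^^ j) v))"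
      by (rule zero_on_boundary_laplacian_pow[OF v bd]) (use j in simp_all)
    ultimately show ?thesis using zero_on_boundary_AE_cong L2_measurable[OF s] by metis
  qed
  with v show "v \<in> H_navier m \<Omega>" by (simp add: H_navier_def)
qed

lemma H_navier_cmult:
  assumes "v \<in> H_navier m \<Omega>" shows "(\<lambda>x. c * v x) \<in> H_navier m \<Omega>"
proof -
  have v: "v \<in> sobolev m \<Omega>" using assms by (simp add: H_navier_def)
  have "zero_on_boundary \<Omega> ((laplacian \<Omega> ^^ j) (\<lambda>x. c * v x))" if "real j < real m / 2" for j
  proof -
    have j: "2 * j \<le> m" using that by linarith
    have z: "zero_on_boundary \<Omega> (\<lambda>x. c * (laplacian \<Omega> ^^ j) v x)"
      using assms that by (intro zero_on_boundary_cmult) (simp add: H_navier_def)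
    have s: "(laplacian \<Omega> ^^ j) (\<lambda>x. c * v x) \<in> sobolev 0 \<Omega>"
      by (rule laplacian_pow_sobolev[OF sobolev_cmult[OF v]]) (use j in simp)
    have "AE x in M. (laplacian \<Omega> ^^ j) (\<lambda>x. v x + (c - 1) * v x) x
      = (laplacian \<Omega> ^^ j) v x + (c - 1) * (laplacian \<Omega> ^^ j) v x"
      by (rule laplacian_pow_AE_linear[OF v v j])
    then have "AE x in M. c * (laplacian \<Omega> ^^ j) v x = (laplacian \<Omega> ^^ j) (\<lambda>x. c * v x) x"
      by (auto simp: algebra_simps)
    with z s show ?thesis using zero_on_boundary_AE_cong sobolev_L2 L2_measurable by blast
  qed
  with v show ?thesis by (simp add: H_navier_def sobolev_cmult)
qed

lemma H_dirichlet_cmult: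
  assumes "v \<in> H_dirichlet m \<Omega>" shows "(\<lambda>x. c * v x) \<in> H_dirichlet m \<Omega>"
proof -
  have v: "v \<in> sobolev m \<Omega>" using assms by (simp add: H_dirichlet_def)
  have "zero_on_boundary \<Omega> (weak_deriv \<Omega> is (\<lambda>x. c * v x))" if "length is < m" for "is"
  proof (rule zero_on_boundary_AE_cong)
    show "zero_on_boundary \<Omega> (\<lambda>x. c * weak_deriv \<Omega> is v x)"
      using assms that by (intro zero_on_boundary_cmult) (simp add: H_dirichlet_def)
    show "AE x in M. c * weak_deriv \<Omega> is v x = weak_deriv \<Omega> is (\<lambda>x. c * v x) x"
      using weak_deriv_cmult[OF v, of "is" c] that by auto
    show "weak_deriv \<Omega> is (\<lambda>x. c * v x) \<in> borel_measurable M"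
      using has_weak_derivD(2)[OF sobolev_weak[OF sobolev_cmult[OF v]]] that by auto
  qed
  with v show ?thesis by (simp add: H_dirichlet_def sobolev_cmult)
qed

end

section \<open>The Gagliardo-Nirenberg inequality\<close>

subsection \<open>Real powers of extended nonnegative reals\<close>

text \<open>The zeroth power is 1 even at 0 and at infinity, so that factors of weight zero can be present in
  Hoelder's inequality.\<close>

definition epow :: "ennreal \<Rightarrow> real \<Rightarrow> ennreal" where
  "epow x p = (if p = 0 then 1 else if x = \<infinity> then \<infinity> else ennreal (enn2real x powr p))"

lemma epow_0 [simp]: "epow x 0 = 1" by (simp add: epow_def)

lemma epow_ennreal: "r \<ge> 0 \<Longrightarrow> p > 0 \<Longrightarrow> epow (ennreal r) p = ennreal (r powr p)"
  by (simp add: epow_def)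

lemma epow_zero: "p > 0 \<Longrightarrow> epow 0 p = 0"
  by (simp add: epow_def)

lemma epow_top: "p > 0 \<Longrightarrow> epow top p = top"
  by (simp add: epow_def)

lemma measurable_epow [measurable (raw)]:
  "f \<in> borel_measurable N \<Longrightarrow> (\<lambda>x. epow (f x) p) \<in> borel_measurable N"
proof -
  assume [measurable]: "f \<in> borel_measurable N"
  have [measurable]: "{x \<in> space N. f x = \<infinity>} \<in> sets N"
    using measurable_sets[OF \<open>f \<in> borel_measurable N\<close>, of "{\<infinity>}"]
    by (simp add: vimage_def Int_def conj_commute)
  show ?thesis by (cases "p = 0") (simp_all add: epow_def)
qed

lemma epow_mono: "x \<le> y \<Longrightarrow> p \<ge> 0 \<Longrightarrow> epow x p \<le> epow y p"
  by (cases x; cases y) (auto simp: epow_def powr_mono2 top_unique intro!: ennreal_leI)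

lemma epow_add: "a \<ge> 0 \<Longrightarrow> b \<ge> 0 \<Longrightarrow> epow x a * epow x b = epow x (a + b)"
proof (cases x)
  case (real r)
  then show "a \<ge> 0 \<Longrightarrow> b \<ge> 0 \<Longrightarrow> epow x a * epow x b = epow x (a + b)"
    by (auto simp: epow_def powr_add ennreal_mult add_nonneg_eq_0_iff)
next
  case top
  then show "a \<ge> 0 \<Longrightarrow> b \<ge> 0 \<Longrightarrow> epow x a * epow x b = epow x (a + b)"
    by (auto simp: epow_def ennreal_mult_top ennreal_top_mult add_nonneg_eq_0_iff)
qed

lemma epow_power: "p \<ge> 0 \<Longrightarrow> epow x p ^ n = epow x (real n * p)"
  by (induction n) (auto simp: epow_add algebra_simps)

lemma weighted_am_gm:
  fixes x w :: "'i \<Rightarrow> real"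
  assumes I: "finite I" and w: "\<And>i. i \<in> I \<Longrightarrow> w i > 0" "sum w I = 1" and x: "\<And>i. i \<in> I \<Longrightarrow> x i \<ge> 0"
  shows "(\<Prod>i\<in>I. x i powr w i) \<le> (\<Sum>i\<in>I. w i * x i)"
proof (cases "\<exists>i\<in>I. x i = 0")
  case True
  then have "(\<Prod>i\<in>I. x i powr w i) = 0" using I by (auto simp: prod_zero_iff)
  then show ?thesis using w x by (simp add: sum_nonneg less_imp_le)
next
  case False
  then have pos: "\<And>i. i \<in> I \<Longrightarrow> x i > 0" using x by (metis less_eq_real_def)
  have ne: "I \<noteq> {}" using w(2) by auto
  have "(\<Prod>i\<in>I. x i powr w i) = exp (\<Sum>i\<in>I. w i *\<^sub>R ln (x i))"
    unfolding exp_sum[OF I] by (intro prod.cong refl) (use pos in \<open>force simp: powr_def\<close>)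
  also have "\<dots> \<le> (\<Sum>i\<in>I. w i * exp (ln (x i)))"
    by (rule convex_on_sum[OF I ne exp_convex w(2)]) (use w in \<open>auto simp: less_imp_le\<close>)
  also have "\<dots> = (\<Sum>i\<in>I. w i * x i)" using pos by (intro sum.cong) auto
  finally show ?thesis .
qed

lemma epow_am_gm:
  fixes x :: "'i \<Rightarrow> ennreal"
  assumes I: "finite I" and w: "\<And>i. i \<in> I \<Longrightarrow> w i \<ge> 0" "sum w I = 1"
  shows "(\<Prod>i\<in>I. epow (x i) (w i)) \<le> (\<Sum>i\<in>I. ennreal (w i) * x i)"
proof -
  define J where "J = {i\<in>I. w i > 0}"
  have J: "finite J" "J \<subseteq> I" "\<And>i. i \<in> I - J \<Longrightarrow> w i = 0"
    using I w(1) by (auto simp: J_def less_le)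
  have "sum w J = 1" using w(2) J by (subst sum.mono_neutral_left[OF I J(2)]) auto
  have p: "(\<Prod>i\<in>I. epow (x i) (w i)) = (\<Prod>i\<in>J. epow (x i) (w i))"
    using J by (intro prod.mono_neutral_right[OF I J(2)]) auto
  have s: "(\<Sum>i\<in>I. ennreal (w i) * x i) = (\<Sum>i\<in>J. ennreal (w i) * x i)"
    using J by (intro sum.mono_neutral_right[OF I J(2)]) auto
  show ?thesis
  proof (cases "\<exists>i\<in>J. x i = \<infinity>")
    case True
    then obtain i where i: "i \<in> J" "x i = \<infinity>" by blast
    then have "\<infinity> = ennreal (w i) * x i" by (simp add: J_def ennreal_mult_top)
    also have "\<dots> \<le> (\<Sum>i\<in>J. ennreal (w i) * x i)" using i J(1) by (intro member_le_sum) auto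
    finally show ?thesis by (simp add: s top_unique)
  next
    case False
    define r where "r i = enn2real (x i)" for i
    have xr: "x i = ennreal (r i)" "r i \<ge> 0" if "i \<in> J" for i
      using False that by (auto simp: r_def less_top)
    have "(\<Prod>i\<in>J. epow (x i) (w i)) = (\<Prod>i\<in>J. ennreal (r i powr w i))"
      using xr by (intro prod.cong) (auto simp: epow_ennreal J_def)
    also have "\<dots> = ennreal (\<Prod>i\<in>J. r i powr w i)" by (rule prod_ennreal) simp
    also have "\<dots> \<le> ennreal (\<Sum>i\<in>J. w i * r i)"
      using weighted_am_gm[OF J(1) _ \<open>sum w J = 1\<close>] xr(2) by (intro ennreal_leI) (auto simp: J_def)
    also have "\<dots> = (\<Sum>i\<in>J. ennreal (w i * r i))"
      using xr(2) by (subst sum_ennreal) (auto simp: J_def)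
    also have "\<dots> = (\<Sum>i\<in>J. ennreal (w i) * x i)"
      using xr by (intro sum.cong) (auto simp: J_def ennreal_mult)
    finally show ?thesis by (simp add: p s)
  qed
qed

lemma epow_mult: "p \<ge> 0 \<Longrightarrow> epow (x * y) p = epow x p * epow y p"
  by (cases x; cases y) (auto simp: epow_def powr_mult ennreal_mult_top ennreal_top_mult enn2real_mult
      ennreal_mult[symmetric] ennreal_mult_eq_top_iff)

text \<open>After every factor has been divided by its integral, this is the integrated weighted inequality between the
  geometric and the arithmetic mean. Factors with integral zero or infinity are treated apart.\<close>

lemma nn_integral_holder:
  fixes f :: "'i \<Rightarrow> 'a \<Rightarrow> ennreal"
  assumes I: "finite I" and w: "\<And>i. i \<in> I \<Longrightarrow> w i \<ge> 0" "sum w I = 1"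
    and f [measurable]: "\<And>i. i \<in> I \<Longrightarrow> f i \<in> borel_measurable N"
  shows "(\<integral>\<^sup>+x. (\<Prod>i\<in>I. epow (f i x) (w i)) \<partial>N) \<le> (\<Prod>i\<in>I. epow (\<integral>\<^sup>+x. f i x \<partial>N) (w i))"
proof -
  define c where "c i = (\<integral>\<^sup>+x. f i x \<partial>N)" for i
  consider (zero) i where "i \<in> I" "w i > 0" "c i = 0"
    | (top) i where "i \<in> I" "w i > 0" "c i = \<infinity>" "\<And>i. i \<in> I \<Longrightarrow> w i > 0 \<Longrightarrow> c i \<noteq> 0"
    | (fin) "\<And>i. i \<in> I \<Longrightarrow> w i > 0 \<Longrightarrow> c i \<noteq> 0 \<and> c i \<noteq> \<infinity>" by blast
  then show ?thesis
  proof cases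
    case zero
    then have "AE x in N. f i x = 0" by (simp add: c_def nn_integral_0_iff_AE)
    then have "AE x in N. (\<Prod>i\<in>I. epow (f i x) (w i)) = 0"
      by eventually_elim (use zero I in \<open>auto intro!: prod_zero bexI[of _ i] simp: epow_zero\<close>)
    then have "(\<integral>\<^sup>+x. (\<Prod>i\<in>I. epow (f i x) (w i)) \<partial>N) = 0" by (simp add: nn_integral_0_iff_AE)
    then show ?thesis by simp
  next
    case top
    have "epow (c j) (w j) \<noteq> 0" if "j \<in> I" for j
    proof (cases "w j = 0")
      case False
      then have "c j \<noteq> 0" "w j > 0" using top(4) that w(1)[OF that] by auto
      then show ?thesis by (cases "c j") (auto simp: epow_def)
    qed simp
    then have "(\<Prod>i\<in>I - {i}. epow (c i) (w i)) \<noteq> 0" using I by simp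
    then have "(\<Prod>i\<in>I. epow (c i) (w i)) = \<infinity>"
      using top I by (simp add: prod.remove[of I i] epow_top ennreal_top_mult)
    then show ?thesis by (simp add: c_def top_unique)
  next
    case fin
    define g where "g i x = f i x / c i" for i x
    have eq: "epow (f i x) (w i) = epow (c i) (w i) * epow (g i x) (w i)" if "i \<in> I" for i x
    proof (cases "w i = 0")
      case False
      then have "c i \<noteq> 0" "c i \<noteq> \<infinity>" using fin that w(1)[OF that] by auto
      then have "c i * g i x = f i x"
        by (simp add: g_def ennreal_times_divide mult.commute[of "c i"] ennreal_mult_divide_eq less_top)
      then show ?thesis using w(1)[OF that] by (metis epow_mult)
    qed simp
    have g1: "ennreal (w i) * (\<integral>\<^sup>+x. g i x \<partial>N) = ennreal (w i)" if "i \<in> I" for i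
    proof (cases "w i = 0")
      case False
      then have "c i \<noteq> 0" "c i \<noteq> \<infinity>" using fin that w(1)[OF that] by auto
      moreover have "(\<integral>\<^sup>+x. g i x \<partial>N) = c i / c i"
        unfolding g_def using that by (simp add: nn_integral_divide c_def)
      ultimately show ?thesis by (simp add: ennreal_divide_self less_top)
    qed simp
    have [measurable]: "g i \<in> borel_measurable N" if "i \<in> I" for i
      using f[OF that] unfolding g_def by measurable
    have "(\<integral>\<^sup>+x. (\<Prod>i\<in>I. epow (f i x) (w i)) \<partial>N)
        = (\<integral>\<^sup>+x. (\<Prod>i\<in>I. epow (c i) (w i)) * (\<Prod>i\<in>I. epow (g i x) (w i)) \<partial>N)"
      using eq by (simp add: prod.distrib)
    also have "\<dots> = (\<Prod>i\<in>I. epow (c i) (w i)) * (\<integral>\<^sup>+x. (\<Prod>i\<in>I. epow (g i x) (w i)) \<partial>N)"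
      by (rule nn_integral_cmult) measurable
    also have "(\<integral>\<^sup>+x. (\<Prod>i\<in>I. epow (g i x) (w i)) \<partial>N) \<le> (\<integral>\<^sup>+x. (\<Sum>i\<in>I. ennreal (w i) * g i x) \<partial>N)"
      by (intro nn_integral_mono epow_am_gm[OF I w])
    also have "\<dots> = (\<Sum>i\<in>I. ennreal (w i) * (\<integral>\<^sup>+x. g i x \<partial>N))"
      by (subst nn_integral_sum) (auto simp: nn_integral_cmult)
    also have "\<dots> = 1" using g1 w by (simp add: sum_ennreal)
    finally show ?thesis by (simp add: c_def mult_left_mono)
  qed
qed

subsection \<open>Grid lines\<close>

text \<open>Points of a product space are functions on the index set, so the line through \<open>x\<close> in direction \<open>i\<close> is
  traversed by updating \<open>x\<close> at \<open>i\<close>.\<close>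

definition line_int :: "'i \<Rightarrow> (('i \<Rightarrow> real) \<Rightarrow> ennreal) \<Rightarrow> ('i \<Rightarrow> real) \<Rightarrow> ennreal" where
  "line_int i f x = (\<integral>\<^sup>+t. f (x(i := t)) \<partial>lborel)"

abbreviation lborel_prod :: "'i set \<Rightarrow> ('i \<Rightarrow> real) measure" where
  "lborel_prod I \<equiv> Pi\<^sub>M I (\<lambda>_. lborel)"

lemma line_int_measurable:
  assumes "f \<in> borel_measurable (lborel_prod (insert i I))"
  shows "line_int i f \<in> borel_measurable (lborel_prod I)"
proof -
  have "(\<lambda>z. (fst z)(i := snd z)) \<in> lborel_prod I \<Otimes>\<^sub>M lborel \<rightarrow>\<^sub>M lborel_prod (insert i I)"
    by (rule measurable_fun_upd[where J = I]) auto
  from measurable_comp[OF this assms]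
  have [measurable]: "(\<lambda>(x, t). f (x(i := t))) \<in> borel_measurable (lborel_prod I \<Otimes>\<^sub>M lborel)"
    by (simp add: comp_def case_prod_beta)
  show ?thesis unfolding line_int_def[abs_def] by measurable
qed

lemma line_int_swap:
  assumes f: "f \<in> borel_measurable (lborel_prod (insert a I))" and i: "i \<in> I" "a \<notin> I"
    and x: "x \<in> space (lborel_prod I)"
  shows "(\<integral>\<^sup>+t. line_int i f (x(a := t)) \<partial>lborel) = line_int i (line_int a f) x"
proof -
  have "(\<lambda>z. (x(a := fst z))(i := snd z)) \<in> lborel \<Otimes>\<^sub>M lborel \<rightarrow>\<^sub>M lborel_prod (insert a I)"
  proof (rule measurable_fun_upd[where J = "insert a I"])
    show "(\<lambda>z. x(a := fst z)) \<in> lborel \<Otimes>\<^sub>M lborel \<rightarrow>\<^sub>M lborel_prod (insert a I)"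
      by (rule measurable_fun_upd[where J = I]) (use x in auto)
  qed (use i in auto)
  from measurable_comp[OF this f]
  have m: "(\<lambda>(t, s). f (x(a := t, i := s))) \<in> borel_measurable (lborel \<Otimes>\<^sub>M lborel)"
    by (simp add: comp_def case_prod_beta)
  have "(\<integral>\<^sup>+t. \<integral>\<^sup>+s. f (x(a := t, i := s)) \<partial>lborel \<partial>lborel)
      = (\<integral>\<^sup>+s. \<integral>\<^sup>+t. f (x(a := t, i := s)) \<partial>lborel \<partial>lborel)"
    using lborel_pair.Fubini'[OF m] by simp
  moreover have "i \<noteq> a" using i by auto
  ultimately show ?thesis by (simp add: line_int_def fun_upd_twist)
qed

text \<open>The exponents are chosen so that the statement for \<open>insert a I\<close> follows from that for \<open>I\<close>, applied to the
  integral \<open>g\<close> of \<open>f\<close> along the direction \<open>a\<close>. Integrate in the direction \<open>a\<close> first. The factor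
  coming from this direction is constant there, and Hoelder's inequality with the weights
  \<open>1 - card I * p, p, ..., p\<close> handles the others; since integrals along different directions can be
  interchanged, the result is the left-hand side for \<open>g\<close>.\<close>

lemma gridlines:
  assumes "finite I" "f \<in> borel_measurable (lborel_prod I)" "p > 0" "(real (card I) - 1) * p \<le> 1"
  shows "(\<integral>\<^sup>+x. epow (f x) (1 - (real (card I) - 1) * p) * (\<Prod>i\<in>I. epow (line_int i f x) p) \<partial>lborel_prod I)
    \<le> epow (\<integral>\<^sup>+x. f x \<partial>lborel_prod I) (1 + p)"
  using assms
proof (induction I arbitrary: f rule: finite_induct)
  case empty
  interpret product_sigma_finite "\<lambda>_. lborel :: real measure" by standard
  show ?case by (simp add: PiM_empty nn_integral_count_space_finite)
next
  case (insert a I)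
  interpret product_sigma_finite "\<lambda>_. lborel :: real measure" by standard
  define q where "q = 1 - real (card I) * p"
  define g where "g = line_int a f"
  have q: "q \<ge> 0" using insert by (simp add: q_def)
  have f[measurable]: "f \<in> borel_measurable (lborel_prod (insert a I))" by fact
  have fi[measurable]: "line_int i f \<in> borel_measurable (lborel_prod (insert a I))" if "i \<in> insert a I" for i
    by (rule line_int_measurable) (use that f in \<open>simp add: insert_absorb\<close>)
  have g[measurable]: "g \<in> borel_measurable (lborel_prod I)"
    unfolding g_def by (rule line_int_measurable[OF f])
  have ga: "line_int a f (x(a := t)) = g x" for x t by (simp add: g_def line_int_def)
  let ?w = "\<lambda>i. if i = a then q else p"
  have sw: "sum ?w (insert a I) = 1"
  proof -
    have "sum ?w I = (\<Sum>i\<in>I. p)" using insert.hyps by (intro sum.cong) auto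
    then show ?thesis using insert.hyps by (simp add: q_def)
  qed
  have "(\<integral>\<^sup>+x. epow (f x) (1 - (real (card (insert a I)) - 1) * p) *
      (\<Prod>i\<in>insert a I. epow (line_int i f x) p) \<partial>lborel_prod (insert a I))
    = (\<integral>\<^sup>+x. epow (f x) q * (epow (line_int a f x) p * (\<Prod>i\<in>I. epow (line_int i f x) p)) \<partial>lborel_prod (insert a I))"
    using insert.hyps by (simp add: q_def)
  also have "\<dots> = (\<integral>\<^sup>+x. \<integral>\<^sup>+t. epow (f (x(a := t))) q * (epow (g x) p *
      (\<Prod>i\<in>I. epow (line_int i f (x(a := t))) p)) \<partial>lborel \<partial>lborel_prod I)"
    using insert.hyps by (subst product_nn_integral_insert) (auto simp: ga)
  also have "\<dots> \<le> (\<integral>\<^sup>+x. epow (g x) (1 - (real (card I) - 1) * p) * (\<Prod>i\<in>I. epow (line_int i g x) p) \<partial>lborel_prod I)"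
  proof (rule nn_integral_mono)
    fix x assume x: "x \<in> space (lborel_prod I)"
    have upd[measurable]: "(\<lambda>t. x(a := t)) \<in> lborel \<rightarrow>\<^sub>M lborel_prod (insert a I)"
      using x insert.hyps by (intro measurable_fun_upd[where J = I]) auto
    have m1[measurable]: "(\<lambda>t. f (x(a := t))) \<in> borel_measurable lborel"
      using measurable_comp[OF upd f] by (simp add: comp_def)
    have m2[measurable]: "(\<lambda>t. line_int i f (x(a := t))) \<in> borel_measurable lborel" if "i \<in> I" for i
      using measurable_comp[OF upd fi[of i]] that by (simp add: comp_def)
    let ?F = "\<lambda>i t. if i = a then f (x(a := t)) else line_int i f (x(a := t))"
    have e: "(\<Prod>i\<in>insert a I. epow (?F i t) (?w i)) = epow (f (x(a := t))) q * (\<Prod>i\<in>I. epow (line_int i f (x(a := t))) p)" for t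
    proof -
      have "(\<Prod>i\<in>I. epow (?F i t) (?w i)) = (\<Prod>i\<in>I. epow (line_int i f (x(a := t))) p)"
        using insert.hyps by (intro prod.cong) auto
      then show ?thesis using insert.hyps by simp
    qed
    have e2: "(\<Prod>i\<in>insert a I. epow (\<integral>\<^sup>+t. ?F i t \<partial>lborel) (?w i)) = epow (g x) q * (\<Prod>i\<in>I. epow (line_int i g x) p)"
    proof -
      have "(\<Prod>i\<in>I. epow (\<integral>\<^sup>+t. ?F i t \<partial>lborel) (?w i)) = (\<Prod>i\<in>I. epow (line_int i g x) p)"
        using insert.hyps line_int_swap[OF f _ _ x] by (intro prod.cong) (auto simp: g_def)
      then show ?thesis using insert.hyps by (simp add: g_def line_int_def)
    qed
    have "(\<integral>\<^sup>+t. epow (f (x(a := t))) q * (epow (g x) p * (\<Prod>i\<in>I. epow (line_int i f (x(a := t))) p)) \<partial>lborel)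
      = (\<integral>\<^sup>+t. epow (g x) p * (\<Prod>i\<in>insert a I. epow (?F i t) (?w i)) \<partial>lborel)"
      unfolding e by (simp add: mult_ac)
    also have "\<dots> = epow (g x) p * (\<integral>\<^sup>+t. (\<Prod>i\<in>insert a I. epow (?F i t) (?w i)) \<partial>lborel)"
      unfolding e by (rule nn_integral_cmult) measurable
    also have "\<dots> \<le> epow (g x) p * (\<Prod>i\<in>insert a I. epow (\<integral>\<^sup>+t. ?F i t \<partial>lborel) (?w i))"
      using insert.hyps q \<open>p > 0\<close> sw by (intro mult_left_mono nn_integral_holder) auto
    also have "\<dots> = (epow (g x) q * epow (g x) p) * (\<Prod>i\<in>I. epow (line_int i g x) p)"
      unfolding e2 by (simp add: mult_ac)
    also have "epow (g x) q * epow (g x) p = epow (g x) (1 - (real (card I) - 1) * p)"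
      using q \<open>p > 0\<close> by (simp add: epow_add q_def algebra_simps)
    finally show "(\<integral>\<^sup>+t. epow (f (x(a := t))) q * (epow (g x) p * (\<Prod>i\<in>I. epow (line_int i f (x(a := t))) p)) \<partial>lborel)
      \<le> epow (g x) (1 - (real (card I) - 1) * p) * (\<Prod>i\<in>I. epow (line_int i g x) p)" .
  qed
  also have "\<dots> \<le> epow (\<integral>\<^sup>+x. g x \<partial>lborel_prod I) (1 + p)"
  proof (rule insert.IH[OF g \<open>p > 0\<close>])
    have "(real (card I) - 1) * p \<le> real (card I) * p" using \<open>p > 0\<close> by (simp add: left_diff_distrib)
    then show "(real (card I) - 1) * p \<le> 1" using q by (simp add: q_def)
  qed
  also have "(\<integral>\<^sup>+x. g x \<partial>lborel_prod I) = (\<integral>\<^sup>+x. f x \<partial>lborel_prod (insert a I))"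
    using insert.hyps by (subst product_nn_integral_insert) (auto simp: g_def line_int_def[abs_def])
  finally show ?case .
qed

text \<open>With \<open>p = 1 / (n - 1)\<close> in dimension \<open>n\<close>, the factor \<open>f\<close> itself has exponent zero on the grid lines, and the
  remaining \<open>n\<close> factors are each at least \<open>v\<close> to the power \<open>p\<close>.\<close>

theorem gagliardo_nirenberg:
  fixes F v :: "'a::euclidean_space \<Rightarrow> ennreal"
  assumes F[measurable]: "F \<in> borel_measurable borel" and v[measurable]: "v \<in> borel_measurable borel"
    and dim: "DIM('a) \<ge> 2"
    and le: "\<And>x b. b \<in> Basis \<Longrightarrow> v x \<le> (\<integral>\<^sup>+t. F (x + (t - x \<bullet> b) *\<^sub>R b) \<partial>lborel)"
  shows "(\<integral>\<^sup>+x. epow (v x) (DIM('a) / (real DIM('a) - 1)) \<partial>lborel)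
    \<le> epow (\<integral>\<^sup>+x. F x \<partial>lborel) (DIM('a) / (real DIM('a) - 1))"
proof -
  define \<Phi> where "\<Phi> f = (\<Sum>b\<in>Basis. f b *\<^sub>R b :: 'a)" for f
  define p where "p = 1 / (real DIM('a) - 1)"
  have p: "p > 0" "(real DIM('a) - 1) * p = 1" "real DIM('a) * p = DIM('a) / (real DIM('a) - 1)"
    "1 + p = DIM('a) / (real DIM('a) - 1)"
    using dim by (auto simp: p_def field_simps)
  have lb: "lborel = distr (lborel_prod Basis) borel \<Phi>"
    unfolding \<Phi>_def by (rule lborel_eq)
  have \<Phi>[measurable]: "\<Phi> \<in> lborel_prod Basis \<rightarrow>\<^sub>M borel"
    unfolding \<Phi>_def by measurable
  have int: "(\<integral>\<^sup>+x. h x \<partial>lborel) = (\<integral>\<^sup>+f. h (\<Phi> f) \<partial>lborel_prod Basis)"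
    if "h \<in> borel_measurable borel" for h :: "'a \<Rightarrow> ennreal"
    by (subst lb) (use that in \<open>simp add: nn_integral_distr\<close>)
  have \<Phi>_inner: "\<Phi> f \<bullet> b = f b" if "b \<in> Basis" for f b
    using that by (simp add: \<Phi>_def inner_sum_left inner_Basis if_distrib sum.delta cong: if_cong)
  have \<Phi>_upd: "\<Phi> (f(b := t)) = \<Phi> f + (t - \<Phi> f \<bullet> b) *\<^sub>R b" if b: "b \<in> Basis" for f b t
  proof -
    have "(\<Sum>c\<in>Basis - {b}. (f(b := t)) c *\<^sub>R c) = (\<Sum>c\<in>Basis - {b}. f c *\<^sub>R c)"
      by (intro sum.cong) auto
    then show ?thesis
      using b unfolding \<Phi>_inner[OF b] by (simp add: \<Phi>_def sum.remove[OF finite_Basis b] scaleR_left_diff_distrib)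
  qed
  have pt: "epow (v (\<Phi> f)) (real DIM('a) * p) \<le> (\<Prod>b\<in>Basis. epow (line_int b (\<lambda>f. F (\<Phi> f)) f) p)" for f
  proof -
    have "epow (v (\<Phi> f)) (real DIM('a) * p) = (\<Prod>b\<in>(Basis :: 'a set). epow (v (\<Phi> f)) p)"
      using p by (simp add: epow_power)
    also have "\<dots> \<le> (\<Prod>b\<in>Basis. epow (line_int b (\<lambda>f. F (\<Phi> f)) f) p)"
    proof (rule prod_mono_ennreal)
      fix b :: 'a assume b: "b \<in> Basis"
      show "epow (v (\<Phi> f)) p \<le> epow (line_int b (\<lambda>f. F (\<Phi> f)) f) p"
        using le[OF b, of "\<Phi> f"] p by (intro epow_mono) (auto simp: line_int_def \<Phi>_upd[OF b])
    qed
    finally show ?thesis .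
  qed
  have "(\<integral>\<^sup>+x. epow (v x) (real DIM('a) * p) \<partial>lborel) = (\<integral>\<^sup>+f. epow (v (\<Phi> f)) (real DIM('a) * p) \<partial>lborel_prod Basis)"
    by (rule int) measurable
  also have "\<dots> \<le> (\<integral>\<^sup>+f. epow (F (\<Phi> f)) (1 - (real (card (Basis :: 'a set)) - 1) * p) *
      (\<Prod>b\<in>Basis. epow (line_int b (\<lambda>f. F (\<Phi> f)) f) p) \<partial>lborel_prod Basis)"
    using pt p by (intro nn_integral_mono) simp
  also have "\<dots> \<le> epow (\<integral>\<^sup>+f. F (\<Phi> f) \<partial>lborel_prod Basis) (1 + p)"
    by (rule gridlines) (use p in auto)
  also have "(\<integral>\<^sup>+f. F (\<Phi> f) \<partial>lborel_prod Basis) = (\<integral>\<^sup>+x. F x \<partial>lborel)"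
    by (rule int[symmetric]) measurable
  finally show ?thesis using p by simp
qed

section \<open>Sobolev's inequality for functions of smooth functions\<close>

lemma integrable_powr_mult:
  fixes f g :: "'a \<Rightarrow> real"
  assumes pq: "p > 1" "q > 1" "1 / p + 1 / q = 1"
    and [measurable]: "f \<in> borel_measurable N" "g \<in> borel_measurable N"
    and int: "integrable N (\<lambda>x. \<bar>f x\<bar> powr p)" "integrable N (\<lambda>x. \<bar>g x\<bar> powr q)"
  shows "integrable N (\<lambda>x. f x * g x)"
proof (rule Bochner_Integration.integrable_bound)
  show "integrable N (\<lambda>x. \<bar>f x\<bar> powr p / p + \<bar>g x\<bar> powr q / q)" using int by simp
  show "AE x in N. norm (f x * g x) \<le> norm (\<bar>f x\<bar> powr p / p + \<bar>g x\<bar> powr q / q)"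
    using Youngs_inequality[OF pq, of "\<bar>f _\<bar>" "\<bar>g _\<bar>"] pq
    by (auto simp: abs_mult intro!: AE_I2 order_trans[OF _ abs_ge_self])
qed simp

lemma holder:
  fixes f g :: "'a \<Rightarrow> real"
  assumes pq: "p > 1" "q > 1" "1 / p + 1 / q = 1"
    and m[measurable]: "f \<in> borel_measurable N" "g \<in> borel_measurable N"
    and int: "integrable N (\<lambda>x. \<bar>f x\<bar> powr p)" "integrable N (\<lambda>x. \<bar>g x\<bar> powr q)"
  shows "(\<integral>x. \<bar>f x * g x\<bar> \<partial>N) \<le> (\<integral>x. \<bar>f x\<bar> powr p \<partial>N) powr (1 / p) * (\<integral>x. \<bar>g x\<bar> powr q \<partial>N) powr (1 / q)"
proof -
  let ?F = "\<lambda>i::bool. \<lambda>x. ennreal (if i then \<bar>f x\<bar> powr p else \<bar>g x\<bar> powr q)"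
  let ?w = "\<lambda>i::bool. if i then 1 / p else 1 / q"
  have "(\<integral>\<^sup>+x. (\<Prod>i\<in>UNIV. epow (?F i x) (?w i)) \<partial>N) \<le> (\<Prod>i\<in>UNIV. epow (\<integral>\<^sup>+x. ?F i x \<partial>N) (?w i))"
    by (rule nn_integral_holder) (use pq in \<open>auto simp: UNIV_bool\<close>)
  moreover have "(\<integral>\<^sup>+x. (\<Prod>i\<in>UNIV. epow (?F i x) (?w i)) \<partial>N) = ennreal (\<integral>x. \<bar>f x * g x\<bar> \<partial>N)"
  proof -
    have "(\<integral>\<^sup>+x. (\<Prod>i\<in>UNIV. epow (?F i x) (?w i)) \<partial>N) = (\<integral>\<^sup>+x. ennreal \<bar>f x * g x\<bar> \<partial>N)"
      using pq by (intro nn_integral_cong)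
        (simp add: UNIV_bool epow_ennreal powr_powr abs_mult mult.commute flip: ennreal_mult)
    also have "\<dots> = ennreal (\<integral>x. \<bar>f x * g x\<bar> \<partial>N)"
      by (intro nn_integral_eq_integral integrable_abs integrable_powr_mult[OF pq m int]) simp
    finally show ?thesis .
  qed
  moreover have "(\<Prod>i\<in>UNIV. epow (\<integral>\<^sup>+x. ?F i x \<partial>N) (?w i))
      = ennreal ((\<integral>x. \<bar>f x\<bar> powr p \<partial>N) powr (1 / p) * (\<integral>x. \<bar>g x\<bar> powr q \<partial>N) powr (1 / q))"
    using pq int by (simp add: UNIV_bool nn_integral_eq_integral epow_ennreal mult.commute flip: ennreal_mult)
  ultimately show ?thesis by (simp add: ennreal_le_iff)
qed

lemma cauchy_schwarz:
  fixes f g :: "'a \<Rightarrow> real"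
  assumes "f \<in> borel_measurable N" "g \<in> borel_measurable N"
    and "integrable N (\<lambda>x. (f x)\<^sup>2)" "integrable N (\<lambda>x. (g x)\<^sup>2)"
  shows "(\<integral>x. \<bar>f x * g x\<bar> \<partial>N) \<le> sqrt (\<integral>x. (f x)\<^sup>2 \<partial>N) * sqrt (\<integral>x. (g x)\<^sup>2 \<partial>N)"
proof -
  have "\<bar>a\<bar> powr 2 = a\<^sup>2" for a :: real by simp
  then show ?thesis
    using holder[of 2 2 f N g] assms by (simp add: powr_half_sqrt)
qed

text \<open>Up to the factor \<open>a + 1\<close>, this is the derivative of \<open>\<bar>s\<bar>\<close> to the power \<open>a + 1\<close>.\<close>

definition odd_powr :: "real \<Rightarrow> real \<Rightarrow> real" where
  "odd_powr s a = sgn s * \<bar>s\<bar> powr a"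

lemma abs_powr_has_derivative:
  assumes a: "a > 1"
  shows "((\<lambda>s. \<bar>s\<bar> powr a) has_real_derivative a * odd_powr s (a - 1)) (at s)"
proof -
  consider "s > 0" | "s < 0" | "s = 0" by linarith
  then show ?thesis
  proof cases
    case 1
    have "((\<lambda>s. s powr a) has_real_derivative a * s powr (a - 1)) (at s)"
      using 1 by (auto intro!: derivative_eq_intros)
    then have "((\<lambda>s. \<bar>s\<bar> powr a) has_real_derivative a * s powr (a - 1)) (at s)"
      by (rule has_field_derivative_transform_within_open[of _ _ _ "{0<..}"]) (use 1 in auto)
    then show ?thesis using 1 by (simp add: odd_powr_def)
  next
    case 2
    have "((\<lambda>s. (- s) powr a) has_real_derivative a * (- s) powr (a - 1) * (-1)) (at s)"
      using 2 by (auto intro!: derivative_eq_intros)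
    then have "((\<lambda>s. \<bar>s\<bar> powr a) has_real_derivative a * (- s) powr (a - 1) * (-1)) (at s)"
      by (rule has_field_derivative_transform_within_open[of _ _ _ "{..<0}"]) (use 2 in auto)
    then show ?thesis using 2 by (simp add: odd_powr_def)
  next
    case 3
    have "((\<lambda>h::real. \<bar>h\<bar> powr (a - 1)) \<longlongrightarrow> \<bar>0\<bar> powr (a - 1)) (at 0)"
      by (rule tendsto_powr'[OF tendsto_rabs[OF tendsto_ident_at] tendsto_const]) (use a in auto)
    then have "((\<lambda>h::real. \<bar>h\<bar> powr (a - 1)) \<longlongrightarrow> 0) (at 0)" using a by simp
    then have "((\<lambda>h::real. \<bar>h\<bar> powr a / h) \<longlongrightarrow> 0) (at 0)"
    proof (rule tendsto_rabs_zero_cancel[OF Lim_transform_eventually])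
      have "\<bar>h\<bar> powr (a - 1) = \<bar>\<bar>h\<bar> powr a / h\<bar>" if "h \<noteq> 0" for h :: real
        using that by (simp add: powr_diff)
      then show "\<forall>\<^sub>F h in at 0. \<bar>h\<bar> powr (a - 1) = \<bar>\<bar>h\<bar> powr a / h\<bar>"
        by (auto simp: eventually_at_filter)
    qed
    then show ?thesis using 3 a by (simp add: DERIV_def odd_powr_def)
  qed
qed

lemma continuous_odd_powr:
  assumes a: "a > 0" shows "continuous_on S (\<lambda>s. odd_powr s a)"
proof (rule continuous_at_imp_continuous_on, rule ballI)
  fix s :: real
  consider "s > 0" | "s < 0" | "s = 0" by linarith
  then show "isCont (\<lambda>s. odd_powr s a) s"
  proof cases
    case 1
    have "isCont (\<lambda>s. s powr a) s" using 1 by (auto intro!: continuous_intros)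
    moreover have "\<forall>\<^sub>F t in nhds s. odd_powr t a = t powr a"
      using eventually_nhds_in_open[of "{0<..}" s] 1 by (auto elim: eventually_mono simp: odd_powr_def)
    ultimately show ?thesis by (simp add: isCont_cong)
  next
    case 2
    have "isCont (\<lambda>s. - ((- s) powr a)) s" using 2 by (auto intro!: continuous_intros)
    moreover have "\<forall>\<^sub>F t in nhds s. odd_powr t a = - ((- t) powr a)"
      using eventually_nhds_in_open[of "{..<0}" s] 2 by (auto elim: eventually_mono simp: odd_powr_def)
    ultimately show ?thesis by (simp add: isCont_cong)
  next
    case 3
    have "((\<lambda>h::real. \<bar>h\<bar> powr a) \<longlongrightarrow> \<bar>0\<bar> powr a) (at 0)"
      by (rule tendsto_powr'[OF tendsto_rabs[OF tendsto_ident_at] tendsto_const]) (use a in auto)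
    then have "((\<lambda>h::real. \<bar>h\<bar> powr a) \<longlongrightarrow> 0) (at 0)" using a by simp
    moreover have "\<forall>\<^sub>F h in at 0. \<bar>h\<bar> powr a = \<bar>odd_powr h a\<bar>"
      by (auto simp: eventually_at_filter odd_powr_def abs_mult abs_sgn_eq)
    ultimately have "((\<lambda>h. \<bar>odd_powr h a\<bar>) \<longlongrightarrow> 0) (at 0)" by (rule Lim_transform_eventually)
    then have "((\<lambda>h. odd_powr h a) \<longlongrightarrow> 0) (at 0)" by (rule tendsto_rabs_zero_cancel)
    then show ?thesis using 3 by (simp add: isCont_def odd_powr_def)
  qed
qed

context bounded_open
begin

text \<open>Start from \<open>x\<close> in the negative direction \<open>i\<close> until the set, which is bounded, is left for the first time.
  There \<open>w\<close> vanishes, and the fundamental theorem of calculus is applied on the segment in between.\<close>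

lemma boundary_line_bound:
  assumes w: "smooth w" "\<And>x. x \<in> frontier \<Omega> \<Longrightarrow> w x = 0"
    and \<Theta>: "\<And>s. (\<Theta> has_real_derivative \<theta> s) (at s)" "continuous_on UNIV \<theta>" "\<Theta> 0 = 0"
    and x: "x \<in> \<Omega>"
  shows "ennreal \<bar>\<Theta> (w x)\<bar> \<le> (\<integral>\<^sup>+t. indicator \<Omega> (x + (t - x $ i) *\<^sub>R axis i 1) *
    ennreal \<bar>\<theta> (w (x + (t - x $ i) *\<^sub>R axis i 1)) * pd i w (x + (t - x $ i) *\<^sub>R axis i 1)\<bar> \<partial>lborel)"
proof -
  define y where "y t = x + (t - x $ i) *\<^sub>R axis i 1" for t
  have y_cont: "continuous_on S y" for S unfolding y_def by (intro continuous_intros)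
  have y_x: "y (x $ i) = x" by (simp add: y_def)
  have y_i: "y t $ i = t" for t by (simp add: y_def)
  define T where "T = {t. t \<le> x $ i \<and> y t \<notin> \<Omega>}"
  have clT: "closed T"
  proof -
    have "closed (y -` (- \<Omega>))" using open_dom unfolding y_def by (intro continuous_closed_vimage continuous_intros) simp
    moreover have "T = {..x $ i} \<inter> y -` (- \<Omega>)" by (auto simp: T_def)
    ultimately show ?thesis by (simp add: closed_Int)
  qed
  obtain R where R: "\<And>z. z \<in> \<Omega> \<Longrightarrow> norm z \<le> R" using bounded_dom by (auto simp: bounded_iff)
  have "y (min (x $ i) (- R - 1)) \<notin> \<Omega>"
  proof
    assume "y (min (x $ i) (- R - 1)) \<in> \<Omega>"
    then have "\<bar>min (x $ i) (- R - 1)\<bar> \<le> R" using R component_le_norm_cart y_i by (metis order_trans)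
    then show False by auto
  qed
  then have T0: "T \<noteq> {}" unfolding T_def by (metis (mono_tags, lifting) empty_iff mem_Collect_eq min.cobounded1)
  have T1: "bdd_above T" by (auto simp: T_def bdd_above_def)
  define a where "a = Sup T"
  have aT: "a \<in> T" unfolding a_def by (rule closed_contains_Sup[OF T0 T1 clT])
  have a_le: "a \<le> x $ i" "y a \<notin> \<Omega>" using aT by (auto simp: T_def)
  have "a \<noteq> x $ i" using a_le x y_x by auto
  then have a_lt: "a < x $ i" using a_le by simp
  have in_dom: "y t \<in> \<Omega>" if "a < t" "t \<le> x $ i" for t
    using cSup_upper[OF _ T1, of t] that unfolding a_def[symmetric] by (auto simp: T_def)
  have "y a \<in> closure \<Omega>"
  proof -
    have "y a \<in> closure (y ` {a<..x $ i})"
    proof -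
      have "a \<in> closure {a<..x $ i}" using a_lt by simp
      moreover have "y ` closure {a<..x $ i} \<subseteq> closure (y ` {a<..x $ i})"
        by (rule image_closure_subset[OF y_cont]) (auto intro: closure_subset[THEN subsetD])
      ultimately show ?thesis by blast
    qed
    moreover have "y ` {a<..x $ i} \<subseteq> \<Omega>" using in_dom by auto
    ultimately show ?thesis using closure_mono by blast
  qed
  then have wa: "w (y a) = 0"
    using a_le w(2) open_dom by (auto simp: frontier_def interior_open)
  define F where "F t = \<theta> (w (y t)) * pd i w (y t)" for t
  have dw: "((\<lambda>t. w (y t)) has_real_derivative pd i w (y t)) (at t)" for t
  proof -
    have "((\<lambda>t. t - x $ i) has_real_derivative 1) (at t)" by (auto intro!: derivative_eq_intros)
    then show ?thesis
    using DERIV_chain2[where f = "\<lambda>t. w (x + t *\<^sub>R axis i 1)" and g = "\<lambda>t. t - x $ i" and x = t,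
        OF smooth_line_derivative[OF w(1)], of 1 UNIV]
    by (simp add: y_def)
  qed
  have d: "((\<lambda>t. \<Theta> (w (y t))) has_real_derivative F t) (at t)" for t
    unfolding F_def by (rule DERIV_chain2[OF \<Theta>(1) dw])
  have Fc: "continuous_on S F" for S
    unfolding F_def
    by (intro continuous_intros continuous_on_compose2[OF \<Theta>(2)] continuous_on_compose2[OF smooth_continuous_on[OF w(1)] y_cont]
        continuous_on_compose2[OF smooth_continuous_on[OF smooth_pd[OF w(1)]] y_cont]) auto
  have F_meas[measurable]: "F \<in> borel_measurable borel" by (intro borel_measurable_continuous_onI Fc)
  have int: "integrable lborel (\<lambda>t. indicator {a..x $ i} t *\<^sub>R F t)"
    and eq: "(\<integral>t. indicator {a..x $ i} t *\<^sub>R F t \<partial>lborel) = \<Theta> (w (y (x $ i))) - \<Theta> (w (y a))"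
  proof -
    show "integrable lborel (\<lambda>t. indicator {a..x $ i} t *\<^sub>R F t)"
      using borel_integrable_atLeastAtMost'[OF Fc] by (simp add: set_integrable_def)
    show "(\<integral>t. indicator {a..x $ i} t *\<^sub>R F t \<partial>lborel) = \<Theta> (w (y (x $ i))) - \<Theta> (w (y a))"
      by (rule integral_FTC_Icc[OF a_le(1) _ Fc])
        (use d in \<open>auto intro: has_vector_derivative_at_within simp: has_real_derivative_iff_has_vector_derivative\<close>)
  qed
  have "ennreal \<bar>\<Theta> (w x)\<bar> \<le> (\<integral>\<^sup>+t. norm (indicator {a..x $ i} t *\<^sub>R F t) \<partial>lborel)"
    using integral_norm_bound_ennreal[OF int] eq by (simp add: wa \<Theta>(3) y_x)
  also have "\<dots> \<le> (\<integral>\<^sup>+t. indicator \<Omega> (y t) * ennreal \<bar>F t\<bar> \<partial>lborel)"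
  proof (rule nn_integral_mono_AE)
    show "AE t in lborel. ennreal (norm (indicator {a..x $ i} t *\<^sub>R F t)) \<le> indicator \<Omega> (y t) * ennreal \<bar>F t\<bar>"
      using AE_lborel_singleton[of a]
      by eventually_elim (use in_dom in \<open>auto simp: indicator_def\<close>)
  qed
  finally show ?thesis by (simp add: y_def F_def)
qed

end

locale bounded_open_dim = bounded_open \<Omega> for \<Omega> :: "(real^'n::finite) set" +
  fixes N :: nat
  assumes N_eq: "N = CARD('n)" and N3: "N \<ge> 3"
begin

abbreviation "crit \<equiv> 2 * real N / (real N - 2)"

text \<open>Apply the Gagliardo-Nirenberg inequality to \<open>\<Theta>(w) = \<bar>\<Phi>(w)\<bar>\<^sup>\<gamma>\<close>. For \<open>\<gamma> = 2(N - 1)/(N - 2)\<close> the power on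
  the left is the critical one, and after the Cauchy-Schwarz inequality the same integral reappears on the
  right with a smaller exponent, so it can be divided out.\<close>

lemma sobolev_composition:
  assumes w: "smooth w" "\<And>x. x \<in> frontier \<Omega> \<Longrightarrow> w x = 0"
    and \<Phi>: "\<And>s. (\<Phi> has_real_derivative \<phi> s) (at s)" "continuous_on UNIV \<phi>" "\<Phi> 0 = 0"
  shows "(\<integral>x. \<bar>\<Phi> (w x)\<bar> powr crit \<partial>M) powr ((real N - 2) / real N)
    \<le> (2 * (real N - 1) / (real N - 2))\<^sup>2 * real N * (\<integral>x. (\<phi> (w x))\<^sup>2 * (\<Sum>i\<in>UNIV. (pd i w x)\<^sup>2) \<partial>M)"
proof -
  define \<gamma> where "\<gamma> = 2 * (real N - 1) / (real N - 2)"
  have n3: "real N \<ge> 3" using N3 by simp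
  have \<gamma>: "\<gamma> > 1" "\<gamma> * (real N / (real N - 1)) = crit" "2 * (\<gamma> - 1) = crit"
  proof -
    have "real N - 1 > 0" "real N - 2 > 0" using n3 by auto
    then show "\<gamma> > 1" "\<gamma> * (real N / (real N - 1)) = crit" "2 * (\<gamma> - 1) = crit"
      unfolding \<gamma>_def by (simp_all add: divide_simps)
  qed
  define \<Theta> where "\<Theta> s = \<bar>\<Phi> s\<bar> powr \<gamma>" for s
  define \<theta> where "\<theta> s = \<gamma> * odd_powr (\<Phi> s) (\<gamma> - 1) * \<phi> s" for s
  have d: "(\<Theta> has_real_derivative \<theta> s) (at s)" for s
    unfolding \<Theta>_def \<theta>_def
    using DERIV_chain2[OF abs_powr_has_derivative[OF \<gamma>(1)] \<Phi>(1)] by simp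
  have \<Phi>c: "continuous_on S \<Phi>" for S
    using \<Phi>(1) DERIV_isCont continuous_at_imp_continuous_on by blast
  have \<theta>c: "continuous_on UNIV \<theta>"
    unfolding \<theta>_def using \<gamma>(1)
    by (intro continuous_intros \<Phi>(2) continuous_on_compose2[OF continuous_odd_powr[of "\<gamma> - 1" UNIV] \<Phi>c]) auto
  have \<Theta>0: "\<Theta> 0 = 0" using \<Phi>(3) by (simp add: \<Theta>_def)
  have wc: "continuous_on S w" "continuous_on S (pd i w)" for S i
    using w(1) by (auto intro: smooth_continuous_on smooth_pd)
  have comp: "continuous_on S (\<lambda>x. h (w x))" if "continuous_on UNIV h" for h :: "real \<Rightarrow> real" and S
    by (rule continuous_on_compose2[OF that wc(1)]) auto
  have \<Theta>c: "continuous_on UNIV \<Theta>"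
    using d DERIV_isCont continuous_at_imp_continuous_on by blast
  define D where "D x = (\<Sum>i\<in>UNIV. \<bar>pd i w x\<bar>)" for x
  have Dc: "continuous_on S D" for S unfolding D_def by (intro continuous_intros wc)
  define F where "F x = indicator \<Omega> x * ennreal (\<bar>\<theta> (w x)\<bar> * D x)" for x
  define v where "v x = indicator \<Omega> x * ennreal \<bar>\<Theta> (w x)\<bar>" for x
  have [measurable]: "(\<lambda>x. \<theta> (w x)) \<in> borel_measurable borel" "D \<in> borel_measurable borel"
    "(\<lambda>x. \<Theta> (w x)) \<in> borel_measurable borel"
    by (intro borel_measurable_continuous_onI comp \<theta>c \<Theta>c Dc)+
  have Fm: "F \<in> borel_measurable borel" and vm: "v \<in> borel_measurable borel"
    unfolding F_def v_def by measurable
  have DIM: "DIM(real^'n) = N" by (simp add: N_eq)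
  have "(\<integral>\<^sup>+x. epow (v x) (real N / (real N - 1)) \<partial>lborel)
    \<le> epow (\<integral>\<^sup>+x. F x \<partial>lborel) (real N / (real N - 1))"
  proof (rule gagliardo_nirenberg[OF Fm vm, unfolded DIM])
    show "N \<ge> 2" using N3 by simp
    fix x b :: "real^'n" assume "b \<in> Basis"
    then obtain i where b: "b = axis i 1" by (auto simp: Basis_vec_def)
    show "v x \<le> (\<integral>\<^sup>+t. F (x + (t - x \<bullet> b) *\<^sub>R b) \<partial>lborel)"
    proof (cases "x \<in> \<Omega>")
      case True
      have "v x \<le> (\<integral>\<^sup>+t. indicator \<Omega> (x + (t - x $ i) *\<^sub>R axis i 1) *
        ennreal \<bar>\<theta> (w (x + (t - x $ i) *\<^sub>R axis i 1)) * pd i w (x + (t - x $ i) *\<^sub>R axis i 1)\<bar> \<partial>lborel)"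
        using boundary_line_bound[OF w d \<theta>c \<Theta>0 True, of i] True by (simp add: v_def)
      also have "\<dots> \<le> (\<integral>\<^sup>+t. F (x + (t - x $ i) *\<^sub>R axis i 1) \<partial>lborel)"
        unfolding F_def abs_mult D_def
        by (intro nn_integral_mono mult_left_mono ennreal_leI member_le_sum[of i UNIV "\<lambda>i. \<bar>pd i w _\<bar>"]) auto
      finally show ?thesis by (simp add: b inner_axis)
    qed (simp add: v_def)
  qed
  moreover have "(\<integral>\<^sup>+x. F x \<partial>lborel) = ennreal (\<integral>x. \<bar>\<theta> (w x)\<bar> * D x \<partial>M)"
    unfolding F_def
    by (subst nn_integral_M_lborel[symmetric], measurable)
       (intro nn_integral_eq_integral continuous_integrable continuous_intros comp \<theta>c Dc AE_I2,
         auto simp: D_def sum_nonneg)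
  moreover have "(\<integral>\<^sup>+x. epow (v x) (real N / (real N - 1)) \<partial>lborel) = ennreal (\<integral>x. \<bar>\<Phi> (w x)\<bar> powr crit \<partial>M)"
  proof -
    have "(\<integral>\<^sup>+x. epow (v x) (real N / (real N - 1)) \<partial>lborel) = (\<integral>\<^sup>+x. indicator \<Omega> x * ennreal (\<bar>\<Phi> (w x)\<bar> powr crit) \<partial>lborel)"
      using n3 \<gamma>(2) by (intro nn_integral_cong)
        (auto simp: v_def indicator_def epow_ennreal epow_zero \<Theta>_def powr_powr)
    also have "\<dots> = (\<integral>\<^sup>+x. ennreal (\<bar>\<Phi> (w x)\<bar> powr crit) \<partial>M)"
      by (rule nn_integral_M_lborel[symmetric])
        (intro measurable_compose[OF borel_measurable_continuous_onI[OF comp[OF \<Phi>c]]], measurable)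
    also have "\<dots> = ennreal (\<integral>x. \<bar>\<Phi> (w x)\<bar> powr crit \<partial>M)"
      using n3 by (intro nn_integral_eq_integral continuous_integrable continuous_on_powr' continuous_intros comp \<Phi>c) auto
    finally show ?thesis .
  qed
  ultimately have GN: "(\<integral>x. \<bar>\<Phi> (w x)\<bar> powr crit \<partial>M) \<le> (\<integral>x. \<bar>\<theta> (w x)\<bar> * D x \<partial>M) powr (real N / (real N - 1))"
    using n3 by (simp add: epow_ennreal D_def sum_nonneg)
  define A where "A = (\<integral>x. \<bar>\<Phi> (w x)\<bar> powr crit \<partial>M)"
  define B where "B = (\<integral>x. (\<phi> (w x))\<^sup>2 * (\<Sum>i\<in>UNIV. (pd i w x)\<^sup>2) \<partial>M)"
  define E where "E = (\<integral>x. \<bar>\<theta> (w x)\<bar> * D x \<partial>M)"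
  have A0: "A \<ge> 0" and B0: "B \<ge> 0" and E0: "E \<ge> 0"
    by (auto simp: A_def B_def E_def D_def sum_nonneg)
  have E_le: "E \<le> \<gamma> * (sqrt A * sqrt (real N * B))"
  proof -
    let ?f = "\<lambda>x. \<bar>\<Phi> (w x)\<bar> powr (\<gamma> - 1)" and ?g = "\<lambda>x. \<phi> (w x) * D x"
    have fc: "continuous_on S ?f" for S
      using \<gamma>(1) by (intro continuous_on_powr' continuous_intros comp \<Phi>c) auto
    have gc: "continuous_on S ?g" for S by (intro continuous_intros comp \<Phi>(2) Dc)
    have "E = \<gamma> * (\<integral>x. \<bar>?f x * ?g x\<bar> \<partial>M)"
    proof -
      have "\<bar>\<theta> (w x)\<bar> * D x = \<gamma> * \<bar>?f x * ?g x\<bar>" for x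
        using \<gamma>(1) by (auto simp: \<theta>_def odd_powr_def abs_mult abs_sgn_eq D_def sum_nonneg)
      then show ?thesis by (simp add: E_def)
    qed
    also have "(\<integral>x. \<bar>?f x * ?g x\<bar> \<partial>M) \<le> sqrt (\<integral>x. (?f x)\<^sup>2 \<partial>M) * sqrt (\<integral>x. (?g x)\<^sup>2 \<partial>M)"
      by (intro cauchy_schwarz continuous_measurable continuous_integrable continuous_intros fc gc)
    also have "(\<integral>x. (?f x)\<^sup>2 \<partial>M) = A"
    proof -
      have "(?f x)\<^sup>2 = \<bar>\<Phi> (w x)\<bar> powr crit" for x
      proof -
        have "\<bar>\<Phi> (w x)\<bar> powr (2 * (\<gamma> - 1)) = (?f x)\<^sup>2"
          by (simp only: mult_2 powr_add power2_eq_square)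
        then show ?thesis unfolding \<gamma>(3) by simp
      qed
      then show ?thesis by (simp add: A_def)
    qed
    also have "(\<integral>x. (?g x)\<^sup>2 \<partial>M) \<le> real N * B"
    proof -
      have "(\<integral>x. (?g x)\<^sup>2 \<partial>M) \<le> (\<integral>x. real N * ((\<phi> (w x))\<^sup>2 * (\<Sum>i\<in>UNIV. (pd i w x)\<^sup>2)) \<partial>M)"
      proof (rule integral_mono)
        fix x
        have "(D x)\<^sup>2 \<le> (\<Sum>i\<in>UNIV. (pd i w x)\<^sup>2) * real N"
          using sum_squared_le_sum_of_squares[of "\<lambda>i. \<bar>pd i w x\<bar>" UNIV] by (simp add: D_def N_eq)
        then have "(\<phi> (w x))\<^sup>2 * (D x)\<^sup>2 \<le> (\<phi> (w x))\<^sup>2 * ((\<Sum>i\<in>UNIV. (pd i w x)\<^sup>2) * real N)"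
          by (intro mult_left_mono) auto
        then show "(?g x)\<^sup>2 \<le> real N * ((\<phi> (w x))\<^sup>2 * (\<Sum>i\<in>UNIV. (pd i w x)\<^sup>2))"
          by (simp add: power_mult_distrib mult_ac)
      qed (intro continuous_integrable continuous_intros comp \<Phi>(2) Dc wc)+
      then show ?thesis by (simp add: B_def)
    qed
    finally show ?thesis using \<gamma>(1) A0 by (simp add: mult_left_mono)
  qed
  have "A powr ((real N - 2) / real N) \<le> \<gamma>\<^sup>2 * real N * B"
  proof (cases "A = 0")
    case True
    then show ?thesis using B0 by simp
  next
    case False
    then have Ap: "A > 0" using A0 by simp
    have "A powr ((real N - 1) / real N) \<le> (E powr (real N / (real N - 1))) powr ((real N - 1) / real N)"
      using GN A0 n3 by (intro powr_mono2) (auto simp: A_def E_def)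
    also have "\<dots> = E" using E0 n3 by (simp add: powr_powr)
    finally have "A powr ((real N - 1) / real N) \<le> E" .
    then have "(A powr ((real N - 1) / real N))\<^sup>2 \<le> (\<gamma> * (sqrt A * sqrt (real N * B)))\<^sup>2"
      using E_le by (intro power_mono) auto
    also have "\<dots> = A * (\<gamma>\<^sup>2 * real N * B)"
      using A0 B0 by (simp add: power_mult_distrib)
    also have "(A powr ((real N - 1) / real N))\<^sup>2 = A * A powr ((real N - 2) / real N)"
    proof -
      have "(A powr ((real N - 1) / real N))\<^sup>2 = A powr (1 + (real N - 2) / real N)"
      proof -
        have "1 + (real N - 2) / real N = 2 * ((real N - 1) / real N)" using n3 by (simp add: field_simps)
        then show ?thesis by (simp only: mult_2 powr_add power2_eq_square)
      qed
      then show ?thesis using Ap by (simp add: powr_add)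
    qed
    finally show ?thesis using Ap by simp
  qed
  then show ?thesis by (simp add: A_def B_def \<gamma>_def)
qed

end

section \<open>Nonlinear test functions\<close>

subsection \<open>Polynomial approximation of a function together with its derivative\<close>

lemma poly_antiderivative:
  fixes p :: "real poly"
  obtains P where "pderiv P = p" "poly P 0 = 0"
proof
  define P where "P = (\<Sum>i\<le>degree p. monom (coeff p i / real (Suc i)) (Suc i))"
  have "pderiv P = (\<Sum>i\<le>degree p. monom (coeff p i) i)"
    unfolding P_def higher_pderiv_sum[of 1, simplified] by (intro sum.cong) (auto simp: pderiv_monom)
  then show "pderiv P = p" by (simp add: poly_as_sum_of_monoms)
  show "poly P 0 = 0" by (simp add: P_def poly_sum poly_monom)
qed

text \<open>Approximate \<open>h\<close> by a polynomial, correct its value at \<open>0\<close>, and integrate.\<close>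

lemma poly_C1_approx:
  fixes h H :: "real \<Rightarrow> real"
  assumes h: "continuous_on {-R..R} h" "h 0 = 0" and H: "\<And>t. (H has_real_derivative h t) (at t)" "H 0 = 0"
    and e: "e > 0" and R: "R \<ge> 0"
  obtains P where "poly P 0 = 0" "poly (pderiv P) 0 = 0"
    "\<And>t. \<bar>t\<bar> \<le> R \<Longrightarrow> \<bar>h t - poly (pderiv P) t\<bar> \<le> e"
    "\<And>t. \<bar>t\<bar> \<le> R \<Longrightarrow> \<bar>H t - poly P t\<bar> \<le> e * R"
proof -
  obtain g where g: "real_polynomial_function g" "\<And>t. t \<in> {-R..R} \<Longrightarrow> \<bar>h t - g t\<bar> < e / 2"
    using Stone_Weierstrass_real_polynomial_function[of "{-R..R}" h "e / 2"] h e by auto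
  obtain a n where gs: "g = (\<lambda>x. \<Sum>i\<le>n. a i * x ^ i)"
    using g(1) by (auto simp: real_polynomial_function_iff_sum)
  define q where "q = (\<Sum>i\<le>n. monom (a i) i)"
  have q: "poly q t = g t" for t by (simp add: q_def gs poly_sum poly_monom)
  \<comment> \<open>the correction by \<open>g 0\<close> makes the derivative vanish at the origin, as \<open>h\<close> does\<close>
  obtain P where P: "pderiv P = q - [:g 0:]" "poly P 0 = 0" using poly_antiderivative by metis
  have g0: "\<bar>g 0\<bar> < e / 2" using g(2)[of 0] h R by simp
  have hP: "\<bar>h t - poly (pderiv P) t\<bar> \<le> e" if "\<bar>t\<bar> \<le> R" for t
  proof -
    have "\<bar>h t - g t\<bar> < e / 2" using that by (intro g(2)) auto
    with g0 have "\<bar>h t - (g t - g 0)\<bar> \<le> e" by linarith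
    then show ?thesis by (simp add: P q)
  qed
  have dP: "((\<lambda>t. H t - poly P t) has_real_derivative h t - poly (pderiv P) t) (at t)" for t
    by (intro derivative_intros H poly_DERIV)
  have "\<bar>H t - poly P t\<bar> \<le> e * R" if t: "\<bar>t\<bar> \<le> R" for t
  proof (cases "t = 0")
    case False
    have "\<exists>z. \<bar>z\<bar> \<le> R \<and> H t - poly P t = t * (h z - poly (pderiv P) z)"
    proof (cases "t > 0")
      case True
      obtain z where "0 < z" "z < t" "H t - poly P t - (H 0 - poly P 0) = (t - 0) * (h z - poly (pderiv P) z)"
        using MVT2[OF True dP] by blast
      then show ?thesis using t H(2) P(2) by (intro exI[of _ z]) auto
    next
      case f: False
      then have "t < 0" using False by simp
      obtain z where "t < z" "z < 0" "H 0 - poly P 0 - (H t - poly P t) = (0 - t) * (h z - poly (pderiv P) z)"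
        using MVT2[OF \<open>t < 0\<close> dP] by blast
      then show ?thesis using t H(2) P(2) by (intro exI[of _ z]) auto
    qed
    then obtain z where z: "\<bar>z\<bar> \<le> R" "H t - poly P t = t * (h z - poly (pderiv P) z)" by blast
    have "\<bar>t\<bar> * \<bar>h z - poly (pderiv P) z\<bar> \<le> R * e" using t hP[OF z(1)] R by (intro mult_mono) auto
    then show ?thesis by (simp add: z abs_mult mult.commute)
  qed (use H P e R in simp)
  with that[OF P(2) _ hP] show ?thesis using P q by simp
qed

subsection \<open>Cutting off near the boundary\<close>

text \<open>This bounds the derivative of the cutoff \<open>flat (k t\<^sup>2 - 1)\<close> in terms of \<open>y = k t\<^sup>2 - 1\<close>.\<close>

lemma flat_deriv_bounds:
  fixes y :: real
  assumes "y > 0"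
  shows "(y + 1) * (exp (- (1 / y)) / y\<^sup>2) \<le> 2" "(y + 1) * (exp (- (1 / y)) / y\<^sup>2) \<le> 1 / y + 1 / y\<^sup>2"
    "0 \<le> (y + 1) * (exp (- (1 / y)) / y\<^sup>2)"
proof -
  define z where "z = 1 / y"
  have z: "z > 0" using assms by (simp add: z_def)
  have eq: "(y + 1) * (exp (- (1 / y)) / y\<^sup>2) = (z + z\<^sup>2) * exp (- z)"
    using assms by (simp add: z_def field_simps power2_eq_square)
  have "z + z\<^sup>2 \<le> 2 * exp z" using exp_lower_Taylor_quadratic[of z] z by linarith
  then have "(z + z\<^sup>2) * exp (- z) \<le> 2 * exp z * exp (- z)" by (intro mult_right_mono) auto
  then show "(y + 1) * (exp (- (1 / y)) / y\<^sup>2) \<le> 2" unfolding eq by (simp add: mult.assoc flip: exp_add)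
  have "(z + z\<^sup>2) * exp (- z) \<le> (z + z\<^sup>2) * 1" using z by (intro mult_left_mono) auto
  then show "(y + 1) * (exp (- (1 / y)) / y\<^sup>2) \<le> 1 / y + 1 / y\<^sup>2"
    unfolding eq by (simp add: z_def power_divide)
  show "0 \<le> (y + 1) * (exp (- (1 / y)) / y\<^sup>2)" using assms by simp
qed

context bounded_open
begin

text \<open>Functions that vanish near the boundary and are cut to zero outside are closed under partial
  derivatives, so they are smooth by coinduction. Their support misses the neighbourhood \<open>U\<close> of the boundary
  and is therefore a compact subset.\<close>

lemma smooth_extend_zero:
  assumes h: "smooth h" and U: "open U" "frontier \<Omega> \<subseteq> U" "\<And>x. x \<in> U \<Longrightarrow> h x = 0"
  shows "(\<lambda>x. if x \<in> \<Omega> then h x else 0) \<in> test_functions \<Omega>"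
    and "x \<in> \<Omega> \<Longrightarrow> pd i (\<lambda>x. if x \<in> \<Omega> then h x else 0) x = pd i h x"
proof -
  let ?ext = "\<lambda>h::real^'n \<Rightarrow> real. \<lambda>x. if x \<in> \<Omega> then h x else 0"
  have d1: "(?ext h has_derivative frechet_derivative h (at x)) (at x)" if "smooth h" "x \<in> \<Omega>" for h x
    by (rule has_derivative_transform_within_open[OF smooth_has_derivative[OF that(1)] open_dom that(2)]) simp
  have cl: "x \<in> U" if "x \<notin> \<Omega>" "x \<in> closure \<Omega>" for x
    using that U(2) open_dom by (auto simp: frontier_def interior_open)
  have d0: "(?ext h has_derivative (\<lambda>v. 0)) (at x)" if h: "\<And>x. x \<in> U \<Longrightarrow> h x = 0" and x: "x \<notin> \<Omega>" for h x
    by (rule has_derivative_transform_within_open[of "\<lambda>_. 0" _ _ _ "U \<union> - closure \<Omega>"])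
      (use h x U(1) cl closure_subset[of \<Omega>] in \<open>auto intro: open_Un\<close>)
  have pdU: "pd i h x = 0" if h: "\<And>x. x \<in> U \<Longrightarrow> h x = 0" and x: "x \<in> U" for h x i
  proof -
    have "(h has_derivative (\<lambda>v. 0)) (at x)"
      by (rule has_derivative_transform_within_open[of "\<lambda>_. 0", OF _ U(1) x]) (use h in auto)
    from pd_eqI[OF this] show ?thesis .
  qed
  have pd_ext: "pd i (?ext h) = ?ext (pd i h)" if "smooth h" "\<And>x. x \<in> U \<Longrightarrow> h x = 0" for h i
  proof
    fix x
    show "pd i (?ext h) x = ?ext (pd i h) x"
    proof (cases "x \<in> \<Omega>")
      case True
      from pd_eqI[OF d1[OF that(1) True]] True show ?thesis by simp
    next
      case False
      from pd_eqI[OF d0[OF that(2) False]] False show ?thesis by simp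
    qed
  qed
  have "smooth (?ext h)"
  proof (rule smooth_coinduct[where P = "\<lambda>g. \<exists>h. smooth h \<and> (\<forall>x\<in>U. h x = 0) \<and> g = ?ext h"])
    show "\<exists>h'. smooth h' \<and> (\<forall>x\<in>U. h' x = 0) \<and> ?ext h = ?ext h'" using h U(3) by blast
    fix g assume "\<exists>h. smooth h \<and> (\<forall>x\<in>U. h x = 0) \<and> g = ?ext h"
    then obtain h where h: "smooth h" "\<And>x. x \<in> U \<Longrightarrow> h x = 0" "g = ?ext h" by blast
    have "g differentiable (at x)" for x
      unfolding h(3) differentiable_def using d1[where x = x, OF h(1)] d0[where x = x and h = h] h(2) by blast
    moreover have "\<exists>h. smooth h \<and> (\<forall>x\<in>U. h x = 0) \<and> pd i g = ?ext h" for i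
      using pd_ext[where h = h and i = i] smooth_pd[OF h(1), of i] pdU[where h = h] h(1,2) unfolding h(3) by blast
    ultimately show "(\<forall>x. g differentiable (at x)) \<and> (\<forall>i. \<exists>h. smooth h \<and> (\<forall>x\<in>U. h x = 0) \<and> pd i g = ?ext h)"
      by blast
  qed
  then show "?ext h \<in> test_functions \<Omega>"
  proof (rule test_functionsI)
    show "compact (closure \<Omega> - U)" using bounded_dom U(1) by (intro compact_diff) simp_all
    show "closure \<Omega> - U \<subseteq> \<Omega>" using cl by blast
    show "?ext h x = 0" if "x \<notin> closure \<Omega> - U" for x
      using that U(3) closure_subset[of \<Omega>] by auto
  qed
  have "pd i (?ext h) = ?ext (pd i h)" by (rule pd_ext) (use h U(3) in auto)
  from fun_cong[OF this, of x] show "x \<in> \<Omega> \<Longrightarrow> pd i (?ext h) x = pd i h x" by simp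
qed

text \<open>The equation \<open>- div G = g\<close> in the sense of distributions.\<close>

definition minus_div :: "('n \<Rightarrow> real^'n \<Rightarrow> real) \<Rightarrow> (real^'n \<Rightarrow> real) \<Rightarrow> bool" where
  "minus_div G g \<longleftrightarrow> (\<forall>i. G i \<in> L2 \<Omega>) \<and> g \<in> L2 \<Omega> \<and>
     (\<forall>\<phi>\<in>test_functions \<Omega>. (\<Sum>i\<in>UNIV. \<integral>x. G i x * pd i \<phi> x \<partial>M) = (\<integral>x. g x * \<phi> x \<partial>M))"

lemma L2_mult_continuous_integrable:
  "f \<in> L2 \<Omega> \<Longrightarrow> continuous_on (closure \<Omega>) c \<Longrightarrow> integrable M (\<lambda>x. f x * c x)"
  by (rule L2_mult_integrable[OF _ continuous_L2])

text \<open>Multiply \<open>P(w)\<close> by the cutoff \<open>flat (k w\<^sup>2 - 1)\<close>, which vanishes where \<open>w\<^sup>2 < 1/k\<close>, in particular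
  near the boundary, and tends to \<open>1\<close> where \<open>w \<noteq> 0\<close>. As \<open>P(t)\<close> is at most of order \<open>t\<close>, the term containing
  the derivative of the cutoff stays bounded, and it tends to zero pointwise. Where \<open>w = 0\<close> the limit of
  the gradient is \<open>0\<close>, in agreement with \<open>P'(0) = 0\<close>.\<close>

lemma minus_div_poly:
  assumes div: "minus_div G g" and w: "smooth w" "\<And>x. x \<in> frontier \<Omega> \<Longrightarrow> w x = 0"
    and P: "poly P 0 = 0" "poly (pderiv P) 0 = 0"
  shows "(\<Sum>i\<in>UNIV. \<integral>x. G i x * (poly (pderiv P) (w x) * pd i w x) \<partial>M) = (\<integral>x. g x * poly P (w x) \<partial>M)"
proof -
  have G: "G i \<in> L2 \<Omega>" and g: "g \<in> L2 \<Omega>" for i using div by (auto simp: minus_div_def)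
  define \<eta> where "\<eta> k x = flat (real k * (w x)\<^sup>2 - 1) * poly P (w x)" for k x
  define \<psi> where "\<psi> k x = (if x \<in> \<Omega> then \<eta> k x else 0)" for k x
  define dfl where "dfl y = (if y > 0 then exp (- (1 / y)) / y\<^sup>2 else 0)" for y :: real
  have sm_arg: "smooth (\<lambda>x. real k * (w x)\<^sup>2 - 1)" for k
    by (rule smooth_diff[OF smooth_mult[OF smooth_const smooth_power[OF w(1)]] smooth_const])
  have sm_\<eta>: "smooth (\<eta> k)" for k
    unfolding \<eta>_def by (intro smooth_mult smooth_comp[OF sm_arg smooth1_flat] smooth_poly w)
  have test: "\<psi> k \<in> test_functions \<Omega>" and pd\<psi>: "\<And>x i. x \<in> \<Omega> \<Longrightarrow> pd i (\<psi> k) x = pd i (\<eta> k) x" for k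
  proof -
    let ?U = "{x. real k * (w x)\<^sup>2 < 1}"
    have U: "open ?U" "frontier \<Omega> \<subseteq> ?U" "\<And>x. x \<in> ?U \<Longrightarrow> \<eta> k x = 0"
      using w(2) by (auto simp: \<eta>_def flat_eq intro!: open_Collect_less continuous_intros smooth_continuous_on[OF w(1)])
    show "\<psi> k \<in> test_functions \<Omega>" unfolding \<psi>_def by (rule smooth_extend_zero(1)[OF sm_\<eta> U])
    show "\<And>x i. x \<in> \<Omega> \<Longrightarrow> pd i (\<psi> k) x = pd i (\<eta> k) x"
      unfolding \<psi>_def by (rule smooth_extend_zero(2)[OF sm_\<eta> U])
  qed
  define a where "a k t = dfl (real k * t\<^sup>2 - 1) * (2 * real k * t) * poly P t" for k t
  define b where "b k t = flat (real k * t\<^sup>2 - 1) * poly (pderiv P) t" for k t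
  have pd\<eta>: "pd i (\<eta> k) x = (a k (w x) + b k (w x)) * pd i w x" for i k x
  proof -
    have "((\<lambda>t. flat (real k * t\<^sup>2 - 1) * poly P t) has_real_derivative
        flat (real k * t\<^sup>2 - 1) * poly (pderiv P) t + dfl (real k * t\<^sup>2 - 1) * (2 * real k * t) * poly P t) (at t)" for t
    proof -
      have "((\<lambda>t. real k * t\<^sup>2 - 1) has_real_derivative 2 * real k * t) (at t)"
        by (auto intro!: derivative_eq_intros)
      from DERIV_chain2[OF flat_deriv this]
      have "((\<lambda>t. flat (real k * t\<^sup>2 - 1)) has_real_derivative dfl (real k * t\<^sup>2 - 1) * (2 * real k * t)) (at t)"
        by (simp add: dfl_def)
      from DERIV_mult[OF this poly_DERIV] show ?thesis by (simp add: mult_ac add.commute)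
    qed
    from pd_comp[OF w(1) this] show ?thesis
      by (simp add: \<eta>_def[abs_def] a_def b_def add.commute)
  qed
  obtain R where R: "R > 0" "\<And>x. x \<in> closure \<Omega> \<Longrightarrow> \<bar>w x\<bar> \<le> R"
    using continuous_bounded[OF smooth_continuous_on[OF w(1)]] by metis
  have R': "\<bar>w x\<bar> \<le> R" if "x \<in> \<Omega>" for x using R(2) that closure_subset by blast
  obtain Q where Q: "P = [:0, 1:] * Q"
    using P(1) by (metis dvd_def minus_zero poly_eq_0_iff_dvd)
  have "compact (poly Q ` {-R..R})" by (intro compact_continuous_image continuous_on_poly continuous_on_id) simp
  then obtain C where C: "C > 0" "\<And>t. t \<in> {-R..R} \<Longrightarrow> \<bar>poly Q t\<bar> \<le> C"
    by (auto dest!: compact_imp_bounded simp: bounded_pos)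
  have a_eq: "\<bar>a k t\<bar> \<le> 2 * C * ((real k * t\<^sup>2 - 1 + 1) * dfl (real k * t\<^sup>2 - 1))" if "\<bar>t\<bar> \<le> R" for k t
  proof -
    have dn: "dfl y \<ge> 0" for y by (simp add: dfl_def)
    have "\<bar>a k t\<bar> = 2 * (real k * t\<^sup>2) * dfl (real k * t\<^sup>2 - 1) * \<bar>poly Q t\<bar>"
    proof -
      have "a k t = (2 * (real k * t\<^sup>2) * dfl (real k * t\<^sup>2 - 1)) * poly Q t"
        by (simp add: a_def Q power2_eq_square)
      then show ?thesis using dn by (simp add: abs_mult)
    qed
    also have "\<dots> \<le> 2 * (real k * t\<^sup>2) * dfl (real k * t\<^sup>2 - 1) * C"
      using C(2)[of t] that dn by (intro mult_left_mono) (auto simp: abs_le_iff)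
    finally show ?thesis by (simp add: mult_ac)
  qed
  have a_bd: "\<bar>a k t\<bar> \<le> 4 * C" if "\<bar>t\<bar> \<le> R" for k t
  proof -
    have "(real k * t\<^sup>2 - 1 + 1) * dfl (real k * t\<^sup>2 - 1) \<le> 2"
      using flat_deriv_bounds(1)[of "real k * t\<^sup>2 - 1"] by (auto simp: dfl_def)
    then have "2 * C * ((real k * t\<^sup>2 - 1 + 1) * dfl (real k * t\<^sup>2 - 1)) \<le> 2 * C * 2"
      using C(1) by (intro mult_left_mono) auto
    with a_eq[OF that, of k] show ?thesis by linarith
  qed
  have lim_arg: "filterlim (\<lambda>k. real k * t\<^sup>2 - 1) at_top sequentially" if "t \<noteq> 0" for t
    using that filterlim_tendsto_add_at_top[OF tendsto_const[of "-1"]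
      filterlim_at_top_mult_tendsto_pos[OF tendsto_const _ filterlim_real_sequentially, of "t\<^sup>2"]] by simp
  have a_lim: "(\<lambda>k. a k t) \<longlonglongrightarrow> 0" if t: "\<bar>t\<bar> \<le> R" for t
  proof (cases "t = 0")
    case False
    have "((\<lambda>y::real. 2 * C * (1 / y + 1 / y\<^sup>2)) \<longlongrightarrow> 2 * C * (0 + 0)) at_top"
      by (intro tendsto_intros) (simp_all add: divide_inverse tendsto_inverse_0_at_top filterlim_ident filterlim_pow_at_top)
    then have l: "(\<lambda>k. 2 * C * (1 / (real k * t\<^sup>2 - 1) + 1 / (real k * t\<^sup>2 - 1)\<^sup>2)) \<longlonglongrightarrow> 0"
      using filterlim_compose[OF _ lim_arg[OF False], of "\<lambda>y. 2 * C * (1 / y + 1 / y\<^sup>2)"] by simp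
    show ?thesis
    proof (rule Lim_null_comparison[OF _ l])
      have "\<forall>\<^sub>F k in sequentially. real k * t\<^sup>2 - 1 > 0"
        using lim_arg[OF False] unfolding filterlim_at_top_dense by blast
      then show "\<forall>\<^sub>F k in sequentially. norm (a k t) \<le> 2 * C * (1 / (real k * t\<^sup>2 - 1) + 1 / (real k * t\<^sup>2 - 1)\<^sup>2)"
      proof eventually_elim
        case (elim k)
        have "2 * C * ((real k * t\<^sup>2 - 1 + 1) * dfl (real k * t\<^sup>2 - 1)) \<le> 2 * C * (1 / (real k * t\<^sup>2 - 1) + 1 / (real k * t\<^sup>2 - 1)\<^sup>2)"
          using flat_deriv_bounds(2)[OF elim] elim C(1) by (intro mult_left_mono) (auto simp: dfl_def)
        with a_eq[OF t, of k] show ?case by (simp only: real_norm_def)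
      qed
    qed
  qed (simp add: a_def)
  have flat_lim: "(\<lambda>k. flat (real k * t\<^sup>2 - 1)) \<longlonglongrightarrow> 1" if "t \<noteq> 0" for t
    by (rule filterlim_compose[OF flat_tendsto_1 lim_arg[OF that]])
  have b_lim: "(\<lambda>k. b k t) \<longlonglongrightarrow> poly (pderiv P) t" for t
  proof (cases "t = 0")
    case False
    from tendsto_mult[OF flat_lim[OF this] tendsto_const] show ?thesis by (simp add: b_def)
  qed (simp add: b_def P)
  have \<eta>_lim: "(\<lambda>k. \<eta> k x) \<longlonglongrightarrow> poly P (w x)" for x
  proof (cases "w x = 0")
    case False
    from tendsto_mult[OF flat_lim[OF this] tendsto_const] show ?thesis by (simp add: \<eta>_def)
  qed (simp add: \<eta>_def P)
  have b_bd: "\<bar>b k t\<bar> \<le> \<bar>poly (pderiv P) t\<bar>" for k t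
    unfolding b_def abs_mult using flat_nonneg flat_le_1 by (intro mult_left_le_one_le) auto
  have wc: "continuous_on S (\<lambda>x. poly p (w x))" "continuous_on S (pd i w)" for S p i
    using w(1) by (auto intro!: smooth_continuous_on smooth_poly smooth_pd)
  have meas: "G i \<in> borel_measurable M" "g \<in> borel_measurable M" for i
    using G g by (auto intro: L2_measurable)
  have L: "(\<lambda>k. \<integral>x. G i x * pd i (\<psi> k) x \<partial>M) \<longlonglongrightarrow> (\<integral>x. G i x * (poly (pderiv P) (w x) * pd i w x) \<partial>M)" for i
  proof (rule integral_dominated_convergence[where w = "\<lambda>x. \<bar>G i x\<bar> * ((4 * C + \<bar>poly (pderiv P) (w x)\<bar>) * \<bar>pd i w x\<bar>)"])
    show "(\<lambda>x. G i x * (poly (pderiv P) (w x) * pd i w x)) \<in> borel_measurable M"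
      by (intro borel_measurable_times meas continuous_measurable wc)
    show "(\<lambda>x. G i x * pd i (\<psi> k) x) \<in> borel_measurable M" for k
      using test_smooth[OF test] by (intro borel_measurable_times meas smooth_measurable smooth_pd)
    have "integrable M (\<lambda>x. G i x * ((4 * C + \<bar>poly (pderiv P) (w x)\<bar>) * \<bar>pd i w x\<bar>))"
      by (intro L2_mult_continuous_integrable G continuous_intros wc)
    from integrable_abs[OF this]
    show "integrable M (\<lambda>x. \<bar>G i x\<bar> * ((4 * C + \<bar>poly (pderiv P) (w x)\<bar>) * \<bar>pd i w x\<bar>))"
      using C(1) by (simp add: abs_mult)
    show "AE x in M. (\<lambda>k. G i x * pd i (\<psi> k) x) \<longlonglongrightarrow> G i x * (poly (pderiv P) (w x) * pd i w x)"
    proof (rule AE_M_I)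
      fix x assume x: "x \<in> \<Omega>"
      have "(\<lambda>k. G i x * ((a k (w x) + b k (w x)) * pd i w x)) \<longlonglongrightarrow> G i x * ((0 + poly (pderiv P) (w x)) * pd i w x)"
        by (intro tendsto_intros a_lim b_lim R' x)
      then show "(\<lambda>k. G i x * pd i (\<psi> k) x) \<longlonglongrightarrow> G i x * (poly (pderiv P) (w x) * pd i w x)"
        by (simp add: pd\<psi>[OF x] pd\<eta>)
    qed
    show "AE x in M. norm (G i x * pd i (\<psi> k) x) \<le> \<bar>G i x\<bar> * ((4 * C + \<bar>poly (pderiv P) (w x)\<bar>) * \<bar>pd i w x\<bar>)" for k
    proof (rule AE_M_I)
      fix x assume x: "x \<in> \<Omega>"
      have "\<bar>a k (w x) + b k (w x)\<bar> \<le> 4 * C + \<bar>poly (pderiv P) (w x)\<bar>"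
        using a_bd[OF R'[OF x], of k] b_bd[of k "w x"] by linarith
      then show "norm (G i x * pd i (\<psi> k) x) \<le> \<bar>G i x\<bar> * ((4 * C + \<bar>poly (pderiv P) (w x)\<bar>) * \<bar>pd i w x\<bar>)"
        unfolding pd\<psi>[OF x] pd\<eta> real_norm_def abs_mult by (intro mult_left_mono mult_right_mono) auto
    qed
  qed
  have Rg: "(\<lambda>k. \<integral>x. g x * \<psi> k x \<partial>M) \<longlonglongrightarrow> (\<integral>x. g x * poly P (w x) \<partial>M)"
  proof (rule integral_dominated_convergence[where w = "\<lambda>x. \<bar>g x\<bar> * \<bar>poly P (w x)\<bar>"])
    show "(\<lambda>x. g x * poly P (w x)) \<in> borel_measurable M"
      by (intro borel_measurable_times meas continuous_measurable wc)
    show "(\<lambda>x. g x * \<psi> k x) \<in> borel_measurable M" for k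
      using test_smooth[OF test] by (intro borel_measurable_times meas smooth_measurable)
    show "integrable M (\<lambda>x. \<bar>g x\<bar> * \<bar>poly P (w x)\<bar>)"
      using integrable_abs[OF L2_mult_continuous_integrable[OF g wc(1)]] by (simp add: abs_mult)
    show "AE x in M. (\<lambda>k. g x * \<psi> k x) \<longlonglongrightarrow> g x * poly P (w x)"
      by (rule AE_M_I) (auto simp: \<psi>_def intro!: tendsto_intros \<eta>_lim)
    show "AE x in M. norm (g x * \<psi> k x) \<le> \<bar>g x\<bar> * \<bar>poly P (w x)\<bar>" for k
    proof (rule AE_M_I)
      fix x assume "x \<in> \<Omega>"
      have "\<bar>\<eta> k x\<bar> \<le> \<bar>poly P (w x)\<bar>"
        unfolding \<eta>_def abs_mult using flat_nonneg flat_le_1 by (intro mult_left_le_one_le) auto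
      then show "norm (g x * \<psi> k x) \<le> \<bar>g x\<bar> * \<bar>poly P (w x)\<bar>"
        by (auto simp: abs_mult \<psi>_def intro!: mult_left_mono)
    qed
  qed
  have "(\<lambda>k. \<Sum>i\<in>UNIV. \<integral>x. G i x * pd i (\<psi> k) x \<partial>M) \<longlonglongrightarrow> (\<Sum>i\<in>UNIV. \<integral>x. G i x * (poly (pderiv P) (w x) * pd i w x) \<partial>M)"
    by (intro tendsto_sum L)
  moreover have "(\<Sum>i\<in>UNIV. \<integral>x. G i x * pd i (\<psi> k) x \<partial>M) = (\<integral>x. g x * \<psi> k x \<partial>M)" for k
    using div test by (simp add: minus_div_def)
  ultimately show ?thesis using Rg LIMSEQ_unique by simp
qed

text \<open>Both sides are continuous in \<open>H\<close> for the \<open>C\<^sup>1\<close> norm on the range of \<open>w\<close>, where polynomials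
  are dense.\<close>

lemma minus_div_comp:
  assumes div: "minus_div G g" and w: "smooth w" "\<And>x. x \<in> frontier \<Omega> \<Longrightarrow> w x = 0"
    and h: "continuous_on UNIV h" "h 0 = 0" and H: "\<And>t. (H has_real_derivative h t) (at t)" "H 0 = 0"
  shows "(\<Sum>i\<in>UNIV. \<integral>x. G i x * (h (w x) * pd i w x) \<partial>M) = (\<integral>x. g x * H (w x) \<partial>M)"
proof -
  have G: "G i \<in> L2 \<Omega>" and g: "g \<in> L2 \<Omega>" for i using div by (auto simp: minus_div_def)
  obtain R where R: "R > 0" "\<And>x. x \<in> closure \<Omega> \<Longrightarrow> \<bar>w x\<bar> \<le> R"
    using continuous_bounded[OF smooth_continuous_on[OF w(1)]] by metis
  have R': "\<bar>w x\<bar> \<le> R" if "x \<in> \<Omega>" for x using R(2) that closure_subset by blast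
  have wc: "continuous_on S w" "continuous_on S (pd i w)" "continuous_on S (\<lambda>x. poly p (w x))" for S i p
    using w(1) by (auto intro!: smooth_continuous_on smooth_pd smooth_poly)
  have Hc: "continuous_on UNIV H" using H(1) DERIV_isCont continuous_at_imp_continuous_on by blast
  have hw: "continuous_on S (\<lambda>x. h (w x))" "continuous_on S (\<lambda>x. H (w x))" for S
    by (rule continuous_on_compose2[OF h(1) wc(1)], simp) (rule continuous_on_compose2[OF Hc wc(1)], simp)
  define D where "D = (\<Sum>i\<in>UNIV. \<integral>x. G i x * (h (w x) * pd i w x) \<partial>M) - (\<integral>x. g x * H (w x) \<partial>M)"
  define K where "K = (\<Sum>i\<in>UNIV. \<integral>x. \<bar>G i x * pd i w x\<bar> \<partial>M) + R * (\<integral>x. \<bar>g x\<bar> \<partial>M)"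
  have K0: "K \<ge> 0" using R(1) by (auto simp: K_def sum_nonneg)
  have "\<bar>D\<bar> \<le> e * K" if e: "e > 0" for e
  proof -
    obtain P where P: "poly P 0 = 0" "poly (pderiv P) 0 = 0"
      "\<And>t. \<bar>t\<bar> \<le> R \<Longrightarrow> \<bar>h t - poly (pderiv P) t\<bar> \<le> e" "\<And>t. \<bar>t\<bar> \<le> R \<Longrightarrow> \<bar>H t - poly P t\<bar> \<le> e * R"
    proof (rule poly_C1_approx[OF _ h(2) H e])
      show "continuous_on {-R..R} h" using h(1) continuous_on_subset by blast
    qed (use R in auto)
    have i1: "integrable M (\<lambda>x. G i x * (h (w x) * pd i w x))" "integrable M (\<lambda>x. G i x * (poly p (w x) * pd i w x))" for i p
      by (intro L2_mult_continuous_integrable G continuous_intros hw wc)+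
    have i2: "integrable M (\<lambda>x. g x * H (w x))" "integrable M (\<lambda>x. g x * poly p (w x))" for p
      by (intro L2_mult_continuous_integrable g hw wc)+
    have "D = (\<Sum>i\<in>UNIV. \<integral>x. G i x * ((h (w x) - poly (pderiv P) (w x)) * pd i w x) \<partial>M)
        - (\<integral>x. g x * (H (w x) - poly P (w x)) \<partial>M)"
    proof -
      have "(\<integral>x. G i x * ((h (w x) - poly (pderiv P) (w x)) * pd i w x) \<partial>M)
        = (\<integral>x. G i x * (h (w x) * pd i w x) \<partial>M) - (\<integral>x. G i x * (poly (pderiv P) (w x) * pd i w x) \<partial>M)" for i
        using i1 by (simp add: left_diff_distrib right_diff_distrib)
      moreover have "(\<integral>x. g x * (H (w x) - poly P (w x)) \<partial>M) = (\<integral>x. g x * H (w x) \<partial>M) - (\<integral>x. g x * poly P (w x) \<partial>M)"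
        using i2 by (simp add: right_diff_distrib)
      ultimately show ?thesis using minus_div_poly[OF div w P(1,2)] by (simp add: D_def sum_subtractf)
    qed
    also have "\<bar>\<dots>\<bar> \<le> (\<Sum>i\<in>UNIV. e * (\<integral>x. \<bar>G i x * pd i w x\<bar> \<partial>M)) + e * R * (\<integral>x. \<bar>g x\<bar> \<partial>M)"
    proof (intro order_trans[OF abs_triangle_ineq4] add_mono order_trans[OF sum_abs] sum_mono)
      fix i
      have "\<bar>\<integral>x. G i x * ((h (w x) - poly (pderiv P) (w x)) * pd i w x) \<partial>M\<bar> \<le> (\<integral>x. e * \<bar>G i x * pd i w x\<bar> \<partial>M)"
      proof (rule integral_abs_bound_integral)
        show "integrable M (\<lambda>x. G i x * ((h (w x) - poly (pderiv P) (w x)) * pd i w x))"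
          by (intro L2_mult_continuous_integrable G continuous_intros hw wc)
        show "integrable M (\<lambda>x. e * \<bar>G i x * pd i w x\<bar>)"
          by (intro integrable_mult_right integrable_abs L2_mult_continuous_integrable G wc)
        show "\<bar>G i x * ((h (w x) - poly (pderiv P) (w x)) * pd i w x)\<bar> \<le> e * \<bar>G i x * pd i w x\<bar>" if "x \<in> space M" for x
        proof -
          have "\<bar>h (w x) - poly (pderiv P) (w x)\<bar> * \<bar>G i x * pd i w x\<bar> \<le> e * \<bar>G i x * pd i w x\<bar>"
            using P(3)[OF R'] that by (intro mult_right_mono) auto
          then show ?thesis by (simp add: abs_mult mult_ac)
        qed
      qed
      then show "\<bar>\<integral>x. G i x * ((h (w x) - poly (pderiv P) (w x)) * pd i w x) \<partial>M\<bar> \<le> e * (\<integral>x. \<bar>G i x * pd i w x\<bar> \<partial>M)"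
        by simp
    next
      have "\<bar>\<integral>x. g x * (H (w x) - poly P (w x)) \<partial>M\<bar> \<le> (\<integral>x. (e * R) * \<bar>g x\<bar> \<partial>M)"
      proof (rule integral_abs_bound_integral)
        show "integrable M (\<lambda>x. g x * (H (w x) - poly P (w x)))"
          by (intro L2_mult_continuous_integrable g continuous_intros hw wc)
        show "integrable M (\<lambda>x. (e * R) * \<bar>g x\<bar>)" using L2_integrable[OF g] by simp
        show "\<bar>g x * (H (w x) - poly P (w x))\<bar> \<le> (e * R) * \<bar>g x\<bar>" if "x \<in> space M" for x
          using mult_right_mono[OF P(4)[OF R'], of x "\<bar>g x\<bar>"] that by (simp add: abs_mult mult.commute)
      qed
      then show "\<bar>\<integral>x. g x * (H (w x) - poly P (w x)) \<partial>M\<bar> \<le> e * R * (\<integral>x. \<bar>g x\<bar> \<partial>M)" by simp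
    qed
    also have "\<dots> = e * K" by (simp add: K_def distrib_left sum_distrib_left)
    finally show ?thesis .
  qed
  then have "\<bar>D\<bar> \<le> e" if "e > 0" for e
  proof -
    have "\<bar>D\<bar> \<le> e / (K + 1) * K" using \<open>\<And>e. e > 0 \<Longrightarrow> \<bar>D\<bar> \<le> e * K\<close>[of "e / (K + 1)"] that K0 by simp
    also have "\<dots> \<le> e" using that K0 by (simp add: field_simps)
    finally show ?thesis .
  qed
  then have "D = 0" using field_le_epsilon[of "\<bar>D\<bar>" 0] by simp
  then show ?thesis by (simp add: D_def)
qed

end

section \<open>The Sobolev embedding\<close>

lemma primitive_has_derivative:
  assumes "continuous_on UNIV (f x)"
  shows "(primitive f x has_real_derivative f x s) (at s)"
proof -
  define K where "K = \<bar>s\<bar> + 1"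
  have "((\<lambda>u. LBINT t=0..u. f x t) has_vector_derivative f x s) (at s within {-K..K})"
    unfolding zero_ereal_def
    by (rule interval_integral_FTC2) (use assms in \<open>auto simp: K_def intro: continuous_on_subset\<close>)
  moreover have "s \<in> interior {-K..K}" by (auto simp: K_def interior_atLeastAtMost_real)
  ultimately show ?thesis
    unfolding primitive_def[abs_def] has_real_derivative_iff_has_vector_derivative
    by (simp only: at_within_interior zero_ereal_def)
qed

lemma primitive_0 [simp]: "primitive f x 0 = 0"
  by (simp add: primitive_def)

text \<open>Whenever \<open>A k\<close> exceeds the bound \<open>T\<close>, the difference \<open>A\<^sup>\<alpha> - K A\<^sup>\<beta> = A\<^sup>\<beta> (A\<^bsup>\<alpha> - \<beta>\<^esup> - K)\<close> is at
  least a fixed positive number, which the error \<open>e k\<close> cannot compensate for large \<open>k\<close>.\<close>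

lemma self_improving_bound:
  fixes A e :: "nat \<Rightarrow> real"
  assumes A: "\<And>k. A k \<ge> 0" "\<And>k. A k powr \<alpha> \<le> K * A k powr \<beta> + e k" and e: "e \<longlonglongrightarrow> 0"
    and ab: "0 < \<beta>" "\<beta> < \<alpha>" and K: "K \<ge> 0" and \<epsilon>: "\<epsilon> > 0"
  shows "\<forall>\<^sub>F k in sequentially. A k \<le> K powr (1 / (\<alpha> - \<beta>)) + \<epsilon>"
proof -
  define T where "T = K powr (1 / (\<alpha> - \<beta>)) + \<epsilon>"
  have T: "T > 0" using \<epsilon> by (simp add: T_def add_nonneg_pos)
  have "K = (K powr (1 / (\<alpha> - \<beta>))) powr (\<alpha> - \<beta>)" using K ab by (simp add: powr_powr)
  also have "\<dots> < T powr (\<alpha> - \<beta>)" using \<epsilon> ab by (intro powr_less_mono2) (auto simp: T_def)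
  finally have KT: "K < T powr (\<alpha> - \<beta>)" .
  have "T powr \<beta> * (T powr (\<alpha> - \<beta>) - K) > 0" using T KT by simp
  with e have "\<forall>\<^sub>F k in sequentially. e k < T powr \<beta> * (T powr (\<alpha> - \<beta>) - K)"
    by (rule order_tendstoD)
  then show ?thesis
  proof eventually_elim
    case (elim k)
    have "A k \<le> T"
    proof (rule ccontr)
      assume "\<not> A k \<le> T"
      then have AT: "A k > T" by simp
      have "T powr \<beta> * (T powr (\<alpha> - \<beta>) - K) \<le> A k powr \<beta> * (A k powr (\<alpha> - \<beta>) - K)"
        using AT T KT ab by (intro mult_mono powr_mono2 diff_right_mono) auto
      also have "\<dots> = A k powr \<alpha> - K * A k powr \<beta>"
        by (simp add: right_diff_distrib powr_add[symmetric])
      finally show False using A(2)[of k] elim by linarith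
    qed
    then show ?case by (simp add: T_def)
  qed
qed

definition Lnorm :: "real \<Rightarrow> 'a measure \<Rightarrow> ('a \<Rightarrow> real) \<Rightarrow> real" where
  "Lnorm p N f = (\<integral>x. \<bar>f x\<bar> powr p \<partial>N) powr (1 / p)"

lemma Lnorm_nonneg: "Lnorm p N f \<ge> 0" by (simp add: Lnorm_def)

lemma Lnorm_bound:
  assumes f: "f \<in> borel_measurable N" and b: "(\<integral>\<^sup>+x. ennreal (\<bar>f x\<bar> powr p) \<partial>N) \<le> ennreal (B powr p)"
    and B: "B \<ge> 0" "p > 0"
  shows "integrable N (\<lambda>x. \<bar>f x\<bar> powr p)" "Lnorm p N f \<le> B"
proof -
  show i: "integrable N (\<lambda>x. \<bar>f x\<bar> powr p)"
    by (rule integrableI_nonneg) (use f b in \<open>auto intro: le_less_trans\<close>)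
  have "(\<integral>x. \<bar>f x\<bar> powr p \<partial>N) \<le> B powr p"
    using b nn_integral_eq_integral[OF i] by (simp add: ennreal_le_iff)
  then have "Lnorm p N f \<le> (B powr p) powr (1 / p)"
    unfolding Lnorm_def using B by (intro powr_mono2) auto
  then show "Lnorm p N f \<le> B" using B by (simp add: powr_powr)
qed

context bounded_open
begin

text \<open>Along a subsequence \<open>w\<^sub>k\<close> converges to \<open>v\<close> almost everywhere, and Fatou's lemma applies.\<close>

lemma fatou_approx:
  assumes w: "\<And>k. smooth (w k)" and v: "v \<in> L2 \<Omega>" and lim: "(\<lambda>k. \<integral>x. (w k x - v x)\<^sup>2 \<partial>M) \<longlonglongrightarrow> 0"
    and \<Psi>: "continuous_on UNIV \<Psi>" "\<And>t. \<Psi> t \<ge> 0" and B: "B \<ge> 0"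
    and bd: "\<And>\<epsilon>. \<epsilon> > 0 \<Longrightarrow> \<forall>\<^sub>F k in sequentially. (\<integral>x. \<Psi> (w k x) \<partial>M) \<le> B + \<epsilon>"
  shows "(\<integral>\<^sup>+x. ennreal (\<Psi> (v x)) \<partial>M) \<le> ennreal B"
proof -
  have wv: "integrable M (\<lambda>x. (w k x - v x)\<^sup>2)" for k
    by (rule L2_square_integrable[OF L2_diff[OF smooth_L2[OF w] v]])
  have "(\<lambda>k. \<integral>x. norm ((w k x - v x)\<^sup>2) \<partial>M) \<longlonglongrightarrow> 0" using lim by simp
  from tendsto_L1_AE_subseq[OF wv this]
  obtain r :: "nat \<Rightarrow> nat" where r: "strict_mono r" "AE x in M. (\<lambda>k. (w (r k) x - v x)\<^sup>2) \<longlonglongrightarrow> 0" by blast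
  have \<Psi>w: "continuous_on S (\<lambda>x. \<Psi> (w k x))" for S k
    by (rule continuous_on_compose2[OF \<Psi>(1) smooth_continuous_on[OF w]]) simp
  have ae: "AE x in M. ennreal (\<Psi> (v x)) = liminf (\<lambda>k. ennreal (\<Psi> (w (r k) x)))"
    using r(2)
  proof eventually_elim
    case (elim x)
    then have "(\<lambda>k. sqrt ((w (r k) x - v x)\<^sup>2)) \<longlonglongrightarrow> sqrt 0" by (rule tendsto_real_sqrt)
    then have "(\<lambda>k. w (r k) x - v x) \<longlonglongrightarrow> 0" by (simp add: tendsto_rabs_zero_iff)
    then have "(\<lambda>k. w (r k) x) \<longlonglongrightarrow> v x" by (simp add: LIM_zero_iff)
    moreover have "isCont \<Psi> (v x)" using \<Psi>(1) by (simp add: continuous_on_eq_continuous_at)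
    ultimately have "(\<lambda>k. \<Psi> (w (r k) x)) \<longlonglongrightarrow> \<Psi> (v x)" by (rule isCont_tendsto_compose[rotated])
    then have "(\<lambda>k. ennreal (\<Psi> (w (r k) x))) \<longlonglongrightarrow> ennreal (\<Psi> (v x))" by (rule tendsto_ennrealI)
    then show ?case using lim_imp_Liminf[OF sequentially_bot] by metis
  qed
  have "(\<integral>\<^sup>+x. ennreal (\<Psi> (v x)) \<partial>M) = (\<integral>\<^sup>+x. liminf (\<lambda>k. ennreal (\<Psi> (w (r k) x))) \<partial>M)"
    by (rule nn_integral_cong_AE[OF ae])
  also have "\<dots> \<le> liminf (\<lambda>k. \<integral>\<^sup>+x. ennreal (\<Psi> (w (r k) x)) \<partial>M)"
    by (rule nn_integral_liminf) (intro measurable_compose[OF continuous_measurable[OF \<Psi>w]] measurable_ennreal)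
  finally have le: "(\<integral>\<^sup>+x. ennreal (\<Psi> (v x)) \<partial>M) \<le> liminf (\<lambda>k. \<integral>\<^sup>+x. ennreal (\<Psi> (w (r k) x)) \<partial>M)" .
  show ?thesis
  proof (rule ennreal_le_epsilon)
    fix \<epsilon> :: real assume \<epsilon>: "\<epsilon> > 0"
    have "\<forall>\<^sub>F k in sequentially. (\<integral>x. \<Psi> (w (r k) x) \<partial>M) \<le> B + \<epsilon>"
      by (rule eventually_subseq[OF r(1) bd[OF \<epsilon>]])
    then have "\<forall>\<^sub>F k in sequentially. (\<integral>\<^sup>+x. ennreal (\<Psi> (w (r k) x)) \<partial>M) \<le> ennreal (B + \<epsilon>)"
    proof eventually_elim
      case (elim k)
      have "(\<integral>\<^sup>+x. ennreal (\<Psi> (w (r k) x)) \<partial>M) = ennreal (\<integral>x. \<Psi> (w (r k) x) \<partial>M)"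
        using \<Psi>(2) by (intro nn_integral_eq_integral continuous_integrable \<Psi>w) auto
      then show ?case using elim by (simp add: ennreal_leI)
    qed
    then have "limsup (\<lambda>k. \<integral>\<^sup>+x. ennreal (\<Psi> (w (r k) x)) \<partial>M) \<le> ennreal (B + \<epsilon>)"
      by (rule Limsup_bounded)
    then have "(\<integral>\<^sup>+x. ennreal (\<Psi> (v x)) \<partial>M) \<le> ennreal (B + \<epsilon>)"
      by (rule order_trans[OF order_trans[OF le Liminf_le_Limsup[OF sequentially_bot]]])
    then show "(\<integral>\<^sup>+x. ennreal (\<Psi> (v x)) \<partial>M) \<le> ennreal B + ennreal \<epsilon>"
      using B \<epsilon> by (simp add: ennreal_plus)
  qed
qed

lemma H10_approxD:
  assumes "H10_approx w v G"
  shows "smooth (w k)" "x \<in> frontier \<Omega> \<Longrightarrow> w k x = 0" "(\<lambda>k. \<integral>x. (w k x - v x)\<^sup>2 \<partial>M) \<longlonglongrightarrow> 0"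
    "(\<lambda>k. \<integral>x. (pd i (w k) x - G i x)\<^sup>2 \<partial>M) \<longlonglongrightarrow> 0"
  using assms by (auto simp: H10_approx_def)

lemma square_integral_diff_bound:
  assumes "f \<in> L2 \<Omega>" "g \<in> L2 \<Omega>"
  shows "(\<integral>x. (f x)\<^sup>2 \<partial>M) \<le> 2 * (\<integral>x. (f x - g x)\<^sup>2 \<partial>M) + 2 * (\<integral>x. (g x)\<^sup>2 \<partial>M)"
proof -
  note i = L2_square_integrable[OF assms(1)] L2_square_integrable[OF L2_diff[OF assms]] L2_square_integrable[OF assms(2)]
  have "(\<integral>x. (f x)\<^sup>2 \<partial>M) \<le> (\<integral>x. 2 * (f x - g x)\<^sup>2 + 2 * (g x)\<^sup>2 \<partial>M)"
  proof (rule integral_mono)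
    show "(f x)\<^sup>2 \<le> 2 * (f x - g x)\<^sup>2 + 2 * (g x)\<^sup>2" for x
      using zero_le_power2[of "f x - 2 * g x"] by (simp add: power2_diff power2_eq_square algebra_simps)
  qed (use i in auto)
  then show ?thesis using i by simp
qed

end

context bounded_open_dim
begin

definition "sob_const = (2 * (real N - 1) / (real N - 2))\<^sup>2 * real N"

lemma sob_const_pos: "sob_const > 0"
  using N3 by (simp add: sob_const_def)

text \<open>This is Sobolev's inequality for the approximating functions, carried over to the limit. Estimating their
  gradients crudely by twice those of the limit only affects the constant.\<close>

lemma sobolev_H10:
  assumes app: "H10_approx w v G" and v: "v \<in> L2 \<Omega>" and G: "\<And>i. G i \<in> L2 \<Omega>"
  shows "integrable M (\<lambda>x. \<bar>v x\<bar> powr crit)"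
    and "Lnorm crit M v \<le> sqrt (2 * sob_const * (\<Sum>i\<in>UNIV. \<integral>x. (G i x)\<^sup>2 \<partial>M))"
proof -
  note a = H10_approxD[OF app]
  define \<alpha> where "\<alpha> = real N / (real N - 2)"
  have n: "real N \<ge> 3" using N3 by simp
  have \<alpha>: "\<alpha> > 0" "(real N - 2) / real N * \<alpha> = 1" "crit / 2 = \<alpha>" using n by (auto simp: \<alpha>_def field_simps)
  define d where "d k = (\<Sum>i\<in>UNIV. \<integral>x. (pd i (w k) x - G i x)\<^sup>2 \<partial>M)" for k
  define S where "S = (\<Sum>i\<in>UNIV. \<integral>x. (G i x)\<^sup>2 \<partial>M)"
  have S0: "S \<ge> 0" "d k \<ge> 0" for k by (auto simp: S_def d_def sum_nonneg)
  define B where "B = 2 * sob_const * S"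
  have B0: "B \<ge> 0" using S0 sob_const_pos by (simp add: B_def)
  have wc: "continuous_on X (w k)" "continuous_on X (pd i (w k))" for X k i
    using a(1) by (auto intro: smooth_continuous_on smooth_pd)
  have bd: "(\<integral>x. \<bar>w k x\<bar> powr crit \<partial>M) \<le> (2 * sob_const * (d k + S)) powr \<alpha>" for k
  proof -
    let ?A = "\<integral>x. \<bar>w k x\<bar> powr crit \<partial>M"
    have "?A powr ((real N - 2) / real N) \<le> sob_const * (\<integral>x. (\<Sum>i\<in>UNIV. (pd i (w k) x)\<^sup>2) \<partial>M)"
      using sobolev_composition[OF a(1,2), where \<Phi> = "\<lambda>s. s" and \<phi> = "\<lambda>s. 1"]
      by (simp add: sob_const_def)
    also have "(\<integral>x. (\<Sum>i\<in>UNIV. (pd i (w k) x)\<^sup>2) \<partial>M) = (\<Sum>i\<in>UNIV. \<integral>x. (pd i (w k) x)\<^sup>2 \<partial>M)"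
      by (intro Bochner_Integration.integral_sum continuous_integrable continuous_intros wc)
    also have "\<dots> \<le> (\<Sum>i\<in>UNIV. 2 * (\<integral>x. (pd i (w k) x - G i x)\<^sup>2 \<partial>M) + 2 * (\<integral>x. (G i x)\<^sup>2 \<partial>M))"
      by (intro sum_mono square_integral_diff_bound G smooth_L2 smooth_pd a(1))
    also have "\<dots> = 2 * (d k + S)" by (simp add: d_def S_def sum.distrib sum_distrib_left)
    finally have "?A powr ((real N - 2) / real N) \<le> 2 * sob_const * (d k + S)"
      using sob_const_pos by (simp add: mult_ac)
    then have "(?A powr ((real N - 2) / real N)) powr \<alpha> \<le> (2 * sob_const * (d k + S)) powr \<alpha>"
      using \<alpha> by (intro powr_mono2) auto
    then show ?thesis using \<alpha> by (simp add: powr_powr)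
  qed
  have "(\<lambda>k. (2 * sob_const * (d k + S)) powr \<alpha>) \<longlonglongrightarrow> (2 * sob_const * (0 + S)) powr \<alpha>"
  proof (rule tendsto_powr'[OF _ tendsto_const])
    have "d \<longlonglongrightarrow> (\<Sum>i\<in>(UNIV::'n set). 0)" unfolding d_def by (intro tendsto_sum a(4))
    then show "(\<lambda>k. 2 * sob_const * (d k + S)) \<longlonglongrightarrow> 2 * sob_const * (0 + S)" by (intro tendsto_intros) simp
  qed (use S0 \<alpha> sob_const_pos in \<open>auto intro!: always_eventually\<close>)
  then have lim: "(\<lambda>k. (2 * sob_const * (d k + S)) powr \<alpha>) \<longlonglongrightarrow> B powr \<alpha>" by (simp add: B_def)
  have "(\<integral>\<^sup>+x. ennreal (\<bar>v x\<bar> powr crit) \<partial>M) \<le> ennreal (B powr \<alpha>)"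
  proof (rule fatou_approx[OF a(1) v a(3), where \<Psi> = "\<lambda>t. \<bar>t\<bar> powr crit"])
    show "continuous_on UNIV (\<lambda>t::real. \<bar>t\<bar> powr crit)"
      using n by (intro continuous_on_powr' continuous_intros) auto
    fix \<epsilon> :: real assume "\<epsilon> > 0"
    with lim have "\<forall>\<^sub>F k in sequentially. (2 * sob_const * (d k + S)) powr \<alpha> < B powr \<alpha> + \<epsilon>"
      by (intro order_tendstoD) auto
    then show "\<forall>\<^sub>F k in sequentially. (\<integral>x. \<bar>w k x\<bar> powr crit \<partial>M) \<le> B powr \<alpha> + \<epsilon>"
      by eventually_elim (rule order_trans[OF bd less_imp_le])
  qed (auto simp: powr_ge_zero)
  moreover have "B powr \<alpha> = (sqrt B) powr crit"
  proof -
    have "sqrt B powr crit = (B powr (1 / 2)) powr crit" using B0 by (simp add: powr_half_sqrt)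
    also have "\<dots> = B powr (1 / 2 * crit)" by (rule powr_powr)
    also have "1 / 2 * crit = \<alpha>" by (simp add: \<alpha>_def)
    finally show ?thesis by simp
  qed
  ultimately have "(\<integral>\<^sup>+x. ennreal (\<bar>v x\<bar> powr crit) \<partial>M) \<le> ennreal (sqrt B powr crit)" by simp
  from Lnorm_bound[OF L2_measurable[OF v] this] n B0
  show "integrable M (\<lambda>x. \<bar>v x\<bar> powr crit)"
    "Lnorm crit M v \<le> sqrt (2 * sob_const * (\<Sum>i\<in>UNIV. \<integral>x. (G i x)\<^sup>2 \<partial>M))"
    by (auto simp: B_def S_def)
qed

text \<open>With \<open>A\<^sub>k\<close> the integral of \<open>\<bar>\<Phi>(w\<^sub>k)\<bar>\<close> to the critical power, Sobolev's inequality bounds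
  \<open>A\<^sub>k\<close> to the power \<open>(N - 2)/N\<close> by the integral of \<open>\<phi>(w\<^sub>k)\<^sup>2 \<bar>\<nabla>w\<^sub>k\<bar>\<^sup>2\<close>. Replacing one factor \<open>\<nabla>w\<^sub>k\<close> by its
  limit \<open>G\<close> costs an error that vanishes as \<open>k\<close> grows, because \<open>\<phi>\<close> is bounded, and turns the integral into
  \<open>\<integral> g H(w\<^sub>k)\<close>. By Hoelder's inequality and the growth of \<open>H\<close> this is a multiple of \<open>A\<^sub>k\<close> to the smaller power
  \<open>1 - 1/r\<close>, so the bound improves itself.\<close>

lemma nonlinear_bound:
  assumes app: "H10_approx w v G" and v: "v \<in> L2 \<Omega>" and div: "minus_div G g"
    and \<phi>: "continuous_on UNIV \<phi>" "\<And>s. \<bar>\<phi> s\<bar> \<le> L" "\<phi> 0 = 0"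
    and \<Phi>: "\<And>s. (\<Phi> has_real_derivative \<phi> s) (at s)" "\<Phi> 0 = 0"
    and H: "\<And>s. (H has_real_derivative (\<phi> s)\<^sup>2) (at s)" "H 0 = 0"
    and r: "r > 1" "1 / r > 2 / real N" and g: "integrable M (\<lambda>x. \<bar>g x\<bar> powr r)"
    and c: "c \<ge> 0" "\<And>t. \<bar>H t\<bar> \<le> c * \<bar>\<Phi> t\<bar> powr (crit * (1 - 1 / r))"
  shows "(\<integral>\<^sup>+x. ennreal (\<bar>\<Phi> (v x)\<bar> powr crit) \<partial>M)
    \<le> ennreal ((sob_const * c * Lnorm r M g) powr (1 / (1 / r - 2 / real N)))"
proof -
  note a = H10_approxD[OF app]
  have n: "real N \<ge> 3" using N3 by simp
  have G: "G i \<in> L2 \<Omega>" and gL: "g \<in> L2 \<Omega>" for i using div by (auto simp: minus_div_def)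
  have wc: "continuous_on X (w k)" "continuous_on X (pd i (w k))" for X k i
    using a(1) by (auto intro: smooth_continuous_on smooth_pd)
  have \<Phi>c: "continuous_on UNIV \<Phi>"
    using \<Phi>(1) DERIV_isCont continuous_at_imp_continuous_on by blast
  have Hc: "continuous_on UNIV H"
    using H(1) DERIV_isCont continuous_at_imp_continuous_on by blast
  have comp: "continuous_on X (\<lambda>x. h (w k x))" if "continuous_on UNIV h" for h :: "real \<Rightarrow> real" and X k
    by (rule continuous_on_compose2[OF that wc(1)]) auto
  have L0: "L \<ge> 0" using \<phi>(2)[of 0] by linarith
  define A where "A k = (\<integral>x. \<bar>\<Phi> (w k x)\<bar> powr crit \<partial>M)" for k
  define d where "d k i = (\<integral>x. (pd i (w k) x - G i x)\<^sup>2 \<partial>M)" for k i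
  define \<gamma> where "\<gamma> i = (\<integral>x. (G i x)\<^sup>2 \<partial>M)" for i
  define e where "e k = sob_const * (\<Sum>i\<in>UNIV. L\<^sup>2 * (sqrt (d k i) * sqrt (2 * d k i + 2 * \<gamma> i)))" for k
  have e0: "e \<longlonglongrightarrow> 0"
  proof -
    have "e \<longlonglongrightarrow> sob_const * (\<Sum>i\<in>(UNIV::'n set). L\<^sup>2 * (sqrt 0 * sqrt (2 * 0 + 2 * \<gamma> i)))"
      unfolding e_def by (intro tendsto_intros a(4)[folded d_def])
    then show ?thesis by simp
  qed
  define q where "q = r / (r - 1)"
  have q: "q > 1" "1 / r + 1 / q = 1" "1 / q = 1 - 1 / r" "(1 - 1 / r) * q = 1"
    using r(1) by (auto simp: q_def field_simps)
  have gH: "(\<integral>x. g x * H (w k x) \<partial>M) \<le> Lnorm r M g * (c * A k powr (1 - 1 / r))" for k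
  proof -
    have Hq: "integrable M (\<lambda>x. \<bar>H (w k x)\<bar> powr q)"
      using q by (intro continuous_integrable continuous_on_powr' continuous_intros comp Hc) auto
    have "(\<integral>x. g x * H (w k x) \<partial>M) \<le> (\<integral>x. \<bar>g x * H (w k x)\<bar> \<partial>M)"
      using L2_mult_continuous_integrable[OF gL comp[OF Hc]] by (intro integral_mono) auto
    also have "\<dots> \<le> Lnorm r M g * (\<integral>x. \<bar>H (w k x)\<bar> powr q \<partial>M) powr (1 / q)"
      unfolding Lnorm_def
      by (intro holder r(1) q L2_measurable[OF gL] continuous_measurable comp Hc g Hq)
    also have "\<dots> \<le> Lnorm r M g * (c powr q * A k) powr (1 / q)"
    proof (intro mult_left_mono Lnorm_nonneg powr_mono2)
      have "(\<integral>x. \<bar>H (w k x)\<bar> powr q \<partial>M) \<le> (\<integral>x. c powr q * \<bar>\<Phi> (w k x)\<bar> powr crit \<partial>M)"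
      proof (rule integral_mono[OF Hq])
        show "integrable M (\<lambda>x. c powr q * \<bar>\<Phi> (w k x)\<bar> powr crit)"
          using n by (intro continuous_integrable continuous_on_powr' continuous_intros comp \<Phi>c) auto
        fix x
        have "\<bar>H (w k x)\<bar> powr q \<le> (c * \<bar>\<Phi> (w k x)\<bar> powr (crit * (1 - 1 / r))) powr q"
          using c q by (intro powr_mono2) auto
        also have "\<dots> = c powr q * \<bar>\<Phi> (w k x)\<bar> powr (crit * ((1 - 1 / r) * q))"
          using c(1) by (simp add: powr_mult powr_powr mult.assoc)
        finally show "\<bar>H (w k x)\<bar> powr q \<le> c powr q * \<bar>\<Phi> (w k x)\<bar> powr crit" by (simp only: q(4) mult_1_right)
      qed
      then show "(\<integral>x. \<bar>H (w k x)\<bar> powr q \<partial>M) \<le> c powr q * A k" by (simp add: A_def)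
    qed (use q r(1) in auto)
    also have "(c powr q * A k) powr (1 / q) = c * A k powr (1 - 1 / r)"
      unfolding q(3)[symmetric] using c(1) q(1) by (simp add: powr_mult powr_powr A_def)
    finally show ?thesis .
  qed
  have main: "A k powr ((real N - 2) / real N) \<le> (sob_const * c * Lnorm r M g) * A k powr (1 - 1 / r) + e k" for k
  proof -
    let ?h = "\<lambda>x. (\<phi> (w k x))\<^sup>2"
    have hc: "continuous_on X ?h" for X by (intro continuous_intros comp \<phi>(1))
    have "A k powr ((real N - 2) / real N) \<le> sob_const * (\<integral>x. ?h x * (\<Sum>i\<in>UNIV. (pd i (w k) x)\<^sup>2) \<partial>M)"
      unfolding A_def sob_const_def by (rule sobolev_composition[OF a(1,2) \<Phi>(1) \<phi>(1) \<Phi>(2)])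
    also have "(\<integral>x. ?h x * (\<Sum>i\<in>UNIV. (pd i (w k) x)\<^sup>2) \<partial>M) = (\<Sum>i\<in>UNIV. \<integral>x. ?h x * (pd i (w k) x)\<^sup>2 \<partial>M)"
      unfolding sum_distrib_left
      by (intro Bochner_Integration.integral_sum continuous_integrable continuous_intros hc wc)
    also have "\<dots> = (\<Sum>i\<in>UNIV. (\<integral>x. G i x * (?h x * pd i (w k) x) \<partial>M)
        + (\<integral>x. (pd i (w k) x - G i x) * (?h x * pd i (w k) x) \<partial>M))"
    proof (rule sum.cong[OF refl])
      fix i
      have "integrable M (\<lambda>x. G i x * (?h x * pd i (w k) x))"
        "integrable M (\<lambda>x. (pd i (w k) x - G i x) * (?h x * pd i (w k) x))"
        by (intro L2_mult_continuous_integrable L2_diff[OF smooth_L2[OF smooth_pd[OF a(1)]]] G continuous_intros hc wc)+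
      then have "(\<integral>x. G i x * (?h x * pd i (w k) x) \<partial>M) + (\<integral>x. (pd i (w k) x - G i x) * (?h x * pd i (w k) x) \<partial>M)
        = (\<integral>x. G i x * (?h x * pd i (w k) x) + (pd i (w k) x - G i x) * (?h x * pd i (w k) x) \<partial>M)" by simp
      also have "\<dots> = (\<integral>x. ?h x * (pd i (w k) x)\<^sup>2 \<partial>M)"
        by (rule Bochner_Integration.integral_cong) (simp_all add: algebra_simps power2_eq_square)
      finally show "(\<integral>x. ?h x * (pd i (w k) x)\<^sup>2 \<partial>M) = (\<integral>x. G i x * (?h x * pd i (w k) x) \<partial>M)
        + (\<integral>x. (pd i (w k) x - G i x) * (?h x * pd i (w k) x) \<partial>M)" by simp
    qed
    also have "\<dots> = (\<integral>x. g x * H (w k x) \<partial>M) + (\<Sum>i\<in>UNIV. \<integral>x. (pd i (w k) x - G i x) * (?h x * pd i (w k) x) \<partial>M)"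
      unfolding sum.distrib
      by (subst minus_div_comp[OF div a(1,2) _ _ H]) (use \<phi> in \<open>auto intro!: continuous_intros\<close>)
    also have "\<dots> \<le> Lnorm r M g * (c * A k powr (1 - 1 / r)) + (\<Sum>i\<in>UNIV. L\<^sup>2 * (sqrt (d k i) * sqrt (2 * d k i + 2 * \<gamma> i)))"
    proof (intro add_mono gH sum_mono)
      fix i
      note D2 = L2_diff[OF smooth_L2[OF smooth_pd[OF a(1)]] G, of k i i]
      note W2 = smooth_L2[OF smooth_pd[OF a(1)], of k i]
      have "(\<integral>x. (pd i (w k) x - G i x) * (?h x * pd i (w k) x) \<partial>M) \<le> (\<integral>x. L\<^sup>2 * \<bar>(pd i (w k) x - G i x) * pd i (w k) x\<bar> \<partial>M)"
      proof (rule integral_mono)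
        show "integrable M (\<lambda>x. (pd i (w k) x - G i x) * (?h x * pd i (w k) x))"
          by (intro L2_mult_continuous_integrable D2 continuous_intros hc wc)
        show "integrable M (\<lambda>x. L\<^sup>2 * \<bar>(pd i (w k) x - G i x) * pd i (w k) x\<bar>)"
          by (intro integrable_mult_right integrable_abs L2_mult_integrable D2 W2)
        fix x
        have "(\<phi> (w k x))\<^sup>2 \<le> L\<^sup>2" using \<phi>(2)[of "w k x"] L0 by (simp add: abs_le_square_iff[symmetric])
        then have "(\<phi> (w k x))\<^sup>2 * \<bar>(pd i (w k) x - G i x) * pd i (w k) x\<bar> \<le> L\<^sup>2 * \<bar>(pd i (w k) x - G i x) * pd i (w k) x\<bar>"
          by (intro mult_right_mono) auto
        moreover have "(pd i (w k) x - G i x) * (?h x * pd i (w k) x) \<le> \<bar>(pd i (w k) x - G i x) * (?h x * pd i (w k) x)\<bar>"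
          by (rule abs_ge_self)
        ultimately show "(pd i (w k) x - G i x) * (?h x * pd i (w k) x) \<le> L\<^sup>2 * \<bar>(pd i (w k) x - G i x) * pd i (w k) x\<bar>"
          by (simp add: abs_mult mult_ac)
      qed
      also have "\<dots> = L\<^sup>2 * (\<integral>x. \<bar>(pd i (w k) x - G i x) * pd i (w k) x\<bar> \<partial>M)" by simp
      also have "\<dots> \<le> L\<^sup>2 * (sqrt (d k i) * sqrt (\<integral>x. (pd i (w k) x)\<^sup>2 \<partial>M))"
        unfolding d_def
        by (intro mult_left_mono cauchy_schwarz L2_measurable L2_square_integrable D2 W2) simp
      also have "\<dots> \<le> L\<^sup>2 * (sqrt (d k i) * sqrt (2 * d k i + 2 * \<gamma> i))"
        unfolding d_def \<gamma>_def
        by (intro mult_left_mono real_sqrt_le_mono square_integral_diff_bound W2 G) auto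
      finally show "(\<integral>x. (pd i (w k) x - G i x) * (?h x * pd i (w k) x) \<partial>M) \<le> L\<^sup>2 * (sqrt (d k i) * sqrt (2 * d k i + 2 * \<gamma> i))" .
    qed
    finally show ?thesis
      using sob_const_pos by (simp add: e_def distrib_left mult_ac)
  qed
  have ex: "(real N - 2) / real N - (1 - 1 / r) = 1 / r - 2 / real N" using n by (simp add: field_simps)
  show ?thesis
  proof (rule fatou_approx[OF a(1) v a(3), where \<Psi> = "\<lambda>t. \<bar>\<Phi> t\<bar> powr crit"])
    show "continuous_on UNIV (\<lambda>t::real. \<bar>\<Phi> t\<bar> powr crit)"
      using n by (intro continuous_on_powr' continuous_intros \<Phi>c) auto
    fix \<epsilon> :: real assume \<epsilon>: "\<epsilon> > 0"
    show "\<forall>\<^sub>F k in sequentially. (\<integral>x. \<bar>\<Phi> (w k x)\<bar> powr crit \<partial>M)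
        \<le> (sob_const * c * Lnorm r M g) powr (1 / (1 / r - 2 / real N)) + \<epsilon>"
      unfolding ex[symmetric] A_def[symmetric]
    proof (rule self_improving_bound[OF _ main e0])
      show "A k \<ge> 0" for k by (simp add: A_def)
      show "0 < 1 - 1 / r" using r by simp
      show "1 - 1 / r < (real N - 2) / real N" using r(2) ex by linarith
      show "0 \<le> sob_const * c * Lnorm r M g" using sob_const_pos c(1)
        by (intro mult_nonneg_nonneg Lnorm_nonneg) auto
    qed (rule \<epsilon>)
  qed (auto simp: powr_ge_zero)
qed

subsection \<open>Truncated powers\<close>

text \<open>Here \<open>\<Phi>(t)\<close> is \<open>\<bar>t\<bar>\<^sup>b\<close> up to sign, continued linearly beyond \<open>M\<close>. For \<open>t > 0\<close>, the derivative \<open>\<phi>\<close> is at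
  most \<open>b\<close> times \<open>\<Phi>\<close> to the power \<open>1 - 1/b\<close>, with equality before the truncation. Multiplied by \<open>\<phi>\<close>,
  this compares the derivatives of the two sides of the bound for \<open>H\<close>.\<close>

lemma truncated_power_facts:
  fixes b M :: real
  assumes b: "b > 1" and M: "M > 0"
  defines "\<phi> \<equiv> \<lambda>t. b * (min \<bar>t\<bar> M) powr (b - 1)"
  assumes \<Phi>: "\<And>s. (\<Phi> has_real_derivative \<phi> s) (at s)" "\<Phi> 0 = 0"
    and H: "\<And>s. (H has_real_derivative (\<phi> s)\<^sup>2) (at s)" "H 0 = 0"
  shows "\<bar>t\<bar> \<le> M \<Longrightarrow> \<bar>\<Phi> t\<bar> = \<bar>t\<bar> powr b"
    and "\<bar>H t\<bar> \<le> b / (2 - 1 / b) * \<bar>\<Phi> t\<bar> powr (2 - 1 / b)"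
proof -
  have \<phi>0: "\<phi> t \<ge> 0" for t using b by (simp add: \<phi>_def)
  have odd: "\<Phi> (- t) = - \<Phi> t" "H (- t) = - H t" for t
  proof -
    have "((\<lambda>t. \<Phi> t + \<Phi> (- t)) has_real_derivative 0) (at t)" for t
      by (rule DERIV_cong[OF DERIV_add[OF \<Phi>(1) DERIV_chain2[OF \<Phi>(1) DERIV_minus[OF DERIV_ident]]]])
        (simp add: \<phi>_def)
    then have "\<Phi> t + \<Phi> (- t) = \<Phi> 0 + \<Phi> (- 0)" using DERIV_isconst_all by blast
    then show "\<Phi> (- t) = - \<Phi> t" using \<Phi>(2) by simp
    have "((\<lambda>t. H t + H (- t)) has_real_derivative 0) (at t)" for t
      by (rule DERIV_cong[OF DERIV_add[OF H(1) DERIV_chain2[OF H(1) DERIV_minus[OF DERIV_ident]]]])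
        (simp add: \<phi>_def)
    then have "H t + H (- t) = H 0 + H (- 0)" using DERIV_isconst_all by blast
    then show "H (- t) = - H t" using H(2) by simp
  qed
  have mono: "s \<le> t \<Longrightarrow> \<Phi> s \<le> \<Phi> t" for s t
    using \<Phi>(1) \<phi>0 by (intro DERIV_nonneg_imp_nondecreasing[of s t \<Phi>]) auto
  have Hmono: "s \<le> t \<Longrightarrow> H s \<le> H t" for s t
    using H(1) by (intro DERIV_nonneg_imp_nondecreasing[of s t H]) (auto intro!: exI[of _ "(\<phi> _)\<^sup>2"])
  have \<Phi>c: "continuous_on X \<Phi>" for X
    using \<Phi>(1) DERIV_isCont continuous_at_imp_continuous_on by blast
  have pw: "\<Phi> t = t powr b" if t: "0 \<le> t" "t \<le> M" for t
  proof (cases "t = 0")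
    case False
    then have tp: "t > 0" using t by simp
    have "\<Phi> t - \<bar>t\<bar> powr b = \<Phi> 0 - \<bar>0\<bar> powr b"
    proof (rule DERIV_isconst_end[OF tp])
      show "continuous_on {0..t} (\<lambda>t. \<Phi> t - \<bar>t\<bar> powr b)"
        using b by (intro continuous_intros \<Phi>c continuous_on_powr') auto
      fix x assume x: "0 < x" "x < t"
      have "((\<lambda>t. \<Phi> t - \<bar>t\<bar> powr b) has_real_derivative \<phi> x - b * odd_powr x (b - 1)) (at x)"
        by (intro DERIV_diff \<Phi>(1) abs_powr_has_derivative b)
      then show "((\<lambda>t. \<Phi> t - \<bar>t\<bar> powr b) has_real_derivative 0) (at x)"
        using x t by (simp add: \<phi>_def odd_powr_def)
    qed
    then show ?thesis using \<Phi>(2) b t by simp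
  qed (use \<Phi>(2) b in simp)
  show "\<bar>\<Phi> t\<bar> = \<bar>t\<bar> powr b" if "\<bar>t\<bar> \<le> M"
  proof (cases "t \<ge> 0")
    case True
    then show ?thesis using pw[of t] that by simp
  next
    case False
    then have "\<Phi> t = - ((- t) powr b)" using pw[of "- t"] odd(1)[of t] that by simp
    then show ?thesis using False by simp
  qed
  define \<theta> where "\<theta> = 2 - 1 / b"
  have \<theta>: "\<theta> > 1" "b * (\<theta> - 1) = b - 1" using b by (auto simp: \<theta>_def field_simps)
  have \<phi>_le: "\<phi> t \<le> b * \<Phi> t powr (\<theta> - 1)" if t: "t > 0" for t
  proof -
    let ?m = "min t M"
    have "?m powr b \<le> \<Phi> t" using pw[of ?m] mono[of ?m t] t M by simp
    then have "(?m powr b) powr (\<theta> - 1) \<le> \<Phi> t powr (\<theta> - 1)" using \<theta> by (intro powr_mono2) auto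
    then show ?thesis using b t by (simp add: \<phi>_def powr_powr \<theta>(2))
  qed
  have key: "H t \<le> b / \<theta> * \<bar>\<Phi> t\<bar> powr \<theta>" if t: "t \<ge> 0" for t
  proof -
    have "b / \<theta> * \<bar>\<Phi> 0\<bar> powr \<theta> - H 0 \<le> b / \<theta> * \<bar>\<Phi> t\<bar> powr \<theta> - H t"
    proof (rule DERIV_nonneg_imp_nondecreasing[OF t])
      fix x assume x: "0 \<le> x" "x \<le> t"
      let ?D = "b / \<theta> * (\<theta> * odd_powr (\<Phi> x) (\<theta> - 1) * \<phi> x) - (\<phi> x)\<^sup>2"
      have "((\<lambda>t. b / \<theta> * \<bar>\<Phi> t\<bar> powr \<theta> - H t) has_real_derivative ?D) (at x)"
        by (intro DERIV_diff DERIV_cmult DERIV_chain2[OF abs_powr_has_derivative[OF \<theta>(1)] \<Phi>(1)] H(1))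
      moreover have "?D \<ge> 0"
      proof (cases "x = 0")
        case True
        then show ?thesis using M b by (simp add: \<phi>_def)
      next
        case False
        then have xp: "x > 0" using x by simp
        have "\<Phi> x \<ge> 0" using mono[of 0 x] \<Phi>(2) xp by simp
        then have "odd_powr (\<Phi> x) (\<theta> - 1) = \<Phi> x powr (\<theta> - 1)" by (cases "\<Phi> x = 0") (auto simp: odd_powr_def)
        then have "?D = \<phi> x * (b * \<Phi> x powr (\<theta> - 1) - \<phi> x)"
          using \<theta>(1) by (simp add: algebra_simps power2_eq_square)
        also have "\<dots> \<ge> 0" using \<phi>_le[OF xp] \<phi>0[of x] by simp
        finally show ?thesis .
      qed
      ultimately show "\<exists>y. ((\<lambda>t. b / \<theta> * \<bar>\<Phi> t\<bar> powr \<theta> - H t) has_real_derivative y) (at x) \<and> 0 \<le> y" by blast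
    qed
    then show ?thesis using \<Phi>(2) H(2) \<theta>(1) by simp
  qed
  have Hn: "H t \<ge> 0" if "t \<ge> 0" for t using Hmono[OF that] H(2) by simp
  have "\<bar>H t\<bar> \<le> b / \<theta> * \<bar>\<Phi> t\<bar> powr \<theta>"
  proof (cases "t \<ge> 0")
    case True
    then show ?thesis using key Hn by simp
  next
    case False
    then show ?thesis using key[of "- t"] Hn[of "- t"] odd[of t] by simp
  qed
  then show "\<bar>H t\<bar> \<le> b / (2 - 1 / b) * \<bar>\<Phi> t\<bar> powr (2 - 1 / b)" by (simp add: \<theta>_def)
qed

text \<open>The exponent \<open>b\<close> of the truncated powers is chosen so that \<open>b\<close> times the critical exponent is \<open>s\<close>; then
  the growth exponent of \<open>H\<close> is the one required by the nonlinear bound. That bound does not depend on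
  the truncation, which is removed by Fatou's lemma.\<close>

lemma elliptic_estimate:
  assumes r: "r \<ge> 2" "1 / r > 2 / real N" and s: "s = 1 / (1 / r - 2 / real N)"
  obtains K where "K \<ge> 0"
    "\<And>w v G g. H10_approx w v G \<Longrightarrow> v \<in> L2 \<Omega> \<Longrightarrow> minus_div G g \<Longrightarrow> integrable M (\<lambda>x. \<bar>g x\<bar> powr r) \<Longrightarrow>
       integrable M (\<lambda>x. \<bar>v x\<bar> powr s) \<and> Lnorm s M v \<le> K * Lnorm r M g"
proof
  have n: "real N \<ge> 3" using N3 by simp
  have s0: "s > 0" "1 / s = 1 / r - 2 / real N" using r s by auto
  define b where "b = s / crit"
  have crit0: "crit > 0" using n by simp
  have b1: "b > 1"
  proof -
    have "1 / r \<le> 1 / 2" using r(1) by (simp add: field_simps)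
    then have "1 / s \<le> 1 / 2 - 2 / real N" using s0(2) by linarith
    also have "\<dots> < 1 / 2 - 1 / real N" using n by (simp add: field_simps)
    also have "\<dots> = 1 / crit" using n by (simp add: field_simps)
    finally have "1 / s < 1 / crit" .
    moreover have "s / c > 1" if "1 / s < 1 / c" "s > 0" "c > 0" for s c :: real
      using that by (simp add: field_simps)
    ultimately show ?thesis unfolding b_def using s0(1) crit0 by blast
  qed
  have \<theta>: "crit * (1 - 1 / r) = 2 - 1 / b"
  proof -
    have "1 / b = crit * (1 / r - 2 / real N)" unfolding s0(2)[symmetric] by (simp add: b_def)
    moreover have "crit * (1 - 2 / real N) = 2" using n by (simp add: field_simps)
    moreover have "C * (1 - x) = 2 - y" if "y = C * (x - q)" "C * (1 - q) = 2" for C x y q :: real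
      using that by (simp add: algebra_simps)
    ultimately show ?thesis by blast
  qed
  define c where "c = b / (2 - 1 / b)"
  have "1 / b \<le> 1" using b1 by simp
  then have c0: "c \<ge> 0" unfolding c_def using b1 by (intro divide_nonneg_nonneg) linarith+
  define K where "K = sob_const * c"
  show "K \<ge> 0" using c0 sob_const_pos by (simp add: K_def)
  fix w v G g
  assume app: "H10_approx w v G" and v: "v \<in> L2 \<Omega>" and div: "minus_div G g"
    and g: "integrable M (\<lambda>x. \<bar>g x\<bar> powr r)"
  define B where "B = (K * Lnorm r M g) powr s"
  define \<phi> where "\<phi> j t = b * (min \<bar>t\<bar> (real (Suc j))) powr (b - 1)" for j t
  have \<phi>c: "continuous_on UNIV (\<phi> j)" for j
    unfolding \<phi>_def using b1 by (intro continuous_intros continuous_on_powr') auto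
  define \<Phi> where "\<Phi> j = primitive (\<lambda>_::unit. \<phi> j) ()" for j
  define H where "H j = primitive (\<lambda>_::unit. \<lambda>t. (\<phi> j t)\<^sup>2) ()" for j
  have \<Phi>: "(\<Phi> j has_real_derivative \<phi> j t) (at t)" "\<Phi> j 0 = 0" for j t
    unfolding \<Phi>_def by (rule primitive_has_derivative[OF \<phi>c]) simp
  have H: "(H j has_real_derivative (\<phi> j t)\<^sup>2) (at t)" "H j 0 = 0" for j t
    unfolding H_def by (rule primitive_has_derivative) (intro continuous_intros \<phi>c, simp)
  note facts = truncated_power_facts[OF b1 _ \<Phi>[unfolded \<phi>_def] H[unfolded \<phi>_def]]
  have bd: "(\<integral>\<^sup>+x. ennreal (\<bar>\<Phi> j (v x)\<bar> powr crit) \<partial>M) \<le> ennreal B" for j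
  proof -
    have "(\<integral>\<^sup>+x. ennreal (\<bar>\<Phi> j (v x)\<bar> powr crit) \<partial>M)
      \<le> ennreal ((sob_const * c * Lnorm r M g) powr (1 / (1 / r - 2 / real N)))"
    proof (rule nonlinear_bound[OF app v div \<phi>c _ _ \<Phi> H _ r(2) g c0])
      show "\<bar>\<phi> j t\<bar> \<le> b * real (Suc j) powr (b - 1)" for t
      proof -
        have "min \<bar>t\<bar> (real (Suc j)) powr (b - 1) \<le> real (Suc j) powr (b - 1)"
          using b1 by (intro powr_mono2) auto
        then have "b * min \<bar>t\<bar> (real (Suc j)) powr (b - 1) \<le> b * real (Suc j) powr (b - 1)"
          using b1 by (intro mult_left_mono) auto
        then show ?thesis using b1 by (simp add: \<phi>_def abs_mult)
      qed
      show "\<phi> j 0 = 0" by (simp add: \<phi>_def)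
      show "r > 1" using r by simp
      show "\<bar>H j t\<bar> \<le> c * \<bar>\<Phi> j t\<bar> powr (crit * (1 - 1 / r))" for t
        unfolding \<theta> c_def by (rule facts(2)) simp
    qed
    then show ?thesis by (simp only: B_def K_def s)
  qed
  have "(\<integral>\<^sup>+x. ennreal (\<bar>v x\<bar> powr s) \<partial>M) = (\<integral>\<^sup>+x. liminf (\<lambda>j. ennreal (\<bar>\<Phi> j (v x)\<bar> powr crit)) \<partial>M)"
  proof (rule nn_integral_cong)
    fix x
    have "\<forall>\<^sub>F j in sequentially. \<bar>v x\<bar> \<le> real (Suc j)"
      using eventually_ge_at_top[of "nat \<lceil>\<bar>v x\<bar>\<rceil>"] by eventually_elim linarith
    then have "\<forall>\<^sub>F j in sequentially. ennreal (\<bar>\<Phi> j (v x)\<bar> powr crit) = ennreal (\<bar>v x\<bar> powr s)"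
    proof eventually_elim
      case (elim j)
      have "\<bar>\<Phi> j (v x)\<bar> powr crit = (\<bar>v x\<bar> powr b) powr crit"
        using facts(1)[of j "v x"] elim by simp
      also have "\<dots> = \<bar>v x\<bar> powr (b * crit)" by (rule powr_powr)
      also have "b * crit = s"
      proof -
        have "s / c * c = s" if "c > 0" for c :: real using that by simp
        then show ?thesis unfolding b_def using crit0 by blast
      qed
      finally show ?case by simp
    qed
    then have "(\<lambda>j. ennreal (\<bar>\<Phi> j (v x)\<bar> powr crit)) \<longlonglongrightarrow> ennreal (\<bar>v x\<bar> powr s)"
      by (rule tendsto_eventually)
    then show "ennreal (\<bar>v x\<bar> powr s) = liminf (\<lambda>j. ennreal (\<bar>\<Phi> j (v x)\<bar> powr crit))"
      using lim_imp_Liminf[OF sequentially_bot] by metis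
  qed
  also have "\<dots> \<le> liminf (\<lambda>j. \<integral>\<^sup>+x. ennreal (\<bar>\<Phi> j (v x)\<bar> powr crit) \<partial>M)"
  proof (rule nn_integral_liminf)
    fix j
    have "continuous_on UNIV (\<Phi> j)"
      using \<Phi>(1) DERIV_isCont continuous_at_imp_continuous_on by blast
    then have [measurable]: "\<Phi> j \<in> borel_measurable borel" by (rule borel_measurable_continuous_onI)
    have [measurable]: "v \<in> borel_measurable M" by (rule L2_measurable[OF v])
    show "(\<lambda>x. ennreal (\<bar>\<Phi> j (v x)\<bar> powr crit)) \<in> borel_measurable M" by measurable
  qed
  also have "\<dots> \<le> limsup (\<lambda>j. \<integral>\<^sup>+x. ennreal (\<bar>\<Phi> j (v x)\<bar> powr crit) \<partial>M)"
    by (rule Liminf_le_Limsup[OF sequentially_bot])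
  also have "\<dots> \<le> ennreal B" by (rule Limsup_bounded) (simp add: bd)
  finally have "(\<integral>\<^sup>+x. ennreal (\<bar>v x\<bar> powr s) \<partial>M) \<le> ennreal ((K * Lnorm r M g) powr s)" by (simp add: B_def)
  from Lnorm_bound[OF L2_measurable[OF v] this] s0(1) mult_nonneg_nonneg[OF \<open>K \<ge> 0\<close> Lnorm_nonneg[of r M g]]
  show "integrable M (\<lambda>x. \<bar>v x\<bar> powr s) \<and> Lnorm s M v \<le> K * Lnorm r M g" by simp
qed

end

subsection \<open>The embedding of the energy space\<close>

context bounded_open
begin

lemma minus_div_laplacian:
  assumes u: "u \<in> sobolev 2 \<Omega>"
  shows "minus_div (\<lambda>i. weak_deriv \<Omega> [i] u) (\<lambda>x. - laplacian \<Omega> u x)"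
  unfolding minus_div_def
proof (intro conjI allI ballI)
  have d1: "has_weak_deriv \<Omega> [i] u (weak_deriv \<Omega> [i] u)"
    and d2: "has_weak_deriv \<Omega> [i, i] u (weak_deriv \<Omega> [i, i] u)" for i
    by (rule sobolev_weak[OF u], simp)+
  show "weak_deriv \<Omega> [i] u \<in> L2 \<Omega>" for i by (rule has_weak_derivD(2)[OF d1])
  show "(\<lambda>x. - laplacian \<Omega> u x) \<in> L2 \<Omega>"
    using L2_cmult[OF L2_sum[of UNIV "\<lambda>i. weak_deriv \<Omega> [i, i] u"], of "-1"] has_weak_derivD(2)[OF d2]
    by (simp add: laplacian_def)
  fix \<phi> assume \<phi>: "\<phi> \<in> test_functions \<Omega>"
  have "(\<integral>x. weak_deriv \<Omega> [i] u x * pd i \<phi> x \<partial>M) = - (\<integral>x. weak_deriv \<Omega> [i, i] u x * \<phi> x \<partial>M)" for i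
    using has_weak_derivD(3)[OF d1 test_pd[OF \<phi>, of i], of i] has_weak_derivD(3)[OF d2 \<phi>, of i] by simp
  then have "(\<Sum>i\<in>UNIV. \<integral>x. weak_deriv \<Omega> [i] u x * pd i \<phi> x \<partial>M)
      = - (\<Sum>i\<in>UNIV. \<integral>x. weak_deriv \<Omega> [i, i] u x * \<phi> x \<partial>M)"
    by (simp add: sum_negf)
  also have "(\<Sum>i\<in>UNIV. \<integral>x. weak_deriv \<Omega> [i, i] u x * \<phi> x \<partial>M) = (\<integral>x. (\<Sum>i\<in>UNIV. weak_deriv \<Omega> [i, i] u x * \<phi> x) \<partial>M)"
    by (intro Bochner_Integration.integral_sum[symmetric] L2_mult_integrable has_weak_derivD(2)[OF d2] test_L2[OF \<phi>])
  finally show "(\<Sum>i\<in>UNIV. \<integral>x. weak_deriv \<Omega> [i] u x * pd i \<phi> x \<partial>M) = (\<integral>x. - laplacian \<Omega> u x * \<phi> x \<partial>M)"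
    by (simp add: laplacian_def sum_distrib_right)
qed

text \<open>The top-order derivatives entering the scalar product. For even order there is only one, listed
  under an arbitrary index.\<close>

definition top_index :: "nat \<Rightarrow> 'n set" where
  "top_index m = (if even m then {undefined} else UNIV)"

definition top_deriv :: "nat \<Rightarrow> 'n \<Rightarrow> (real^'n \<Rightarrow> real) \<Rightarrow> real^'n \<Rightarrow> real" where
  "top_deriv m i u = (if even m then (laplacian \<Omega> ^^ (m div 2)) u else weak_deriv \<Omega> [i] ((laplacian \<Omega> ^^ (m div 2)) u))"

lemma top_index [simp]: "finite (top_index m)" "top_index m \<noteq> {}"
  by (auto simp: top_index_def)

lemma top_deriv_L2:
  assumes "u \<in> sobolev m \<Omega>" shows "top_deriv m i u \<in> L2 \<Omega>"
proof (cases "even m")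
  case True
  then show ?thesis
    using sobolev_L2[OF laplacian_pow_sobolev[OF assms, of "m div 2" 0]] by (simp add: top_deriv_def)
next
  case False
  then have "2 * (m div 2) + 1 \<le> m" by presburger
  from sobolev_weak[OF laplacian_pow_sobolev[OF assms this], of "[i]"] False show ?thesis
    using has_weak_derivD(2) by (auto simp: top_deriv_def)
qed

lemma top_deriv_linear:
  assumes u: "u \<in> sobolev m \<Omega>" and v: "v \<in> sobolev m \<Omega>"
  shows "AE x in M. top_deriv m i (\<lambda>x. u x + c * v x) x = top_deriv m i u x + c * top_deriv m i v x"
proof -
  let ?L = "laplacian \<Omega> ^^ (m div 2)"
  have lin: "AE x in M. ?L (\<lambda>x. u x + c * v x) x = ?L u x + c * ?L v x"
    by (rule laplacian_pow_AE_linear[OF u v]) simp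
  show ?thesis
  proof (cases "even m")
    case True
    then show ?thesis using lin by (simp add: top_deriv_def)
  next
    case False
    then have m: "2 * (m div 2) + 1 \<le> m" by presburger
    have w: "\<And>z. z \<in> sobolev m \<Omega> \<Longrightarrow> has_weak_deriv \<Omega> [i] (?L z) (weak_deriv \<Omega> [i] (?L z))"
      using sobolev_weak[OF laplacian_pow_sobolev[OF _ m], of _ "[i]"] by simp
    have "AE x in M. weak_deriv \<Omega> [i] (?L (\<lambda>x. u x + c * v x)) x = weak_deriv \<Omega> [i] (?L u) x + c * weak_deriv \<Omega> [i] (?L v) x"
      by (rule weak_deriv_AE_eq[OF has_weak_deriv_add[OF w[OF u] has_weak_deriv_cmult[OF w[OF v]]]
            w[OF sobolev_add[OF u sobolev_cmult[OF v]]] lin])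
    then show ?thesis using False by (simp add: top_deriv_def)
  qed
qed

lemma inner_m_eq:
  assumes "u \<in> sobolev m \<Omega>" "v \<in> sobolev m \<Omega>"
  shows "inner_m m \<Omega> u v = (\<Sum>i\<in>top_index m. \<integral>x. top_deriv m i u x * top_deriv m i v x \<partial>M)"
proof (cases "even m")
  case False
  then have "inner_m m \<Omega> u v = (\<integral>x. (\<Sum>i\<in>UNIV. top_deriv m i u x * top_deriv m i v x) \<partial>M)"
    by (simp add: inner_m_def top_deriv_def Let_def)
  also have "\<dots> = (\<Sum>i\<in>UNIV. \<integral>x. top_deriv m i u x * top_deriv m i v x \<partial>M)"
    by (intro Bochner_Integration.integral_sum L2_mult_integrable top_deriv_L2 assms)
  finally show ?thesis using False by (simp add: top_index_def)
qed (simp add: inner_m_def top_deriv_def top_index_def Let_def)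

lemma inner_m_self: "u \<in> sobolev m \<Omega> \<Longrightarrow> inner_m m \<Omega> u u = (norm_m m \<Omega> u)\<^sup>2"
  and norm_m_nonneg: "u \<in> sobolev m \<Omega> \<Longrightarrow> norm_m m \<Omega> u \<ge> 0"
proof -
  assume u: "u \<in> sobolev m \<Omega>"
  have "inner_m m \<Omega> u u \<ge> 0"
    unfolding inner_m_eq[OF u u] by (intro sum_nonneg Bochner_Integration.integral_nonneg) simp
  then show "inner_m m \<Omega> u u = (norm_m m \<Omega> u)\<^sup>2" "norm_m m \<Omega> u \<ge> 0" by (simp_all add: norm_m_def)
qed

lemma inner_m_sym: "inner_m m \<Omega> u v = inner_m m \<Omega> v u"
  by (simp add: inner_m_def Let_def mult.commute)

lemma inner_m_linear:
  assumes u: "u \<in> sobolev m \<Omega>" and v: "v \<in> sobolev m \<Omega>" and w: "w \<in> sobolev m \<Omega>"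
  shows "inner_m m \<Omega> u (\<lambda>x. v x + c * w x) = inner_m m \<Omega> u v + c * inner_m m \<Omega> u w"
proof -
  have vw: "(\<lambda>x. v x + c * w x) \<in> sobolev m \<Omega>" by (rule sobolev_add[OF v sobolev_cmult[OF w]])
  have "(\<integral>x. top_deriv m i u x * top_deriv m i (\<lambda>x. v x + c * w x) x \<partial>M)
    = (\<integral>x. top_deriv m i u x * top_deriv m i v x \<partial>M) + c * (\<integral>x. top_deriv m i u x * top_deriv m i w x \<partial>M)" for i
  proof -
    note meas = L2_measurable[OF top_deriv_L2[OF u]] L2_measurable[OF top_deriv_L2[OF v]]
      L2_measurable[OF top_deriv_L2[OF w]] L2_measurable[OF top_deriv_L2[OF vw]]
    note int = L2_mult_integrable[OF top_deriv_L2[OF u] top_deriv_L2[OF v], of i i]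
      L2_mult_integrable[OF top_deriv_L2[OF u] top_deriv_L2[OF w], of i i]
    have "(\<integral>x. top_deriv m i u x * top_deriv m i (\<lambda>x. v x + c * w x) x \<partial>M)
      = (\<integral>x. top_deriv m i u x * top_deriv m i v x + c * (top_deriv m i u x * top_deriv m i w x) \<partial>M)"
    proof (rule integral_cong_AE)
      show "AE x in M. top_deriv m i u x * top_deriv m i (\<lambda>x. v x + c * w x) x
        = top_deriv m i u x * top_deriv m i v x + c * (top_deriv m i u x * top_deriv m i w x)"
        using top_deriv_linear[OF v w, of i c] by eventually_elim (simp add: algebra_simps)
    qed (intro borel_measurable_times borel_measurable_add borel_measurable_const meas)+
    then show ?thesis using int by simp
  qed
  then show ?thesis
    unfolding inner_m_eq[OF u vw] inner_m_eq[OF u v] inner_m_eq[OF u w]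
    by (simp add: sum.distrib sum_distrib_left)
qed

text \<open>The Cauchy-Schwarz inequality is used for each component separately, which costs the number of components as
  a factor; for a bounded functional this is immaterial.\<close>

lemma inner_m_bounded:
  assumes u: "u \<in> sobolev m \<Omega>" and v: "v \<in> sobolev m \<Omega>"
  shows "\<bar>inner_m m \<Omega> u v\<bar> \<le> real (card (top_index m)) * (norm_m m \<Omega> u * norm_m m \<Omega> v)"
proof -
  have le: "sqrt (\<integral>x. (top_deriv m i z x)\<^sup>2 \<partial>M) \<le> norm_m m \<Omega> z" if i: "i \<in> top_index m" and z: "z \<in> sobolev m \<Omega>" for i z
    unfolding norm_m_def inner_m_eq[OF z z] power2_eq_square
    by (intro real_sqrt_le_mono member_le_sum[OF i, of "\<lambda>i. \<integral>x. top_deriv m i z x * top_deriv m i z x \<partial>M"]) auto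
  have "\<bar>inner_m m \<Omega> u v\<bar> \<le> (\<Sum>i\<in>top_index m. norm_m m \<Omega> u * norm_m m \<Omega> v)"
    unfolding inner_m_eq[OF u v]
  proof (intro order_trans[OF sum_abs] sum_mono)
    fix i assume i: "i \<in> top_index m"
    have "\<bar>\<integral>x. top_deriv m i u x * top_deriv m i v x \<partial>M\<bar> \<le> (\<integral>x. \<bar>top_deriv m i u x * top_deriv m i v x\<bar> \<partial>M)"
      by (rule integral_abs_bound)
    also have "\<dots> \<le> sqrt (\<integral>x. (top_deriv m i u x)\<^sup>2 \<partial>M) * sqrt (\<integral>x. (top_deriv m i v x)\<^sup>2 \<partial>M)"
      by (intro cauchy_schwarz L2_measurable L2_square_integrable top_deriv_L2 u v)
    also have "\<dots> \<le> norm_m m \<Omega> u * norm_m m \<Omega> v"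
      by (intro mult_mono le i u v norm_m_nonneg) simp
    finally show "\<bar>\<integral>x. top_deriv m i u x * top_deriv m i v x \<partial>M\<bar> \<le> norm_m m \<Omega> u * norm_m m \<Omega> v" .
  qed
  then show ?thesis by simp
qed

lemma norm_m_cmult:
  assumes u: "u \<in> sobolev m \<Omega>"
  shows "norm_m m \<Omega> (\<lambda>x. c * u x) = \<bar>c\<bar> * norm_m m \<Omega> u"
proof -
  have lin: "inner_m m \<Omega> w (\<lambda>x. c * u x) = c * inner_m m \<Omega> w u" if w: "w \<in> sobolev m \<Omega>" for w
    using inner_m_linear[OF w u u, of "c - 1"] by (simp add: algebra_simps)
  have "inner_m m \<Omega> (\<lambda>x. c * u x) (\<lambda>x. c * u x) = c\<^sup>2 * inner_m m \<Omega> u u"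
    using lin[OF sobolev_cmult[OF u]] lin[OF u] inner_m_sym[of m "\<lambda>x. c * u x" u]
    by (simp add: power2_eq_square)
  then show ?thesis by (simp add: norm_m_def real_sqrt_mult)
qed

lemma norm_m_add_square:
  assumes u: "u \<in> sobolev m \<Omega>" and h: "h \<in> sobolev m \<Omega>"
  shows "(norm_m m \<Omega> (\<lambda>x. u x + h x))\<^sup>2 = (norm_m m \<Omega> u)\<^sup>2 + 2 * inner_m m \<Omega> u h + (norm_m m \<Omega> h)\<^sup>2"
proof -
  have uh: "(\<lambda>x. u x + h x) \<in> sobolev m \<Omega>" by (rule sobolev_add[OF u h])
  have lin: "inner_m m \<Omega> w (\<lambda>x. u x + h x) = inner_m m \<Omega> w u + inner_m m \<Omega> w h" if w: "w \<in> sobolev m \<Omega>" for w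
    using inner_m_linear[OF w u h, of 1] by simp
  show ?thesis
    unfolding inner_m_self[OF u, symmetric] inner_m_self[OF h, symmetric] inner_m_self[OF uh, symmetric]
    using lin[OF uh] lin[OF u] lin[OF h] inner_m_sym[of m u "\<lambda>x. u x + h x"] inner_m_sym[of m h "\<lambda>x. u x + h x"]
      inner_m_sym[of m h u] inner_m_sym[of m "\<lambda>x. u x + h x" u] inner_m_sym[of m "\<lambda>x. u x + h x" h] by linarith
qed

end

lemma Lnorm_minus: "Lnorm p N (\<lambda>x. - f x) = Lnorm p N f"
  by (simp add: Lnorm_def)

context bounded_open_dim
begin

lemma H_navier_zero_on_boundary:
  "v \<in> H_navier m \<Omega> \<Longrightarrow> 2 * j < m \<Longrightarrow> zero_on_boundary \<Omega> ((laplacian \<Omega> ^^ j) v)"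
  unfolding H_navier_def by simp

text \<open>Induction on the number \<open>i\<close> of Laplacians removed, starting from \<open>\<Delta>\<^sup>l v\<close> with \<open>l = m div 2\<close>. That function is
  in \<open>L\<^sup>2\<close> if \<open>m\<close> is even, and in the critical space of Sobolev's inequality if \<open>m\<close> is odd, with norm
  controlled by the energy norm in both cases. The reciprocal exponent \<open>\<rho> i\<close> decreases by \<open>2/N\<close> in each step
  and is still positive at the end because \<open>N > 2m\<close>.\<close>

theorem sobolev_embedding:
  assumes Nm: "N \<ge> 2 * m + 1"
  obtains K where "K \<ge> 0" "\<And>v. v \<in> H_navier m \<Omega> \<Longrightarrow>
    integrable M (\<lambda>x. \<bar>v x\<bar> powr (2 * real N / (real N - 2 * real m))) \<and>
    Lnorm (2 * real N / (real N - 2 * real m)) M v \<le> K * norm_m m \<Omega> v"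
proof -
  define l where "l = m div 2"
  \<comment> \<open>the reciprocal of the exponent reached after \<open>i\<close> steps\<close>
  define \<rho> where "\<rho> i = (if even m then 1 / 2 else 1 / 2 - 1 / real N) - 2 * real i / real N" for i
  have n: "real N \<ge> 3" using N3 by simp
  have nm: "real N - 2 * real m > 0" using Nm by linarith
  have ml: "m = (if even m then 2 * l else 2 * l + 1)" by (auto simp: l_def)
  have \<rho>l: "\<rho> l = (real N - 2 * real m) / (2 * real N)"
    using n ml by (cases "even m") (auto simp: \<rho>_def field_simps)
  have \<rho>_pos: "\<rho> i > 0" if "i \<le> l" for i
  proof -
    have "\<rho> l > 0" unfolding \<rho>l using n nm by simp
    also have "\<rho> l \<le> \<rho> i" using that n by (simp add: \<rho>_def divide_right_mono)
    finally show ?thesis .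
  qed
  have \<rho>_half: "\<rho> i \<le> 1 / 2" for i
  proof -
    have "2 * real i / real N \<ge> 0" "1 / real N \<ge> 0" by simp_all
    then show ?thesis unfolding \<rho>_def by (cases "even m"; simp only: if_True if_False simp_thms; linarith)
  qed
  have sob: "(laplacian \<Omega> ^^ (l - i)) v \<in> L2 \<Omega>" if "v \<in> H_navier m \<Omega>" for v i
    using that ml laplacian_pow_sobolev[of v m "l - i" 0] sobolev_L2[of _ 0] by (auto simp: H_navier_def split: if_splits)
  have "\<exists>K\<ge>0. \<forall>v\<in>H_navier m \<Omega>. integrable M (\<lambda>x. \<bar>(laplacian \<Omega> ^^ (l - i)) v x\<bar> powr (1 / \<rho> i)) \<and>
    Lnorm (1 / \<rho> i) M ((laplacian \<Omega> ^^ (l - i)) v) \<le> K * norm_m m \<Omega> v" if "i \<le> l" for i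
    using that
  proof (induction i)
    case 0
    show ?case
    proof (cases "even m")
      case True
      have "integrable M (\<lambda>x. \<bar>(laplacian \<Omega> ^^ l) v x\<bar> powr 2) \<and>
        Lnorm 2 M ((laplacian \<Omega> ^^ l) v) \<le> 1 * norm_m m \<Omega> v" if v: "v \<in> H_navier m \<Omega>" for v
        using L2_square_integrable[OF sob[OF v, of 0]] True
        by (simp add: Lnorm_def norm_m_def inner_m_def powr_half_sqrt l_def power2_eq_square)
      then show ?thesis using True by (intro exI[of _ 1]) (simp add: \<rho>_def)
    next
      case False
      have cr: "1 / \<rho> 0 = crit" using False n by (simp add: \<rho>_def field_simps)
      have "integrable M (\<lambda>x. \<bar>(laplacian \<Omega> ^^ l) v x\<bar> powr crit) \<and>
        Lnorm crit M ((laplacian \<Omega> ^^ l) v) \<le> sqrt (2 * sob_const) * norm_m m \<Omega> v" if v: "v \<in> H_navier m \<Omega>" for v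
      proof -
        let ?u = "(laplacian \<Omega> ^^ l) v"
        have vs: "v \<in> sobolev m \<Omega>" using v by (simp add: H_navier_def)
        have z: "zero_on_boundary \<Omega> ?u" using H_navier_zero_on_boundary[OF v] False ml by simp
        note d = zero_on_boundary_weak[OF z]
        obtain w where w: "H10_approx w ?u (\<lambda>i. weak_deriv \<Omega> [i] ?u)"
          using z zero_on_boundary_iff[of ?u "\<lambda>i. weak_deriv \<Omega> [i] ?u", OF d] by blast
        have nrm: "norm_m m \<Omega> v = sqrt (\<Sum>i\<in>UNIV. \<integral>x. (weak_deriv \<Omega> [i] ?u x)\<^sup>2 \<partial>M)"
          unfolding norm_m_def inner_m_eq[OF vs vs] using False
          by (simp add: top_index_def top_deriv_def l_def power2_eq_square)
        show ?thesis
          using sobolev_H10[OF w has_weak_derivD(1)[OF d] has_weak_derivD(2)[OF d]]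
          by (simp add: nrm real_sqrt_mult)
      qed
      then show ?thesis unfolding cr using sob_const_pos
        by (intro exI[of _ "sqrt (2 * sob_const)"]) auto
    qed
  next
    case (Suc i)
    then obtain K where K: "K \<ge> 0" "\<And>v. v \<in> H_navier m \<Omega> \<Longrightarrow>
        integrable M (\<lambda>x. \<bar>(laplacian \<Omega> ^^ (l - i)) v x\<bar> powr (1 / \<rho> i)) \<and>
        Lnorm (1 / \<rho> i) M ((laplacian \<Omega> ^^ (l - i)) v) \<le> K * norm_m m \<Omega> v" by auto
    have r: "1 / \<rho> i \<ge> 2" "1 / (1 / \<rho> i) > 2 / real N" "1 / \<rho> (Suc i) = 1 / (1 / (1 / \<rho> i) - 2 / real N)"
    proof -
      have S: "\<rho> (Suc i) = \<rho> i - 2 / real N" by (simp add: \<rho>_def add_divide_distrib)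
      show "1 / \<rho> i \<ge> 2" using \<rho>_half[of i] \<rho>_pos[of i] Suc.prems by (simp add: field_simps)
      show "1 / (1 / \<rho> i) > 2 / real N" "1 / \<rho> (Suc i) = 1 / (1 / (1 / \<rho> i) - 2 / real N)"
        using \<rho>_pos[OF Suc.prems] S by simp_all
    qed
    obtain K' where K': "K' \<ge> 0"
      "\<And>w v G g. H10_approx w v G \<Longrightarrow> v \<in> L2 \<Omega> \<Longrightarrow> minus_div G g \<Longrightarrow> integrable M (\<lambda>x. \<bar>g x\<bar> powr (1 / \<rho> i)) \<Longrightarrow>
       integrable M (\<lambda>x. \<bar>v x\<bar> powr (1 / \<rho> (Suc i))) \<and> Lnorm (1 / \<rho> (Suc i)) M v \<le> K' * Lnorm (1 / \<rho> i) M g"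
      using elliptic_estimate[OF r] by metis
    show ?case
    proof (intro exI[of _ "K' * K"] conjI ballI)
      show "0 \<le> K' * K" using K(1) K'(1) by simp
      fix v assume v: "v \<in> H_navier m \<Omega>"
      let ?u = "(laplacian \<Omega> ^^ (l - Suc i)) v"
      have lap: "laplacian \<Omega> ?u = (laplacian \<Omega> ^^ (l - i)) v"
      proof -
        have "l - i = Suc (l - Suc i)" using Suc.prems by simp
        then show ?thesis by simp
      qed
      have vs: "v \<in> sobolev m \<Omega>" using v by (simp add: H_navier_def)
      have le: "2 * (l - Suc i) + 2 \<le> m" using ml Suc.prems by (auto split: if_splits)
      have us: "?u \<in> sobolev 2 \<Omega>" by (rule laplacian_pow_sobolev[OF vs le])
      have z: "zero_on_boundary \<Omega> ?u" by (rule H_navier_zero_on_boundary[OF v]) (use le in simp)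
      note d = zero_on_boundary_weak[OF z]
      obtain w where w: "H10_approx w ?u (\<lambda>i. weak_deriv \<Omega> [i] ?u)"
        using z zero_on_boundary_iff[of ?u "\<lambda>i. weak_deriv \<Omega> [i] ?u", OF d] by blast
      note div = minus_div_laplacian[OF us, unfolded lap]
      have g: "integrable M (\<lambda>x. \<bar>- (laplacian \<Omega> ^^ (l - i)) v x\<bar> powr (1 / \<rho> i))" using K(2)[OF v] by simp
      note est = K'(2)[OF w has_weak_derivD(1)[OF d] div g]
      show "integrable M (\<lambda>x. \<bar>?u x\<bar> powr (1 / \<rho> (Suc i)))" using est by blast
      have "Lnorm (1 / \<rho> (Suc i)) M ?u \<le> K' * Lnorm (1 / \<rho> i) M ((laplacian \<Omega> ^^ (l - i)) v)"
        using est by (simp add: Lnorm_minus)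
      also have "\<dots> \<le> K' * (K * norm_m m \<Omega> v)"
        using K(2)[OF v] K'(1) by (intro mult_left_mono) auto
      finally show "Lnorm (1 / \<rho> (Suc i)) M ?u \<le> K' * K * norm_m m \<Omega> v" by (simp add: mult.assoc)
    qed
  qed
  from this[OF order_refl] obtain K where K: "K \<ge> 0" "\<And>v. v \<in> H_navier m \<Omega> \<Longrightarrow>
    integrable M (\<lambda>x. \<bar>v x\<bar> powr (1 / \<rho> l)) \<and> Lnorm (1 / \<rho> l) M v \<le> K * norm_m m \<Omega> v" by auto
  have "1 / \<rho> l = 2 * real N / (real N - 2 * real m)" unfolding \<rho>l by simp
  with K show ?thesis using that by metis
qed

end

section \<open>Differentiability of the nonlinear term\<close>

lemma powr_add_le:
  fixes a b r :: real
  assumes "a \<ge> 0" "b \<ge> 0" "r > 0"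
  shows "(a + b) powr r \<le> 2 powr r * (a powr r + b powr r)"
proof -
  have "(a + b) powr r \<le> (2 * max a b) powr r" using assms by (intro powr_mono2) auto
  also have "\<dots> = 2 powr r * max a b powr r" using assms by (simp add: powr_mult)
  also have "max a b powr r \<le> a powr r + b powr r" by (auto simp: max_def)
  finally show ?thesis by (simp add: mult_left_mono)
qed

locale growth_nonlinearity = bounded_open \<Omega> for \<Omega> :: "(real^'n::finite) set" +
  fixes f :: "real^'n \<Rightarrow> real \<Rightarrow> real" and p C\<^sub>0 C\<^sub>1 :: real
  assumes f_cont: "continuous_on (closure \<Omega> \<times> UNIV) (\<lambda>(x, s). f x s)"
    and p1: "p > 1" and C_nonneg: "C\<^sub>0 \<ge> 0" "C\<^sub>1 \<ge> 0"
    and f_growth: "x \<in> \<Omega> \<Longrightarrow> \<bar>f x s\<bar> \<le> C\<^sub>1 + C\<^sub>0 * \<bar>s\<bar> powr (p - 1)"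
begin

abbreviation "q \<equiv> p / (p - 1)"

lemma q1: "q > 1" and pq: "1 / p + 1 / q = 1" "1 / q + 1 / p = 1" "(p - 1) * q = p"
  using p1 by (auto simp: field_simps)

abbreviation "F \<equiv> primitive f"

lemma f_cont_snd: "x \<in> closure \<Omega> \<Longrightarrow> continuous_on S (f x)"
  using continuous_on_compose2[OF f_cont continuous_on_Pair[OF continuous_on_const continuous_on_id], of x S] by auto

lemma F_deriv: "x \<in> \<Omega> \<Longrightarrow> (F x has_real_derivative f x s) (at s)"
  using closure_subset by (intro primitive_has_derivative f_cont_snd) blast

text \<open>The increment \<open>h\<close> may have either sign, so the intermediate point is described by its distance from \<open>s\<close>.\<close>

lemma F_mvt:
  assumes "x \<in> \<Omega>"
  obtains \<xi> where "\<bar>\<xi>\<bar> \<le> \<bar>h\<bar>" "F x (s + h) - F x s = h * f x (s + \<xi>)"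
proof -
  consider "h > 0" | "h < 0" | "h = 0" by linarith
  then show ?thesis
  proof cases
    case 1
    then obtain z where "s < z" "z < s + h" "F x (s + h) - F x s = (s + h - s) * f x z"
      using MVT2[of s "s + h" "F x" "f x"] F_deriv[OF assms] by auto
    then show ?thesis by (intro that[of "z - s"]) auto
  next
    case 2
    then obtain z where "s + h < z" "z < s" "F x s - F x (s + h) = (s - (s + h)) * f x z"
      using MVT2[of "s + h" s "F x" "f x"] F_deriv[OF assms] by auto
    then show ?thesis by (intro that[of "z - s"]) auto
  qed (use that[of 0] in auto)
qed

lemma F_bound: "x \<in> \<Omega> \<Longrightarrow> \<bar>F x s\<bar> \<le> C\<^sub>1 * \<bar>s\<bar> + C\<^sub>0 * \<bar>s\<bar> powr p"
proof -
  assume x: "x \<in> \<Omega>"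
  obtain \<xi> where \<xi>: "\<bar>\<xi>\<bar> \<le> \<bar>s\<bar>" "F x (0 + s) - F x 0 = s * f x (0 + \<xi>)" using F_mvt[OF x] by metis
  have "\<bar>f x \<xi>\<bar> \<le> C\<^sub>1 + C\<^sub>0 * \<bar>s\<bar> powr (p - 1)"
    using f_growth[OF x, of \<xi>] mult_left_mono[OF powr_mono2[of "p - 1" "\<bar>\<xi>\<bar>" "\<bar>s\<bar>"] C_nonneg(1)] \<xi>(1) p1 by simp
  then have "\<bar>s\<bar> * \<bar>f x \<xi>\<bar> \<le> \<bar>s\<bar> * (C\<^sub>1 + C\<^sub>0 * \<bar>s\<bar> powr (p - 1))" by (intro mult_left_mono) auto
  also have "\<dots> = C\<^sub>1 * \<bar>s\<bar> + C\<^sub>0 * \<bar>s\<bar> powr p"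
    by (cases "s = 0") (auto simp: algebra_simps powr_diff)
  finally show ?thesis using \<xi>(2) by (simp add: abs_mult)
qed

definition "A\<^sub>0 = 2 powr q * (C\<^sub>1 powr q + C\<^sub>0 powr q)"

lemma A0_nonneg: "A\<^sub>0 \<ge> 0" by (simp add: A\<^sub>0_def)

lemma f_powr_bound: "x \<in> \<Omega> \<Longrightarrow> \<bar>f x s\<bar> powr q \<le> A\<^sub>0 * (1 + \<bar>s\<bar> powr p)"
proof -
  assume x: "x \<in> \<Omega>"
  have q0: "q > 0" using q1 by simp
  have "\<bar>f x s\<bar> powr q \<le> (C\<^sub>1 + C\<^sub>0 * \<bar>s\<bar> powr (p - 1)) powr q"
    using f_growth[OF x] q0 by (intro powr_mono2) auto
  also have "\<dots> \<le> 2 powr q * (C\<^sub>1 powr q + (C\<^sub>0 * \<bar>s\<bar> powr (p - 1)) powr q)"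
    using C_nonneg q0 by (intro powr_add_le) auto
  also have "(C\<^sub>0 * \<bar>s\<bar> powr (p - 1)) powr q = C\<^sub>0 powr q * \<bar>s\<bar> powr ((p - 1) * q)"
    using C_nonneg by (simp add: powr_mult powr_powr)
  also have "2 powr q * (C\<^sub>1 powr q + C\<^sub>0 powr q * \<bar>s\<bar> powr ((p - 1) * q)) \<le> A\<^sub>0 * (1 + \<bar>s\<bar> powr p)"
  proof -
    have "a + b * t \<le> (a + b) * (1 + t)" if "a \<ge> 0" "b \<ge> 0" "t \<ge> 0" for a b t :: real
      using that by (simp add: algebra_simps)
    then have "C\<^sub>1 powr q + C\<^sub>0 powr q * \<bar>s\<bar> powr p \<le> (C\<^sub>1 powr q + C\<^sub>0 powr q) * (1 + \<bar>s\<bar> powr p)" by simp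
    then show ?thesis unfolding A\<^sub>0_def pq(3) mult.assoc by (intro mult_left_mono) auto
  qed
  finally show ?thesis .
qed

lemma integrable_one_plus:
  "integrable M (\<lambda>x. \<bar>u x\<bar> powr p) \<Longrightarrow> integrable M (\<lambda>x. A * (1 + \<bar>u x\<bar> powr p))"
  by simp

lemma f_measurable:
  assumes [measurable]: "u \<in> borel_measurable M"
  shows "(\<lambda>x. f x (u x)) \<in> borel_measurable M"
    and "(\<lambda>(x, t). f x (t * u x)) \<in> borel_measurable (M \<Otimes>\<^sub>M lborel)"
proof -
  define f' where "f' z = indicator (closure \<Omega> \<times> UNIV) z *\<^sub>R (case z of (x, s) \<Rightarrow> f x s)" for z
  have "closed (closure \<Omega> \<times> (UNIV :: real set))" by (intro closed_Times) auto
  then have [measurable]: "f' \<in> borel_measurable borel"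
    unfolding f'_def by (intro borel_measurable_continuous_on_indicator f_cont) auto
  have id[measurable]: "(\<lambda>x. x) \<in> borel_measurable M"
    by (rule continuous_measurable) (rule continuous_on_id)
  have eq: "f' (x, s) = f x s" if "x \<in> \<Omega>" for x s
    using that closure_subset[of \<Omega>] by (auto simp: f'_def indicator_def)
  have "(\<lambda>x. f' (x, u x)) \<in> borel_measurable M" by measurable
  then show "(\<lambda>x. f x (u x)) \<in> borel_measurable M"
    by (rule measurable_cong[THEN iffD1, rotated]) (simp add: eq)
  have "(\<lambda>(x, t). f' (x, t * u x)) \<in> borel_measurable (M \<Otimes>\<^sub>M lborel)" by measurable
  then show "(\<lambda>(x, t). f x (t * u x)) \<in> borel_measurable (M \<Otimes>\<^sub>M lborel)"
    by (rule measurable_cong[THEN iffD1, rotated]) (auto simp: eq space_pair_measure)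
qed

text \<open>Writing the primitive as an integral over a fixed interval makes its measurability an instance of the
  measurability of parameter integrals.\<close>

lemma F_integral:
  assumes x: "x \<in> \<Omega>"
  shows "F x s = (\<integral>t. indicator {0..1} t * (s * f x (t * s)) \<partial>lborel)"
proof -
  have c: "continuous_on {0..1} (\<lambda>t. s * f x (t * s))"
    using x closure_subset
    by (intro continuous_intros continuous_on_compose2[OF f_cont_snd[of x UNIV]]) auto
  have "(\<integral>t. indicator {0..1} t *\<^sub>R (s * f x (t * s)) \<partial>lborel) = F x (1 * s) - F x (0 * s)"
  proof (rule integral_FTC_Icc[OF _ _ c])
    fix t :: real
    have "((\<lambda>t. t * s) has_real_derivative s) (at t within {0..1})" by (auto intro!: derivative_eq_intros)
    from DERIV_chain2[OF F_deriv[OF x] this]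
    have "((\<lambda>t. F x (t * s)) has_real_derivative s * f x (t * s)) (at t within {0..1})" by (simp add: mult.commute)
    then show "((\<lambda>t. F x (t * s)) has_vector_derivative s * f x (t * s)) (at t within {0..1})"
      by (simp add: has_real_derivative_iff_has_vector_derivative)
  qed simp
  then show ?thesis by simp
qed

lemma F_measurable:
  assumes u: "u \<in> borel_measurable M"
  shows "(\<lambda>x. F x (u x)) \<in> borel_measurable M"
proof -
  note [measurable] = u f_measurable(2)[OF u]
  have "(\<lambda>x. \<integral>t. indicator {0..1} t * (u x * f x (t * u x)) \<partial>lborel) \<in> borel_measurable M"
    by measurable
  then show ?thesis
    by (rule measurable_cong[THEN iffD1, rotated]) (simp add: F_integral[symmetric])
qed

lemma f_Lq:
  assumes u: "u \<in> borel_measurable M" "integrable M (\<lambda>x. \<bar>u x\<bar> powr p)"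
  shows "integrable M (\<lambda>x. \<bar>f x (u x)\<bar> powr q)"
proof (rule Bochner_Integration.integrable_bound[OF integrable_one_plus[OF u(2), of A\<^sub>0]])
  show "(\<lambda>x. \<bar>f x (u x)\<bar> powr q) \<in> borel_measurable M" using f_measurable(1)[OF u(1)] by measurable
  show "AE x in M. norm (\<bar>f x (u x)\<bar> powr q) \<le> norm (A\<^sub>0 * (1 + \<bar>u x\<bar> powr p))"
    by (rule AE_M_I) (use f_powr_bound A0_nonneg in \<open>simp add: add_nonneg_nonneg\<close>)
qed

lemma F_integrable:
  assumes u: "u \<in> borel_measurable M" "integrable M (\<lambda>x. \<bar>u x\<bar> powr p)"
  shows "integrable M (\<lambda>x. F x (u x))"
proof (rule Bochner_Integration.integrable_bound[OF integrable_one_plus[OF u(2), of "C\<^sub>1 + C\<^sub>0"]])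
  show "(\<lambda>x. F x (u x)) \<in> borel_measurable M" by (rule F_measurable[OF u(1)])
  show "AE x in M. norm (F x (u x)) \<le> norm ((C\<^sub>1 + C\<^sub>0) * (1 + \<bar>u x\<bar> powr p))"
  proof (rule AE_M_I)
    fix x assume x: "x \<in> \<Omega>"
    have "\<bar>s\<bar> \<le> 1 + \<bar>s\<bar> powr p" for s :: real
    proof (cases "\<bar>s\<bar> \<le> 1")
      case False
      then have "\<bar>s\<bar> powr 1 \<le> \<bar>s\<bar> powr p" using p1 by (intro powr_mono) auto
      then show ?thesis using False by simp
    qed (use powr_ge_zero[of "\<bar>s\<bar>" p] in linarith)
    then have "C\<^sub>1 * \<bar>u x\<bar> \<le> C\<^sub>1 * (1 + \<bar>u x\<bar> powr p)" using C_nonneg by (intro mult_left_mono) auto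
    moreover have "C\<^sub>0 * \<bar>u x\<bar> powr p \<le> C\<^sub>0 * (1 + \<bar>u x\<bar> powr p)" using C_nonneg by (intro mult_left_mono) auto
    ultimately have "\<bar>F x (u x)\<bar> \<le> (C\<^sub>1 + C\<^sub>0) * (1 + \<bar>u x\<bar> powr p)"
      using F_bound[OF x, of "u x"] by (simp only: distrib_right)
    then show "norm (F x (u x)) \<le> norm ((C\<^sub>1 + C\<^sub>0) * (1 + \<bar>u x\<bar> powr p))"
      by (simp add: order_trans[OF _ abs_ge_self])
  qed
qed

lemma f_mult_integrable:
  assumes u: "u \<in> borel_measurable M" "integrable M (\<lambda>x. \<bar>u x\<bar> powr p)"
    and h: "h \<in> borel_measurable M" "integrable M (\<lambda>x. \<bar>h x\<bar> powr p)"
  shows "integrable M (\<lambda>x. f x (u x) * h x)"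
    and "\<bar>\<integral>x. f x (u x) * h x \<partial>M\<bar> \<le> Lnorm q M (\<lambda>x. f x (u x)) * Lnorm p M h"
proof -
  note args = q1 p1 pq(2) f_measurable(1)[OF u(1)] h(1) f_Lq[OF u] h(2)
  show "integrable M (\<lambda>x. f x (u x) * h x)" by (rule integrable_powr_mult[OF args])
  have "\<bar>\<integral>x. f x (u x) * h x \<partial>M\<bar> \<le> (\<integral>x. \<bar>f x (u x) * h x\<bar> \<partial>M)" by (rule integral_abs_bound)
  also have "\<dots> \<le> Lnorm q M (\<lambda>x. f x (u x)) * Lnorm p M h" unfolding Lnorm_def by (rule holder[OF args])
  finally show "\<bar>\<integral>x. f x (u x) * h x \<partial>M\<bar> \<le> Lnorm q M (\<lambda>x. f x (u x)) * Lnorm p M h" .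
qed

lemma add_Lp:
  assumes "u \<in> borel_measurable M" "integrable M (\<lambda>x. \<bar>u x\<bar> powr p)"
    and "h \<in> borel_measurable M" "integrable M (\<lambda>x. \<bar>h x\<bar> powr p)"
  shows "integrable M (\<lambda>x. \<bar>u x + h x\<bar> powr p)"
proof (rule Bochner_Integration.integrable_bound)
  show "integrable M (\<lambda>x. 2 powr p * (\<bar>u x\<bar> powr p + \<bar>h x\<bar> powr p))" using assms by simp
  show "(\<lambda>x. \<bar>u x + h x\<bar> powr p) \<in> borel_measurable M" using assms by measurable
  show "AE x in M. norm (\<bar>u x + h x\<bar> powr p) \<le> norm (2 powr p * (\<bar>u x\<bar> powr p + \<bar>h x\<bar> powr p))"
  proof (rule AE_M_I)
    fix x
    have "\<bar>u x + h x\<bar> powr p \<le> (\<bar>u x\<bar> + \<bar>h x\<bar>) powr p" using p1 by (intro powr_mono2) auto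
    also have "\<dots> \<le> 2 powr p * (\<bar>u x\<bar> powr p + \<bar>h x\<bar> powr p)" using p1 by (intro powr_add_le) auto
    finally show "norm (\<bar>u x + h x\<bar> powr p) \<le> norm (2 powr p * (\<bar>u x\<bar> powr p + \<bar>h x\<bar> powr p))" by simp
  qed
qed

text \<open>By the mean value theorem, \<open>\<bar>D\<bar>\<close> is at most the oscillation of \<open>f\<close> between \<open>u\<close> and \<open>u + h\<close>. Where \<open>\<bar>u\<bar> \<le> k\<close>
  and \<open>\<bar>h\<bar> < \<delta>1\<close>, it is small by uniform continuity of \<open>f\<close> on a compact set. Elsewhere the growth
  condition gives a multiple of \<open>1 + \<bar>u\<bar>\<^sup>p + \<bar>h\<bar>\<^sup>p\<close>. Where \<open>\<bar>u\<bar> > k\<close>, this has a small integral for large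
  \<open>k\<close>; where \<open>\<bar>u\<bar> \<le> k\<close> and \<open>\<bar>h\<bar> \<ge> \<delta>1\<close>, it is dominated by a multiple of \<open>\<bar>h\<bar>\<^sup>p\<close>. So \<open>D\<close> is small in
  \<open>L\<^sup>q\<close> as soon as \<open>h\<close> is small in \<open>L\<^sup>p\<close>.\<close>

lemma difference_quotient_small:
  assumes u: "u \<in> borel_measurable M" "integrable M (\<lambda>x. \<bar>u x\<bar> powr p)" and \<eta>: "\<eta> > 0"
  obtains \<delta> where "\<delta> > 0"
    "\<And>h. h \<in> borel_measurable M \<Longrightarrow> integrable M (\<lambda>x. \<bar>h x\<bar> powr p) \<Longrightarrow> Lnorm p M h < \<delta> \<Longrightarrow>
      \<exists>D. D \<in> borel_measurable M \<and> integrable M (\<lambda>x. \<bar>D x\<bar> powr q) \<and> (\<integral>x. \<bar>D x\<bar> powr q \<partial>M) \<le> \<eta> \<and>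
        (\<forall>x\<in>\<Omega>. F x (u x + h x) - F x (u x) - f x (u x) * h x = D x * h x)"
proof -
  note [measurable] = u(1)
  have q0: "q > 0" using q1 by simp
  define A where "A = 2 powr q * A\<^sub>0 * (2 + 2 powr p) + 1"
  have A: "A > 0" using A0_nonneg by (simp add: A_def add_nonneg_pos)
  \<comment> \<open>The bound for \<open>D\<close> has three terms. The parameters \<open>k\<close>, \<open>\<epsilon>\<close> and \<open>\<delta>\<close> are chosen, in this order, such that
      each term contributes at most \<open>\<eta> / 4\<close>.\<close>
  define tail where "tail k x = (1 + \<bar>u x\<bar> powr p) * indicator {x. \<bar>u x\<bar> > real k} x" for k x
  have tail_int: "integrable M (tail k)" for k
  proof (rule Bochner_Integration.integrable_bound[OF integrable_one_plus[OF u(2), of 1]])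
    show "tail k \<in> borel_measurable M" unfolding tail_def indicator_def by measurable
  qed (auto simp: tail_def indicator_def)
  have "(\<lambda>k. \<integral>x. tail k x \<partial>M) \<longlonglongrightarrow> (\<integral>x. 0 \<partial>M)"
  proof (rule integral_dominated_convergence[where w = "\<lambda>x. 1 * (1 + \<bar>u x\<bar> powr p)"])
    show "integrable M (\<lambda>x. 1 * (1 + \<bar>u x\<bar> powr p))" by (rule integrable_one_plus[OF u(2)])
    show "AE x in M. (\<lambda>k. tail k x) \<longlonglongrightarrow> 0"
    proof (rule AE_M_I)
      fix x
      have "\<forall>\<^sub>F k in sequentially. tail k x = 0"
        using eventually_ge_at_top[of "nat \<lceil>\<bar>u x\<bar>\<rceil>"]
      proof eventually_elim
        case (elim k)
        then have "\<bar>u x\<bar> \<le> real k" by linarith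
        then show ?case by (simp add: tail_def)
      qed
      then show "(\<lambda>k. tail k x) \<longlonglongrightarrow> 0" by (rule tendsto_eventually)
    qed
  qed (use tail_int in \<open>auto simp: tail_def indicator_def\<close>)
  then have "(\<lambda>k. \<integral>x. tail k x \<partial>M) \<longlonglongrightarrow> 0" by simp
  moreover have "\<eta> / (4 * A) > 0" using \<eta> A by simp
  ultimately have "\<forall>\<^sub>F k in sequentially. (\<integral>x. tail k x \<partial>M) < \<eta> / (4 * A)" by (rule order_tendstoD)
  then obtain k where k: "(\<integral>x. tail k x \<partial>M) < \<eta> / (4 * A)" by (auto dest: eventually_happens)
  define \<mu> where "\<mu> = measure M (space M)"
  have \<mu>: "\<mu> \<ge> 0" by (simp add: \<mu>_def)
  define \<epsilon> where "\<epsilon> = (\<eta> / (4 * (\<mu> + 1))) powr (1 / q)"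
  have \<epsilon>0: "\<epsilon> > 0" using \<eta> \<mu> by (simp add: \<epsilon>_def)
  have \<epsilon>q: "\<epsilon> powr q = \<eta> / (4 * (\<mu> + 1))"
  proof -
    have "1 / q * q = 1" using p1 by simp
    then show ?thesis unfolding \<epsilon>_def powr_powr using \<eta> \<mu> by simp
  qed
  define T where "T = closure \<Omega> \<times> {-(real k + 1)..real k + 1}"
  have "compact T" unfolding T_def using bounded_dom by (intro compact_Times) auto
  moreover have "continuous_on T (\<lambda>(x, s). f x s)"
    by (rule continuous_on_subset[OF f_cont]) (auto simp: T_def)
  ultimately have "uniformly_continuous_on T (\<lambda>(x, s). f x s)" by (rule compact_uniformly_continuous[rotated])
  then obtain \<delta>0 where \<delta>0: "\<delta>0 > 0" "\<And>z z'. z \<in> T \<Longrightarrow> z' \<in> T \<Longrightarrow> dist z' z < \<delta>0 \<Longrightarrow>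
      dist ((\<lambda>(x, s). f x s) z') ((\<lambda>(x, s). f x s) z) < \<epsilon>"
    using \<epsilon>0 unfolding uniformly_continuous_on_def by metis
  define \<delta>1 where "\<delta>1 = min \<delta>0 1"
  have \<delta>1: "\<delta>1 > 0" "\<delta>1 \<le> 1" "\<delta>1 \<le> \<delta>0" using \<delta>0(1) by (auto simp: \<delta>1_def)
  have uc: "\<bar>f x (s + \<xi>) - f x s\<bar> < \<epsilon>" if "x \<in> \<Omega>" "\<bar>s\<bar> \<le> real k" "\<bar>\<xi>\<bar> < \<delta>1" for x s \<xi>
  proof -
    have "(x, s) \<in> T" "(x, s + \<xi>) \<in> T" using that \<delta>1 closure_subset by (auto simp: T_def)
    moreover have "dist (x, s + \<xi>) (x, s) < \<delta>0" using that \<delta>1 by (simp add: dist_Pair_Pair dist_real_def)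
    ultimately show ?thesis using \<delta>0(2)[of "(x, s)" "(x, s + \<xi>)"] by (simp add: dist_real_def)
  qed
  define c where "c = A * (1 + (1 + real k powr p) / \<delta>1 powr p)"
  have c: "c > 0" unfolding c_def using A \<delta>1 by (intro mult_pos_pos add_pos_nonneg) (auto intro: divide_nonneg_nonneg)
  define \<delta> where "\<delta> = (\<eta> / (4 * c)) powr (1 / p)"
  have \<delta>: "\<delta> > 0" using \<eta> c by (simp add: \<delta>_def)
  have \<delta>p: "\<delta> powr p = \<eta> / (4 * c)" unfolding \<delta>_def powr_powr using \<eta> c p1 by simp
  show thesis
  proof (rule that[OF \<delta>])
    fix h assume h: "h \<in> borel_measurable M" "integrable M (\<lambda>x. \<bar>h x\<bar> powr p)" "Lnorm p M h < \<delta>"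
    note [measurable] = h(1)
    define D where "D x = (if h x = 0 then 0 else (F x (u x + h x) - F x (u x) - f x (u x) * h x) / h x)" for x
    have [measurable]: "(\<lambda>x. F x (u x + h x)) \<in> borel_measurable M" "(\<lambda>x. F x (u x)) \<in> borel_measurable M"
      "(\<lambda>x. f x (u x)) \<in> borel_measurable M"
      by (intro F_measurable f_measurable(1); measurable)+
    have D_meas[measurable]: "D \<in> borel_measurable M" unfolding D_def by measurable
    have D_eq: "F x (u x + h x) - F x (u x) - f x (u x) * h x = D x * h x" if "x \<in> \<Omega>" for x
      by (simp add: D_def)
    have D_mvt: "\<exists>\<xi>. \<bar>\<xi>\<bar> \<le> \<bar>h x\<bar> \<and> \<bar>D x\<bar> \<le> \<bar>f x (u x + \<xi>) - f x (u x)\<bar>" if x: "x \<in> \<Omega>" for x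
    proof -
      obtain \<xi> where \<xi>: "\<bar>\<xi>\<bar> \<le> \<bar>h x\<bar>" "F x (u x + h x) - F x (u x) = h x * f x (u x + \<xi>)"
        using F_mvt[OF x] by metis
      have "h x \<noteq> 0 \<Longrightarrow> D x = f x (u x + \<xi>) - f x (u x)"
        by (simp add: D_def \<xi>(2) diff_divide_distrib)
      then have "\<bar>D x\<bar> \<le> \<bar>f x (u x + \<xi>) - f x (u x)\<bar>" by (cases "h x = 0") (auto simp: D_def)
      with \<xi>(1) show ?thesis by blast
    qed
    have D_gen: "\<bar>D x\<bar> powr q \<le> A * (1 + \<bar>u x\<bar> powr p + \<bar>h x\<bar> powr p)" if x: "x \<in> \<Omega>" for x
    proof -
      obtain \<xi> where \<xi>: "\<bar>\<xi>\<bar> \<le> \<bar>h x\<bar>" "\<bar>D x\<bar> \<le> \<bar>f x (u x + \<xi>) - f x (u x)\<bar>" using D_mvt[OF x] by blast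
      have "\<bar>D x\<bar> \<le> \<bar>f x (u x + \<xi>)\<bar> + \<bar>f x (u x)\<bar>" using \<xi>(2) by linarith
      then have "\<bar>D x\<bar> powr q \<le> (\<bar>f x (u x + \<xi>)\<bar> + \<bar>f x (u x)\<bar>) powr q" using q0 by (intro powr_mono2) auto
      also have "\<dots> \<le> 2 powr q * (\<bar>f x (u x + \<xi>)\<bar> powr q + \<bar>f x (u x)\<bar> powr q)"
        using q0 by (intro powr_add_le) auto
      also have "\<dots> \<le> 2 powr q * (A\<^sub>0 * (1 + \<bar>u x + \<xi>\<bar> powr p) + A\<^sub>0 * (1 + \<bar>u x\<bar> powr p))"
        by (intro mult_left_mono add_mono f_powr_bound x) auto
      also have "\<dots> = 2 powr q * A\<^sub>0 * (2 + \<bar>u x + \<xi>\<bar> powr p + \<bar>u x\<bar> powr p)" by (simp add: algebra_simps)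
      also have "\<dots> \<le> 2 powr q * A\<^sub>0 * ((2 + 2 powr p) * (1 + \<bar>u x\<bar> powr p + \<bar>h x\<bar> powr p))"
      proof (intro mult_left_mono)
        have "\<bar>u x + \<xi>\<bar> powr p \<le> (\<bar>u x\<bar> + \<bar>h x\<bar>) powr p" using \<xi>(1) p1 by (intro powr_mono2) auto
        also have "\<dots> \<le> 2 powr p * (\<bar>u x\<bar> powr p + \<bar>h x\<bar> powr p)" using p1 by (intro powr_add_le) auto
        finally have 1: "\<bar>u x + \<xi>\<bar> powr p \<le> 2 powr p * (\<bar>u x\<bar> powr p + \<bar>h x\<bar> powr p)" .
        have "2 + t * (a + b) + a \<le> (2 + t) * (1 + a + b)" if "a \<ge> 0" "b \<ge> 0" "t \<ge> 0" for a b t :: real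
          using that by (simp add: algebra_simps)
        from this[of "\<bar>u x\<bar> powr p" "\<bar>h x\<bar> powr p" "2 powr p"] 1
        show "2 + \<bar>u x + \<xi>\<bar> powr p + \<bar>u x\<bar> powr p \<le> (2 + 2 powr p) * (1 + \<bar>u x\<bar> powr p + \<bar>h x\<bar> powr p)" by simp
      qed (use A0_nonneg in simp)
      also have "\<dots> \<le> A * (1 + \<bar>u x\<bar> powr p + \<bar>h x\<bar> powr p)"
        unfolding mult.assoc[symmetric] A_def by (intro mult_right_mono) auto
      finally show ?thesis .
    qed
    have D_pt: "\<bar>D x\<bar> powr q \<le> \<epsilon> powr q + A * tail k x + c * \<bar>h x\<bar> powr p" if x: "x \<in> \<Omega>" for x
    proof -
      have nn: "\<epsilon> powr q \<ge> 0" "A * tail k x \<ge> 0" "c * \<bar>h x\<bar> powr p \<ge> 0"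
        using A c by (auto simp: tail_def indicator_def)
      consider (far) "\<bar>u x\<bar> > real k" | (near) "\<bar>u x\<bar> \<le> real k" "\<bar>h x\<bar> < \<delta>1" | (big) "\<bar>u x\<bar> \<le> real k" "\<bar>h x\<bar> \<ge> \<delta>1"
        by linarith
      then show ?thesis
      proof cases
        case far
        have "A * \<bar>h x\<bar> powr p \<le> c * \<bar>h x\<bar> powr p"
          unfolding c_def using A by (intro mult_right_mono) (auto simp: algebra_simps)
        moreover have "A * tail k x = A + A * \<bar>u x\<bar> powr p" using far by (simp add: tail_def distrib_left)
        moreover have "\<bar>D x\<bar> powr q \<le> A + A * \<bar>u x\<bar> powr p + A * \<bar>h x\<bar> powr p"
          using D_gen[OF x] by (simp add: distrib_left)
        ultimately show ?thesis using nn(1) by linarith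
      next
        case near
        obtain \<xi> where \<xi>: "\<bar>\<xi>\<bar> \<le> \<bar>h x\<bar>" "\<bar>D x\<bar> \<le> \<bar>f x (u x + \<xi>) - f x (u x)\<bar>" using D_mvt[OF x] by blast
        have "\<bar>D x\<bar> \<le> \<epsilon>" using uc[OF x near(1), of \<xi>] \<xi> near(2) by linarith
        then have "\<bar>D x\<bar> powr q \<le> \<epsilon> powr q" using q0 by (intro powr_mono2) auto
        then show ?thesis using nn by linarith
      next
        case big
        have "\<delta>1 powr p \<le> \<bar>h x\<bar> powr p" using big \<delta>1 p1 by (intro powr_mono2) auto
        then have r1: "1 \<le> \<bar>h x\<bar> powr p / \<delta>1 powr p" using \<delta>1 by (simp add: field_simps)
        have "1 + \<bar>u x\<bar> powr p \<le> 1 + real k powr p" using big p1 by (intro add_left_mono powr_mono2) auto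
        also have "\<dots> \<le> (1 + real k powr p) * (\<bar>h x\<bar> powr p / \<delta>1 powr p)"
          using mult_left_mono[OF r1, of "1 + real k powr p"] by simp
        finally have "A * (1 + \<bar>u x\<bar> powr p + \<bar>h x\<bar> powr p)
            \<le> A * ((1 + real k powr p) * (\<bar>h x\<bar> powr p / \<delta>1 powr p) + \<bar>h x\<bar> powr p)"
          using A by (intro mult_left_mono) auto
        also have "\<dots> = c * \<bar>h x\<bar> powr p" by (simp add: c_def algebra_simps)
        finally show ?thesis using D_gen[OF x] nn by linarith
      qed
    qed
    have Ri: "integrable M (\<lambda>x. \<epsilon> powr q + A * tail k x + c * \<bar>h x\<bar> powr p)" using tail_int h(2) by simp
    have Di: "integrable M (\<lambda>x. \<bar>D x\<bar> powr q)"
    proof (rule Bochner_Integration.integrable_bound[OF Ri])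
      show "AE x in M. norm (\<bar>D x\<bar> powr q) \<le> norm (\<epsilon> powr q + A * tail k x + c * \<bar>h x\<bar> powr p)"
        by (rule AE_M_I) (use D_pt in \<open>auto intro: order_trans[OF _ abs_ge_self]\<close>)
    qed measurable
    have "(\<integral>x. \<bar>D x\<bar> powr q \<partial>M) \<le> (\<integral>x. \<epsilon> powr q + A * tail k x + c * \<bar>h x\<bar> powr p \<partial>M)"
      using D_pt by (intro integral_mono Di Ri) auto
    also have "\<dots> = \<epsilon> powr q * \<mu> + A * (\<integral>x. tail k x \<partial>M) + c * (\<integral>x. \<bar>h x\<bar> powr p \<partial>M)"
      using tail_int h(2) by (simp add: \<mu>_def)
    also have "\<dots> \<le> \<eta> / 4 + \<eta> / 4 + \<eta> / 4"
    proof (intro add_mono)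
      show "\<epsilon> powr q * \<mu> \<le> \<eta> / 4" unfolding \<epsilon>q using \<eta> \<mu> by (simp add: field_simps)
      show "A * (\<integral>x. tail k x \<partial>M) \<le> \<eta> / 4" using k A by (simp add: field_simps)
      have "(\<integral>x. \<bar>h x\<bar> powr p \<partial>M) = (Lnorm p M h) powr p"
        unfolding Lnorm_def powr_powr using p1 by simp
      also have "\<dots> \<le> \<delta> powr p" using h(3) Lnorm_nonneg p1 by (intro powr_mono2) auto
      finally show "c * (\<integral>x. \<bar>h x\<bar> powr p \<partial>M) \<le> \<eta> / 4" unfolding \<delta>p using c by (simp add: field_simps)
    qed
    also have "\<dots> \<le> \<eta>" using \<eta> by simp
    finally show "\<exists>D. D \<in> borel_measurable M \<and> integrable M (\<lambda>x. \<bar>D x\<bar> powr q) \<and> (\<integral>x. \<bar>D x\<bar> powr q \<partial>M) \<le> \<eta> \<and>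
        (\<forall>x\<in>\<Omega>. F x (u x + h x) - F x (u x) - f x (u x) * h x = D x * h x)"
      using D_meas Di D_eq by blast
  qed
qed

lemma nonlinear_term_differentiable:
  assumes u: "u \<in> borel_measurable M" "integrable M (\<lambda>x. \<bar>u x\<bar> powr p)" and \<epsilon>: "\<epsilon> > 0"
  obtains \<delta> where "\<delta> > 0"
    "\<And>h. h \<in> borel_measurable M \<Longrightarrow> integrable M (\<lambda>x. \<bar>h x\<bar> powr p) \<Longrightarrow> Lnorm p M h < \<delta> \<Longrightarrow>
      \<bar>(\<integral>x. F x (u x + h x) \<partial>M) - (\<integral>x. F x (u x) \<partial>M) - (\<integral>x. f x (u x) * h x \<partial>M)\<bar> \<le> \<epsilon> * Lnorm p M h"
proof -
  have "\<epsilon> powr q > 0" using \<epsilon> by simp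
  from difference_quotient_small[OF u this] obtain \<delta> where \<delta>: "\<delta> > 0"
    "\<And>h. h \<in> borel_measurable M \<Longrightarrow> integrable M (\<lambda>x. \<bar>h x\<bar> powr p) \<Longrightarrow> Lnorm p M h < \<delta> \<Longrightarrow>
      \<exists>D. D \<in> borel_measurable M \<and> integrable M (\<lambda>x. \<bar>D x\<bar> powr q) \<and> (\<integral>x. \<bar>D x\<bar> powr q \<partial>M) \<le> \<epsilon> powr q \<and>
        (\<forall>x\<in>\<Omega>. F x (u x + h x) - F x (u x) - f x (u x) * h x = D x * h x)" by metis
  show thesis
  proof (rule that[OF \<delta>(1)])
    fix h assume h: "h \<in> borel_measurable M" "integrable M (\<lambda>x. \<bar>h x\<bar> powr p)" "Lnorm p M h < \<delta>"
    then obtain D where D: "D \<in> borel_measurable M" "integrable M (\<lambda>x. \<bar>D x\<bar> powr q)" "(\<integral>x. \<bar>D x\<bar> powr q \<partial>M) \<le> \<epsilon> powr q"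
      "\<And>x. x \<in> \<Omega> \<Longrightarrow> F x (u x + h x) - F x (u x) - f x (u x) * h x = D x * h x"
      using \<delta>(2)[OF h] by blast
    have uh: "(\<lambda>x. u x + h x) \<in> borel_measurable M" using u(1) h(1) by measurable
    have "(\<integral>x. F x (u x + h x) \<partial>M) - (\<integral>x. F x (u x) \<partial>M) - (\<integral>x. f x (u x) * h x \<partial>M)
        = (\<integral>x. F x (u x + h x) - F x (u x) - f x (u x) * h x \<partial>M)"
      using F_integrable[OF uh add_Lp[OF u h(1,2)]] F_integrable[OF u] f_mult_integrable(1)[OF u h(1,2)] by simp
    also have "\<dots> = (\<integral>x. D x * h x \<partial>M)" by (rule Bochner_Integration.integral_cong) (simp_all add: D(4))
    also have "\<bar>\<dots>\<bar> \<le> (\<integral>x. \<bar>D x * h x\<bar> \<partial>M)" by (rule integral_abs_bound)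
    also have "\<dots> \<le> (\<integral>x. \<bar>D x\<bar> powr q \<partial>M) powr (1 / q) * Lnorm p M h"
      unfolding Lnorm_def by (rule holder[OF q1 p1 pq(2) D(1) h(1) D(2) h(2)])
    also have "\<dots> \<le> \<epsilon> * Lnorm p M h"
    proof (intro mult_right_mono Lnorm_nonneg)
      have "(\<integral>x. \<bar>D x\<bar> powr q \<partial>M) powr (1 / q) \<le> (\<epsilon> powr q) powr (1 / q)" using D(3) p1 by (intro powr_mono2) auto
      also have "\<dots> = \<epsilon>"
      proof -
        have "q * (1 / q) = 1" using p1 by simp
        then show ?thesis unfolding powr_powr using \<epsilon> by simp
      qed
      finally show "(\<integral>x. \<bar>D x\<bar> powr q \<partial>M) powr (1 / q) \<le> \<epsilon>" .
    qed
    finally show "\<bar>(\<integral>x. F x (u x + h x) \<partial>M) - (\<integral>x. F x (u x) \<partial>M) - (\<integral>x. f x (u x) * h x \<partial>M)\<bar> \<le> \<epsilon> * Lnorm p M h" .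
  qed
qed

end

section \<open>The energy functional\<close>

text \<open>Both functionals approximate the same increment along \<open>t v\<close> up to \<open>o(t)\<close>.\<close>

lemma frechet_deriv_on_ray_unique:
  assumes L: "has_frechet_deriv_on J L u E \<nu>" and L': "has_frechet_deriv_on J L' u E \<nu>"
    and ray: "\<And>c. (\<lambda>x. c * v x) \<in> E" and \<nu>: "\<nu> v \<ge> 0" "\<And>c. \<nu> (\<lambda>x. c * v x) = \<bar>c\<bar> * \<nu> v"
  shows "L v = L' v"
proof -
  have v: "v \<in> E" using ray[of 1] by simp
  have "\<bar>L v - L' v\<bar> \<le> \<epsilon>" if \<epsilon>: "\<epsilon> > 0" for \<epsilon>
  proof -
    define \<epsilon>' where "\<epsilon>' = \<epsilon> / (2 * (\<nu> v + 1))"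
    have \<epsilon>': "\<epsilon>' > 0" using \<epsilon> \<nu>(1) by (simp add: \<epsilon>'_def)
    obtain \<delta> where \<delta>: "\<delta> > 0" "\<And>h. h \<in> E \<Longrightarrow> \<nu> h < \<delta> \<Longrightarrow> \<bar>J (\<lambda>x. u x + h x) - J u - L h\<bar> \<le> \<epsilon>' * \<nu> h"
      using L \<epsilon>' unfolding has_frechet_deriv_on_def by blast
    obtain \<delta>' where \<delta>': "\<delta>' > 0" "\<And>h. h \<in> E \<Longrightarrow> \<nu> h < \<delta>' \<Longrightarrow> \<bar>J (\<lambda>x. u x + h x) - J u - L' h\<bar> \<le> \<epsilon>' * \<nu> h"
      using L' \<epsilon>' unfolding has_frechet_deriv_on_def by blast
    define t where "t = min \<delta> \<delta>' / (2 * (\<nu> v + 1))"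
    have t: "t > 0" using \<delta>(1) \<delta>'(1) \<nu>(1) by (simp add: t_def)
    have "t * \<nu> v \<le> t * (\<nu> v + 1)" using t by simp
    also have "\<dots> = min \<delta> \<delta>' / 2"
    proof -
      have "x / (2 * y) * y = x / 2" if "y > 0" for x y :: real using that by simp
      from this[of "\<nu> v + 1"] show ?thesis unfolding t_def using \<nu>(1) by simp
    qed
    finally have small: "\<nu> (\<lambda>x. t * v x) < \<delta>" "\<nu> (\<lambda>x. t * v x) < \<delta>'"
      using \<delta>(1) \<delta>'(1) t by (auto simp: \<nu>(2))
    have lin: "L (\<lambda>x. t * v x) = t * L v" "L' (\<lambda>x. t * v x) = t * L' v"
      using L L' v unfolding has_frechet_deriv_on_def by blast+
    have "t * \<bar>L v - L' v\<bar> = \<bar>L (\<lambda>x. t * v x) - L' (\<lambda>x. t * v x)\<bar>"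
      using t by (simp add: lin abs_mult flip: right_diff_distrib)
    also have "\<dots> \<le> \<epsilon>' * \<nu> (\<lambda>x. t * v x) + \<epsilon>' * \<nu> (\<lambda>x. t * v x)"
      using \<delta>(2)[OF ray small(1)] \<delta>'(2)[OF ray small(2)] by linarith
    also have "\<dots> = t * (2 * \<epsilon>' * \<nu> v)" using t by (simp add: \<nu>(2))
    finally have "\<bar>L v - L' v\<bar> \<le> 2 * \<epsilon>' * \<nu> v" using t by simp
    also have "\<dots> = \<epsilon> * (\<nu> v / (\<nu> v + 1))"
    proof -
      have "2 * (\<epsilon> / (2 * y)) * x = \<epsilon> * (x / y)" for x y by simp
      then show ?thesis by (simp only: \<epsilon>'_def)
    qed
    also have "\<dots> \<le> \<epsilon> * 1" using \<epsilon> \<nu>(1) by (intro mult_left_mono) auto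
    finally show ?thesis by simp
  qed
  then show ?thesis using field_le_epsilon[of "\<bar>L v - L' v\<bar>" 0] by simp
qed

text \<open>Dividing by \<open>X\<close> leaves a right-hand side of order \<open>X\<^sup>\<tau>\<close>, which is at most half of \<open>X\<close> plus a constant.\<close>

lemma sublinear_absorption:
  fixes K S a b \<tau> :: real
  assumes "K \<ge> 0" "S \<ge> 0" "a \<ge> 0" "b \<ge> 0" and \<tau>: "0 < \<tau>" "\<tau> < 1"
  obtains B where "\<And>X. X \<ge> 0 \<Longrightarrow> X\<^sup>2 \<le> K * X + S * (a + b * X) powr \<tau> * X \<Longrightarrow> X \<le> B"
proof -
  define \<epsilon> where "\<epsilon> = 1 / (2 * (b + 1))"
  have \<epsilon>: "\<epsilon> > 0" "\<epsilon> * b \<le> 1 / 2" using assms by (auto simp: \<epsilon>_def field_simps)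
  \<comment> \<open>the point where \<open>S Y\<^sup>\<tau> = \<epsilon> Y\<close>\<close>
  define Y0 where "Y0 = (S / \<epsilon>) powr (1 / (1 - \<tau>))"
  have Y0: "Y0 \<ge> 0" by (simp add: Y0_def)
  have absorb: "S * Y powr \<tau> \<le> \<epsilon> * Y + S * Y0 powr \<tau>" if Y: "Y \<ge> 0" for Y
  proof (cases "Y \<le> Y0")
    case True
    then have "S * Y powr \<tau> \<le> S * Y0 powr \<tau>" using Y \<tau> assms by (intro mult_left_mono powr_mono2) auto
    moreover have "\<epsilon> * Y \<ge> 0" using Y \<epsilon> by simp
    ultimately show ?thesis by linarith
  next
    case False
    then have Yp: "Y > 0" using Y0 by linarith
    have "Y0 powr (1 - \<tau>) \<le> Y powr (1 - \<tau>)" using False Y0 \<tau> by (intro powr_mono2) auto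
    moreover have "Y0 powr (1 - \<tau>) = S / \<epsilon>" using \<tau> \<epsilon> assms by (simp add: Y0_def powr_powr)
    ultimately have "S \<le> \<epsilon> * Y powr (1 - \<tau>)" using \<epsilon> by (simp add: field_simps)
    then have "S * Y powr \<tau> \<le> \<epsilon> * Y powr (1 - \<tau>) * Y powr \<tau>" by (intro mult_right_mono) auto
    also have "\<dots> = \<epsilon> * Y" using Yp by (simp add: mult.assoc flip: powr_add)
    finally have "S * Y powr \<tau> \<le> \<epsilon> * Y" .
    moreover have "S * Y0 powr \<tau> \<ge> 0" using assms by simp
    ultimately show ?thesis by linarith
  qed
  show thesis
  proof (rule that)
    fix X :: real assume X: "X \<ge> 0" "X\<^sup>2 \<le> K * X + S * (a + b * X) powr \<tau> * X"
    show "X \<le> 2 * (K + \<epsilon> * a + S * Y0 powr \<tau>)"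
    proof (cases "X = 0")
      case True
      have "\<epsilon> * a \<ge> 0" "S * Y0 powr \<tau> \<ge> 0" using assms \<epsilon> by auto
      then show ?thesis using True assms(1) by simp
    next
      case False
      then have "X > 0" using X by simp
      moreover have "X * X \<le> X * (K + S * (a + b * X) powr \<tau>)"
        using X(2) by (simp add: power2_eq_square algebra_simps)
      ultimately have "X \<le> K + S * (a + b * X) powr \<tau>" by simp
      also have "S * (a + b * X) powr \<tau> \<le> \<epsilon> * (a + b * X) + S * Y0 powr \<tau>"
        using assms X(1) by (intro absorb) auto
      finally have "X \<le> K + \<epsilon> * a + (\<epsilon> * b) * X + S * Y0 powr \<tau>" by (simp add: algebra_simps)
      moreover have "(\<epsilon> * b) * X \<le> 1 / 2 * X" using \<epsilon> X(1) by (intro mult_right_mono) auto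
      moreover have "X \<le> 2 * (k + e + y)" if "X \<le> k + e + z + y" "z \<le> 1 / 2 * X" for k e y z :: real
        using that by simp
      ultimately show ?thesis by blast
    qed
  qed
qed

lemma (in bounded_open) bounded_on_slab:
  fixes f :: "real^'n \<Rightarrow> real \<Rightarrow> real"
  assumes "continuous_on (closure \<Omega> \<times> UNIV) (\<lambda>(x, s). f x s)"
  obtains B where "B > 0" "\<And>x s. x \<in> \<Omega> \<Longrightarrow> \<bar>s\<bar> \<le> R \<Longrightarrow> \<bar>f x s\<bar> \<le> B"
proof -
  have "compact (closure \<Omega> \<times> {-R..R})" using bounded_dom by (intro compact_Times) auto
  moreover have "continuous_on (closure \<Omega> \<times> {-R..R}) (\<lambda>(x, s). f x s)"
    by (rule continuous_on_subset[OF assms]) auto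
  ultimately have "bounded ((\<lambda>(x, s). f x s) ` (closure \<Omega> \<times> {-R..R}))"
    by (intro compact_imp_bounded compact_continuous_image)
  then obtain B where B: "B > 0" "\<And>z. z \<in> (\<lambda>(x, s). f x s) ` (closure \<Omega> \<times> {-R..R}) \<Longrightarrow> norm z \<le> B"
    unfolding bounded_pos by blast
  show thesis
  proof (rule that[OF B(1)])
    fix x s assume "x \<in> \<Omega>" "\<bar>s\<bar> \<le> R"
    then have "(x, s) \<in> closure \<Omega> \<times> {-R..R}" using closure_subset[of \<Omega>] by auto
    then show "\<bar>f x s\<bar> \<le> B" using B(2)[of "f x s"] by (force simp: image_iff)
  qed
qed

text \<open>What the Navier and the Dirichlet space have in common for the variational argument; \<open>S\<close> is the constant of
  the Sobolev embedding.\<close>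

locale energy_space = growth_nonlinearity \<Omega> f p C\<^sub>0 C\<^sub>1
  for \<Omega> :: "(real^'n::finite) set" and f p C\<^sub>0 C\<^sub>1 +
  fixes m :: nat and E :: "(real^'n \<Rightarrow> real) set" and S :: real
  assumes E_sobolev: "v \<in> E \<Longrightarrow> v \<in> sobolev m \<Omega>"
    and E_cmult: "v \<in> E \<Longrightarrow> (\<lambda>x. c * v x) \<in> E"
    and S_nonneg: "S \<ge> 0"
    and embedding: "v \<in> E \<Longrightarrow> integrable M (\<lambda>x. \<bar>v x\<bar> powr p)" "v \<in> E \<Longrightarrow> Lnorm p M v \<le> S * norm_m m \<Omega> v"
begin

lemma E_measurable: "v \<in> E \<Longrightarrow> v \<in> borel_measurable M"
  by (rule L2_measurable[OF sobolev_L2[OF E_sobolev]])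

lemma energy_has_frechet_deriv:
  assumes u: "u \<in> E"
  shows "has_frechet_deriv_on (energy m \<Omega> f) (\<lambda>\<phi>. inner_m m \<Omega> u \<phi> - (\<integral>x. f x (u x) * \<phi> x \<partial>M)) u E (norm_m m \<Omega>)"
  unfolding has_frechet_deriv_on_def
proof (intro conjI ballI allI impI)
  note us = E_sobolev[OF u] and um = E_measurable[OF u] and ui = embedding(1)[OF u]
  note fi = f_mult_integrable(1)[OF um ui E_measurable embedding(1)]
  fix \<phi> \<psi> assume \<phi>: "\<phi> \<in> E" and \<psi>: "\<psi> \<in> E"
  show "inner_m m \<Omega> u (\<lambda>x. \<phi> x + \<psi> x) - (\<integral>x. f x (u x) * (\<phi> x + \<psi> x) \<partial>M)
    = inner_m m \<Omega> u \<phi> - (\<integral>x. f x (u x) * \<phi> x \<partial>M) + (inner_m m \<Omega> u \<psi> - (\<integral>x. f x (u x) * \<psi> x \<partial>M))"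
    using inner_m_linear[OF us E_sobolev[OF \<phi>] E_sobolev[OF \<psi>], of 1] fi[OF \<phi> \<phi>] fi[OF \<psi> \<psi>]
    by (simp add: distrib_left)
next
  note us = E_sobolev[OF u]
  fix c \<phi> assume \<phi>: "\<phi> \<in> E"
  have "(\<integral>x. f x (u x) * (c * \<phi> x) \<partial>M) = c * (\<integral>x. f x (u x) * \<phi> x \<partial>M)"
    by (simp add: mult.left_commute)
  then show "inner_m m \<Omega> u (\<lambda>x. c * \<phi> x) - (\<integral>x. f x (u x) * (c * \<phi> x) \<partial>M)
    = c * (inner_m m \<Omega> u \<phi> - (\<integral>x. f x (u x) * \<phi> x \<partial>M))"
    using inner_m_linear[OF us E_sobolev[OF \<phi>] E_sobolev[OF \<phi>], of "c - 1"] by (simp add: algebra_simps)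
next
  note us = E_sobolev[OF u] and um = E_measurable[OF u] and ui = embedding(1)[OF u]
  let ?K = "real (card (top_index m)) * norm_m m \<Omega> u + Lnorm q M (\<lambda>x. f x (u x)) * S"
  have "\<bar>inner_m m \<Omega> u \<phi> - (\<integral>x. f x (u x) * \<phi> x \<partial>M)\<bar> \<le> ?K * norm_m m \<Omega> \<phi>" if \<phi>: "\<phi> \<in> E" for \<phi>
  proof -
    have "\<bar>\<integral>x. f x (u x) * \<phi> x \<partial>M\<bar> \<le> Lnorm q M (\<lambda>x. f x (u x)) * Lnorm p M \<phi>"
      by (rule f_mult_integrable(2)[OF um ui E_measurable[OF \<phi>] embedding(1)[OF \<phi>]])
    also have "\<dots> \<le> Lnorm q M (\<lambda>x. f x (u x)) * (S * norm_m m \<Omega> \<phi>)"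
      by (intro mult_left_mono embedding(2)[OF \<phi>] Lnorm_nonneg)
    finally have "\<bar>\<integral>x. f x (u x) * \<phi> x \<partial>M\<bar> \<le> Lnorm q M (\<lambda>x. f x (u x)) * S * norm_m m \<Omega> \<phi>" by (simp add: mult.assoc)
    with inner_m_bounded[OF us E_sobolev[OF \<phi>]] show ?thesis by (simp add: distrib_right mult.assoc)
  qed
  then show "\<exists>K. \<forall>\<phi>\<in>E. \<bar>inner_m m \<Omega> u \<phi> - (\<integral>x. f x (u x) * \<phi> x \<partial>M)\<bar> \<le> K * norm_m m \<Omega> \<phi>" by blast
next
  note us = E_sobolev[OF u] and um = E_measurable[OF u] and ui = embedding(1)[OF u]
  fix \<epsilon> :: real assume \<epsilon>: "\<epsilon> > 0"
  have \<epsilon>': "\<epsilon> / (2 * (S + 1)) > 0" using \<epsilon> S_nonneg by simp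
  obtain \<delta>' where \<delta>': "\<delta>' > 0"
    "\<And>h. h \<in> borel_measurable M \<Longrightarrow> integrable M (\<lambda>x. \<bar>h x\<bar> powr p) \<Longrightarrow> Lnorm p M h < \<delta>' \<Longrightarrow>
      \<bar>(\<integral>x. F x (u x + h x) \<partial>M) - (\<integral>x. F x (u x) \<partial>M) - (\<integral>x. f x (u x) * h x \<partial>M)\<bar> \<le> \<epsilon> / (2 * (S + 1)) * Lnorm p M h"
    by (rule nonlinear_term_differentiable[OF um ui \<epsilon>']) (rule that)
  define \<delta> where "\<delta> = min \<epsilon> (\<delta>' / (S + 1))"
  have "\<delta> > 0" using \<epsilon> \<delta>'(1) S_nonneg by (simp add: \<delta>_def)
  moreover have "\<bar>energy m \<Omega> f (\<lambda>x. u x + h x) - energy m \<Omega> f u - (inner_m m \<Omega> u h - (\<integral>x. f x (u x) * h x \<partial>M))\<bar>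
      \<le> \<epsilon> * norm_m m \<Omega> h" if h: "h \<in> E" and small: "norm_m m \<Omega> h < \<delta>" for h
  proof -
    let ?n = "norm_m m \<Omega> h"
    have n0: "?n \<ge> 0" by (rule norm_m_nonneg[OF E_sobolev[OF h]])
    have le: "Lnorm p M h \<le> (S + 1) * ?n"
      using embedding(2)[OF h] n0 by (simp add: distrib_right)
    also have "\<dots> < (S + 1) * (\<delta>' / (S + 1))"
      using small S_nonneg by (intro mult_strict_left_mono) (auto simp: \<delta>_def)
    also have "\<dots> = \<delta>'" using S_nonneg by simp
    finally have "Lnorm p M h < \<delta>'" .
    from \<delta>'(2)[OF E_measurable[OF h] embedding(1)[OF h] this]
    have "\<bar>(\<integral>x. F x (u x + h x) \<partial>M) - (\<integral>x. F x (u x) \<partial>M) - (\<integral>x. f x (u x) * h x \<partial>M)\<bar> \<le> \<epsilon> / (2 * (S + 1)) * Lnorm p M h" .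
    also have "\<dots> \<le> \<epsilon> / (2 * (S + 1)) * ((S + 1) * ?n)"
      using le \<epsilon> S_nonneg by (intro mult_left_mono) auto
    also have "\<dots> = \<epsilon> / 2 * ?n" using S_nonneg by (simp add: field_simps)
    finally have nl: "\<bar>(\<integral>x. F x (u x + h x) \<partial>M) - (\<integral>x. F x (u x) \<partial>M) - (\<integral>x. f x (u x) * h x \<partial>M)\<bar> \<le> \<epsilon> / 2 * ?n" .
    have "?n * ?n \<le> \<epsilon> * ?n" using small n0 by (intro mult_right_mono) (auto simp: \<delta>_def)
    then have sq: "1 / 2 * ?n\<^sup>2 \<le> \<epsilon> / 2 * ?n" by (simp add: power2_eq_square)
    have eq: "energy m \<Omega> f (\<lambda>x. u x + h x) - energy m \<Omega> f u - (inner_m m \<Omega> u h - (\<integral>x. f x (u x) * h x \<partial>M))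
      = 1 / 2 * ?n\<^sup>2 - ((\<integral>x. F x (u x + h x) \<partial>M) - (\<integral>x. F x (u x) \<partial>M) - (\<integral>x. f x (u x) * h x \<partial>M))"
      unfolding energy_def norm_m_add_square[OF us E_sobolev[OF h]] by (simp add: algebra_simps)
    have "\<bar>a - y\<bar> \<le> \<epsilon> * ?n" if "\<bar>y\<bar> \<le> \<epsilon> / 2 * ?n" "a \<le> \<epsilon> / 2 * ?n" "a \<ge> 0" for a y
      using that by (simp add: field_simps)
    from this[OF nl sq] show ?thesis unfolding eq by simp
  qed
  ultimately show "\<exists>\<delta>>0. \<forall>h\<in>E. norm_m m \<Omega> h < \<delta> \<longrightarrow>
    \<bar>energy m \<Omega> f (\<lambda>x. u x + h x) - energy m \<Omega> f u - (inner_m m \<Omega> u h - (\<integral>x. f x (u x) * h x \<partial>M))\<bar> \<le> \<epsilon> * norm_m m \<Omega> h"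
    by blast
qed

text \<open>The derivative is chosen among all Frechet derivatives at \<open>u\<close>; there is one, and they agree in the direction
  \<open>u\<close>.\<close>

lemma energy_deriv_self:
  assumes u: "u \<in> E"
  shows "energy_deriv E m \<Omega> f u u = (norm_m m \<Omega> u)\<^sup>2 - (\<integral>x. f x (u x) * u x \<partial>M)"
proof -
  have "has_frechet_deriv_on (energy m \<Omega> f) (energy_deriv E m \<Omega> f u) u E (norm_m m \<Omega>)"
    using someI[of "\<lambda>L. has_frechet_deriv_on (energy m \<Omega> f) L u E (norm_m m \<Omega>)", OF energy_has_frechet_deriv[OF u]]
    by (simp add: energy_deriv_def)
  from frechet_deriv_on_ray_unique[OF this energy_has_frechet_deriv[OF u] E_cmult[OF u]
      norm_m_nonneg[OF E_sobolev[OF u]] norm_m_cmult[OF E_sobolev[OF u]]]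
  show ?thesis by (simp add: inner_m_self[OF E_sobolev[OF u]])
qed

text \<open>Condition (b), which concerns large \<open>s\<close> only, holds for all \<open>s\<close> after adding a constant \<open>D\<close> to the right-hand
  side, since \<open>f\<close> is bounded for \<open>s\<close> in a compact interval. Integrated, it bounds \<open>\<integral> \<bar>f(x, u\<^sub>n)\<bar>\<^sup>q\<close> by
  \<open>2 J(u\<^sub>n) - J'(u\<^sub>n) u\<^sub>n\<close> plus a constant, hence linearly in the norm of \<open>u\<^sub>n\<close>.\<close>

lemma bounded_energy_and_derivative_imp_bounded:
  assumes b: "c > 0" "\<And>x s. x \<in> \<Omega> \<Longrightarrow> \<bar>s\<bar> > s\<^sub>0 \<Longrightarrow> c * \<bar>f x s\<bar> powr q \<le> s * f x s - 2 * F x s"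
    and u: "\<And>n. u n \<in> E" and J: "\<And>n. energy m \<Omega> f (u n) \<le> A"
    and J': "\<And>n \<phi>. \<phi> \<in> E \<Longrightarrow> \<bar>energy_deriv E m \<Omega> f (u n) \<phi>\<bar> \<le> K * norm_m m \<Omega> \<phi>"
  shows "\<exists>B. \<forall>n. norm_m m \<Omega> (u n) \<le> B"
proof -
  define R where "R = max s\<^sub>0 0"
  obtain B where B: "B > 0" "\<And>x s. x \<in> \<Omega> \<Longrightarrow> \<bar>s\<bar> \<le> R \<Longrightarrow> \<bar>f x s\<bar> \<le> B"
    using bounded_on_slab[OF f_cont] by metis
  define D where "D = c * B powr q + 3 * R * B"
  have R0: "R \<ge> 0" by (simp add: R_def)
  have pt: "c * \<bar>f x s\<bar> powr q \<le> s * f x s - 2 * F x s + D" if x: "x \<in> \<Omega>" for x s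
  proof (cases "\<bar>s\<bar> > R")
    case True
    have "D \<ge> 0" unfolding D_def using b(1) B(1) R0 by simp
    with b(2)[OF x, of s] True show ?thesis by (simp add: R_def)
  next
    case False
    then have s: "\<bar>s\<bar> \<le> R" by simp
    have "\<bar>f x s\<bar> powr q \<le> B powr q" using B(2)[OF x s] p1 by (intro powr_mono2) auto
    then have 1: "c * \<bar>f x s\<bar> powr q \<le> c * B powr q" using b(1) by simp
    have 2: "\<bar>s * f x s\<bar> \<le> R * B" unfolding abs_mult using s B(2)[OF x s] R0 by (intro mult_mono) auto
    obtain \<xi> where \<xi>: "\<bar>\<xi>\<bar> \<le> \<bar>s\<bar>" "F x (0 + s) - F x 0 = s * f x (0 + \<xi>)" using F_mvt[OF x] by metis
    have "\<bar>s * f x \<xi>\<bar> \<le> R * B" unfolding abs_mult using s B(2)[OF x, of \<xi>] R0 \<xi>(1) by (intro mult_mono) auto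
    then have 3: "\<bar>F x s\<bar> \<le> R * B" using \<xi>(2) by simp
    have "D = c * B powr q + 3 * (R * B)" by (simp add: D_def)
    with 1 2 3 show ?thesis by linarith
  qed
  define \<mu> where "\<mu> = measure M (space M)"
  define K' where "K' = max K 0"
  define a where "a = max ((2 * A + D * \<mu>) / c) 0"
  define b' where "b' = K' / c"
  have "0 < 1 / q" "1 / q < 1" using p1 by auto
  then obtain B' where B': "\<And>X. X \<ge> 0 \<Longrightarrow> X\<^sup>2 \<le> K' * X + S * (a + b' * X) powr (1 / q) * X \<Longrightarrow> X \<le> B'"
    using sublinear_absorption[of K' S a b' "1 / q"] S_nonneg b(1) by (auto simp: K'_def a_def b'_def)
  have "norm_m m \<Omega> (u n) \<le> B'" for n
  proof (rule B')
    let ?X = "norm_m m \<Omega> (u n)"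
    note un = u[of n]
    note um = E_measurable[OF un] and ui = embedding(1)[OF un]
    show X0: "?X \<ge> 0" by (rule norm_m_nonneg[OF E_sobolev[OF un]])
    have fu: "integrable M (\<lambda>x. f x (u n x) * u n x)" by (rule f_mult_integrable(1)[OF um ui um ui])
    have Fu: "integrable M (\<lambda>x. F x (u n x))" by (rule F_integrable[OF um ui])
    have fq: "integrable M (\<lambda>x. \<bar>f x (u n x)\<bar> powr q)" by (rule f_Lq[OF um ui])
    have "K * ?X \<le> K' * ?X" using X0 by (intro mult_right_mono) (auto simp: K'_def)
    with J'[OF un, of n] have dJ: "\<bar>?X\<^sup>2 - (\<integral>x. f x (u n x) * u n x \<partial>M)\<bar> \<le> K' * ?X"
      unfolding energy_deriv_self[OF un] by linarith
    have "c * (\<integral>x. \<bar>f x (u n x)\<bar> powr q \<partial>M) = (\<integral>x. c * \<bar>f x (u n x)\<bar> powr q \<partial>M)" by simp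
    also have "\<dots> \<le> (\<integral>x. f x (u n x) * u n x - 2 * F x (u n x) + D \<partial>M)"
      using fq fu Fu pt by (intro integral_mono) (auto simp: mult.commute)
    also have "\<dots> = (\<integral>x. f x (u n x) * u n x \<partial>M) - 2 * (\<integral>x. F x (u n x) \<partial>M) + D * \<mu>"
      using fu Fu by (simp add: \<mu>_def)
    also have "\<dots> \<le> 2 * A + K' * ?X + D * \<mu>"
      using J[of n] dJ unfolding energy_def by linarith
    finally have "(\<integral>x. \<bar>f x (u n x)\<bar> powr q \<partial>M) \<le> (2 * A + D * \<mu>) / c + b' * ?X"
      using b(1) by (simp add: b'_def field_simps)
    then have "(\<integral>x. \<bar>f x (u n x)\<bar> powr q \<partial>M) \<le> a + b' * ?X" by (simp add: a_def)
    then have fn: "Lnorm q M (\<lambda>x. f x (u n x)) \<le> (a + b' * ?X) powr (1 / q)"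
      unfolding Lnorm_def using p1 by (intro powr_mono2) auto
    have "\<bar>\<integral>x. f x (u n x) * u n x \<partial>M\<bar> \<le> Lnorm q M (\<lambda>x. f x (u n x)) * Lnorm p M (u n)"
      by (rule f_mult_integrable(2)[OF um ui um ui])
    also have "\<dots> \<le> (a + b' * ?X) powr (1 / q) * (S * ?X)"
      by (intro mult_mono fn embedding(2)[OF un] Lnorm_nonneg) simp
    finally show "?X\<^sup>2 \<le> K' * ?X + S * (a + b' * ?X) powr (1 / q) * ?X"
      using dJ by (simp add: mult_ac)
  qed
  then show ?thesis by blast
qed

end

theorem proposition1p2:
  fixes \<Omega> :: "(real^'n::finite) set"
    and f :: "real^'n \<Rightarrow> real \<Rightarrow> real"
    and E :: "(real^'n \<Rightarrow> real) set"
    and u :: "nat \<Rightarrow> real^'n \<Rightarrow> real"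
    and m N :: nat
  assumes "N = CARD('n)" and "m \<ge> 1" and "N \<ge> 2 * m + 1" and "N \<ge> 2"
    and "bounded_smooth_domain \<Omega>"
    and "E = H_navier m \<Omega> \<or> E = H_dirichlet m \<Omega>"
    and "continuous_on (closure \<Omega> \<times> UNIV) (\<lambda>(x, s). f x s)"
    and a: "\<exists>C\<^sub>0>0. \<exists>s\<^sub>0>0. \<forall>s. \<forall>x\<in>\<Omega>. \<bar>s\<bar> \<ge> s\<^sub>0 \<longrightarrow>
        \<bar>f x s\<bar> \<le> C\<^sub>0 * \<bar>s\<bar> powr ((real N + 2 * real m) / (real N - 2 * real m))"
    and b: "\<exists>C>0. \<exists>s\<^sub>0>0. \<forall>s. \<forall>x\<in>\<Omega>. \<bar>s\<bar> > s\<^sub>0 \<longrightarrow>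
        C * \<bar>f x s\<bar> powr (2 * real N / (real N + 2 * real m)) \<le> s * f x s - 2 * primitive f x s \<and>
        s * f x s - 2 * primitive f x s > 0"
    and "\<forall>n. u n \<in> E"
    and "bdd_above (range (\<lambda>n. energy m \<Omega> f (u n)))"
    and "\<exists>K. \<forall>n. \<forall>\<phi>\<in>E. \<bar>energy_deriv E m \<Omega> f (u n) \<phi>\<bar> \<le> K * norm_m m \<Omega> \<phi>"
  shows "\<exists>B. \<forall>n. norm_m m \<Omega> (u n) \<le> B"
proof -
  interpret bounded_open_dim \<Omega> N
    using assms(1-5) by unfold_locales (auto simp: bounded_smooth_domain_def)
  define p where "p = 2 * real N / (real N - 2 * real m)"
  have Nm: "real N - 2 * real m > 0" "real N \<ge> 3" "real m \<ge> 1" using assms(2,3) N3 by linarith+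
  have p: "p > 1" "(real N + 2 * real m) / (real N - 2 * real m) = p - 1"
    using Nm by (auto simp: p_def field_simps)
  have q: "2 * real N / (real N + 2 * real m) = p / (p - 1)"
    unfolding p(2)[symmetric] using Nm by (simp add: p_def)
  obtain C\<^sub>0 s\<^sub>0 where C0: "C\<^sub>0 > 0" "s\<^sub>0 > 0" "\<And>x s. x \<in> \<Omega> \<Longrightarrow> \<bar>s\<bar> \<ge> s\<^sub>0 \<Longrightarrow> \<bar>f x s\<bar> \<le> C\<^sub>0 * \<bar>s\<bar> powr (p - 1)"
    using a unfolding p(2) by blast
  obtain C\<^sub>1 where C1: "C\<^sub>1 > 0" "\<And>x s. x \<in> \<Omega> \<Longrightarrow> \<bar>s\<bar> \<le> s\<^sub>0 \<Longrightarrow> \<bar>f x s\<bar> \<le> C\<^sub>1"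
    using bounded_on_slab[OF assms(7)] by metis
  obtain S where S: "S \<ge> 0" "\<And>v. v \<in> H_navier m \<Omega> \<Longrightarrow> integrable M (\<lambda>x. \<bar>v x\<bar> powr p) \<and> Lnorm p M v \<le> S * norm_m m \<Omega> v"
    using sobolev_embedding[OF assms(3)] unfolding p_def by metis
  have E_sub: "E \<subseteq> H_navier m \<Omega>" using assms(6) H_dirichlet_subset_navier by blast
  interpret energy_space \<Omega> f p C\<^sub>0 C\<^sub>1 m E S
  proof unfold_locales
    show "continuous_on (closure \<Omega> \<times> UNIV) (\<lambda>(x, s). f x s)" by fact
    show "1 < p" "0 \<le> C\<^sub>0" "0 \<le> C\<^sub>1" "0 \<le> S" using p C0 C1 S by auto
    show "\<bar>f x s\<bar> \<le> C\<^sub>1 + C\<^sub>0 * \<bar>s\<bar> powr (p - 1)" if "x \<in> \<Omega>" for x s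
    proof (cases "\<bar>s\<bar> \<le> s\<^sub>0")
      case True
      then have "\<bar>f x s\<bar> \<le> C\<^sub>1" using C1 that by blast
      moreover have "C\<^sub>0 * \<bar>s\<bar> powr (p - 1) \<ge> 0" using C0(1) by simp
      ultimately show ?thesis by linarith
    next
      case False
      then have "\<bar>f x s\<bar> \<le> C\<^sub>0 * \<bar>s\<bar> powr (p - 1)" using C0(3) that by simp
      then show ?thesis using C1(1) by linarith
    qed
    show "v \<in> sobolev m \<Omega>" if "v \<in> E" for v using that E_sub by (auto simp: H_navier_def)
    show "(\<lambda>x. c * v x) \<in> E" if "v \<in> E" for v c
      using assms(6) that H_navier_cmult H_dirichlet_cmult by auto
    show "integrable M (\<lambda>x. \<bar>v x\<bar> powr p)" "Lnorm p M v \<le> S * norm_m m \<Omega> v" if "v \<in> E" for v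
      using S(2) E_sub that by auto
  qed
  obtain C s\<^sub>1 where C: "C > 0" "\<And>x s. x \<in> \<Omega> \<Longrightarrow> \<bar>s\<bar> > s\<^sub>1 \<Longrightarrow> C * \<bar>f x s\<bar> powr (p / (p - 1)) \<le> s * f x s - 2 * primitive f x s"
    using b unfolding q by blast
  obtain A where A: "\<And>n. energy m \<Omega> f (u n) \<le> A" using assms(11) by (auto simp: bdd_above_def)
  obtain K where K: "\<And>n \<phi>. \<phi> \<in> E \<Longrightarrow> \<bar>energy_deriv E m \<Omega> f (u n) \<phi>\<bar> \<le> K * norm_m m \<Omega> \<phi>" using assms(12) by blast
  show ?thesis
    by (rule bounded_energy_and_derivative_imp_bounded[OF C _ A K]) (use assms(10) in auto)
qed

end
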